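(* Let $k$ be a field with $\operatorname{char}(k)=0$ and let $d,r$ be positive integers with $r\le P(d)$. If $m$ is large enough for the binomial construction in degree $d$ (defined in the context), then for all $n\ge m$ the following hold. 1. The map $\eta_{m,n}$ restricts to a bijection $\eta_{m,n}:\mathcal{SI}^g(R_m)\to\mathcal{SI}^g(R_n)$. 2. $\pi_{m,n}(O_m)\subseteq O_n$. 3. The diagram with vertices $O_m$, $O_n$, $G$, $\mathcal{SI}^g(R_m)$, $\mathcal{SI}^g(R_n)$ and (restricted) maps $\pi_{m,n}:O_m\to O_n$, $\Phi_m:O_m\to\mathcal{SI}^g(R_m)$, $\Phi_n:O_n\to\mathcal{SI}^g(R_n)$, $\alpha_m:O_m\to G$, $\alpha_n:O_n\to G$, $\Psi_m:G\to\mathcal{SI}^g(R_m)$, $\Psi_n:G\to\mathcal{SI}^g(R_n)$, $\eta_{m,n}:\mathcal{SI}^g(R_m)\to\mathcal{SI}^g(R_n)$ commutes, i.e. $\Phi_m=\Psi_m\alpha_m$, $\Phi_n=\Psi_n\alpha_n$, $\alpha_n\pi_{m,n}=\alpha_m$, $\eta_{m,n}\Phi_m=\Phi_n\pi_{m,n}$, $\eta_{m,n}\Psi_m=\Psi_n$; and the maps $\Psi_m$, $\Psi_n$, $\eta_{m,n}$ in the triangle on $G$, $\mathcal{SI}^g(R_m)$, $\mathcal{SI}^g(R_n)$ are bijections. In particular, if $I$ is a general $(r,d)$-symmetric ideal of $R_m$, then $I_{\mathfrak S_n}$ is a general $(r,d)$-symmetric ideal of $R_n$ for all $n\ge m$.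
   Context: $P(i)$ is the number of partitions of $i$. For each $n$, $R_n=k[x_1,\dots,x_n]$ is standard graded, $S=k[y_1,\dots,y_n]_{DP}$ is the divided power algebra with $\deg y_i=-1$, and $R_n$ acts on $S$ by contraction ($x^{\mathbf d}\circ y^{(\mathbf e)}=y^{(\mathbf e-\mathbf d)}$ if $\mathbf e\ge\mathbf d$ componentwise, else $0$). $\mathfrak S_n$ permutes the variables; $R'_n,S'$ are the invariants; $\rho(f)=\frac1{n!}\sum_{\sigma\in\mathfrak S_n}\sigma\cdot f$. For $V\subseteq[R_n]_d$, $(V)_{\mathfrak S_n}$ is the ideal generated by the $\mathfrak S_n$-orbits of elements of $V$. For $U\subseteq[R'_n]_d$, $U^\perp=\{w\in S'_{-d}:u\circ w=0\ \forall u\in U\}$. $\mathcal{SI}(R_n)$ is the set of $(r,d)$-symmetric ideals, i.e. ideals $(V)_{\mathfrak S_n}$ with $V\in\operatorname{Gr}(r,[R_n]_d)$. Maps: $\Phi_n(V)=(V)_{\mathfrak S_n}$; $\alpha_n(V)=\operatorname{Span}_k(\rho(f):f\in V)$; $\Psi_n(U)=\operatorname{Ann}_{R_n}(U^\perp+S_{\ge-d+1})$, where $S_{\ge -d+1}=\bigoplus_{j\ge-d+1}S_j$ and $\operatorname{Ann}_{R_n}(W)=\{f:f\circ w=0\ \forall w\in W\}$. For $m\le n$: $\pi_{m,n}:\operatorname{Gr}(r,[R_m]_d)\to\operatorname{Gr}(r,[R_n]_d)$, $\pi_{m,n}(V)=V$; $\eta_{m,n}:\mathcal{SI}(R_m)\to\mathcal{SI}(R_n)$,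 $\eta_{m,n}(I)=I_{\mathfrak S_n}$, the ideal of $R_n$ generated by $\{\sigma\cdot f:\sigma\in\mathfrak S_n,f\in I\}$. For $n\ge d$ identify $[R'_n]_d$ with $k^{P(d)}$ via the basis $\{m_\lambda\}_{\lambda\vdash d}$ ($m_\lambda$ = sum of all distinct monomials $\sigma\cdot x_1^{\lambda_1}\cdots x_p^{\lambda_p}$). For a subspace $W\subseteq S'_{-d}$ with basis $F_1,\dots,F_b$, let $L_W=\{(\ell_j)\in([R_n]_1)^b:\sum_j\ell_j\circ F_j=0\}$. Property $\mathcal P(W)$: if $(\sum_ic_{ij}x_i)_{1\le j\le b}\in L_W$ then $c_{ij}=c_{i'j}$ for all $i,i',j$. Property $\mathcal Q(W)$: for $F\in W$, $(x_1-x_2)\circ F=0$ implies $F=0$. $G$ is a fixed nonempty Zariski open subset of $\operatorname{Gr}(r,k^{P(d)})$, independent of $n$, such that for all $n\ge d$ and every $U\in G$ (viewed in $\operatorname{Gr}(r,[R'_n]_d)$), $W=U^\perp$ satisfies $\mathcal P(W)$, $\mathcal Q(W)$, $\dim_kL_W=\max\{P(d)-P(d-1)-r,0\}$ (such a set exists). $\widetilde O_n=\{V\in\operatorname{Gr}(r,[R_n]_d):\dim_k[(V)_{\mathfrak S_n}]_d\ge\dim_k[R_n]_d-\max\{P(d)-r,0\}\}$; $O_n=\widetilde O_n\cap\alpha_n^{-1}(G)$ if $r<P(d)$ and $O_n=\widetilde O_n$ if $r\ge P(d)$. For $n>d$ with $n\ge1+\frac1r\sum_{i=0}^{d-1}P(i)$,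 a general $(r,d)$-symmetric ideal of $R_n$ is an ideal $(V)_{\mathfrak S_n}$ with $V\in O_n$; $\mathcal{SI}^g(R_n)$ is the set of these. Binomial construction: a monomial has type $\lambda$ if it is a permutation of $x^\lambda=x_1^{\lambda_1}\cdots x_p^{\lambda_p}$. A $\lambda$-binomial is $b=M-M'$ with $M\ne M'$ monomials of type $\lambda$; with $g(b)=\gcd(M,M')$, $b$ is admissible if $g(b)$ is relatively prime to both $M/g(b)$ and $M'/g(b)$. A subpartition $\gamma\subsetneq\lambda$ is a proper sub-multiset of the parts of $\lambda$ (possibly empty). An integer $m$ is large enough for the construction in degree $d$ if for every nonzero $\boldsymbol\alpha=(\alpha_\lambda)_{\lambda\vdash d}\in k^{P(d)}$, with $\tau$ the smallest partition (in a fixed order on partitions of $d$, e.g. lexicographic) with $\alpha_\tau\ne0$, one can choose in $R_m$, for each $\lambda\vdash d$, $\lambda\ne\tau$ and each $\gamma\subsetneq\lambda$, an admissible $\lambda$-binomial $b(\lambda,\gamma)$ with $g(b(\lambda,\gamma))$ of type $\gamma$, such that no variable occurring in a $b(\lambda,\gamma)$ occurs in $h_{\boldsymbol\alpha}=\sum_{\lambda\vdash d}\alpha_\lambda x^\lambda$, and distinct $b(\lambda,\gamma)$ involve disjoint sets of variables. (All sufficiently large $m$, depending only on $d$, have this property.)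
   Formalization: The identification of [R'_n]_d with k^{P(d)} uses the basis m_λ divided by its number of monomials, i.e. ρ(x^λ), instead of m_λ itself; with m_λ the coordinates of α_n(V) depend on n, so α_nπ_{m,n}=α_m fails (e.g. d=3, r=2). *)

theory Defs
  imports
    "HOL-Library.Poly_Mapping"
    "HOL-Library.Multiset"
    "HOL-Combinatorics.Permutations"
    "HOL-Algebra.Ideal"
    "Jordan_Normal_Form.Determinant"
begin

text \<open>
  Polynomials in countably many variables \<open>x\<^sub>1, x\<^sub>2, \<dots>\<close> over \<open>'k\<close>: finitely supported functions on
  exponent vectors.  The ring \<open>R\<^sub>n\<close> is the subset of polynomials in \<open>x\<^sub>1, \<dots>, x\<^sub>n\<close>, so
  \<open>R\<^sub>m \<subseteq> R\<^sub>n\<close> holds literally for \<open>m \<le> n\<close>.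
\<close>

type_synonym mon = "nat \<Rightarrow>\<^sub>0 nat"
type_synonym 'k mpol = "mon \<Rightarrow>\<^sub>0 'k"

text \<open>
  Divided power elements: the basis element indexed by \<open>e\<close> is \<open>y\<^sup>(\<^sup>e\<^sup>)\<close>, of degree \<open>-|e|\<close>.  Only the
  graded \<open>R\<^sub>n\<close>-module structure and the permutation action on the divided power algebra are
  used, never its product (the product of the type below would be the wrong one).
\<close>

type_synonym 'k dpow = "mon \<Rightarrow>\<^sub>0 'k"

subsection \<open>Vector spaces of finitely supported functions\<close>

definition pscale :: "'k::field \<Rightarrow> ('i \<Rightarrow>\<^sub>0 'k) \<Rightarrow> 'i \<Rightarrow>\<^sub>0 'k" where
  "pscale c = Poly_Mapping.map ((*) c)"

lemma lookup_pscale: "Poly_Mapping.lookup (pscale c p) i = c * Poly_Mapping.lookup p i"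
  by (simp add: pscale_def Poly_Mapping.map.rep_eq when_def)

global_interpretation pvs: vector_space "pscale :: 'k::field \<Rightarrow> ('i \<Rightarrow>\<^sub>0 'k) \<Rightarrow> _"
  by unfold_locales
    (auto intro!: poly_mapping_eqI simp: lookup_pscale lookup_add algebra_simps)

text \<open>Tuples of polynomials, indexed by natural numbers.\<close>

definition tscale :: "'k::field \<Rightarrow> (nat \<Rightarrow>\<^sub>0 'k mpol) \<Rightarrow> nat \<Rightarrow>\<^sub>0 'k mpol" where
  "tscale c = Poly_Mapping.map (pscale c)"

lemma lookup_tscale: "Poly_Mapping.lookup (tscale c l) j = pscale c (Poly_Mapping.lookup l j)"
  by (simp add: tscale_def Poly_Mapping.map.rep_eq when_def)

global_interpretation tvs: vector_space "tscale :: 'k::field \<Rightarrow> _"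
  by unfold_locales
    (auto intro!: poly_mapping_eqI
      simp: lookup_tscale lookup_pscale lookup_add algebra_simps)

definition is_basis :: "('i \<Rightarrow>\<^sub>0 'k::field) list \<Rightarrow> ('i \<Rightarrow>\<^sub>0 'k) set \<Rightarrow> bool" where
  "is_basis vs W \<longleftrightarrow> distinct vs \<and> pvs.independent (set vs) \<and> pvs.span (set vs) = W"

definition Grass :: "nat \<Rightarrow> ('i \<Rightarrow>\<^sub>0 'k::field) set \<Rightarrow> ('i \<Rightarrow>\<^sub>0 'k) set set" where
  "Grass r A = {V. pvs.subspace V \<and> V \<subseteq> A \<and> pvs.dim V = r}"

subsection \<open>The polynomial ring, its grading and the symmetric group action\<close>

definition mdeg :: "('i \<Rightarrow>\<^sub>0 nat) \<Rightarrow> nat" where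
  "mdeg e = (\<Sum>i\<in>Poly_Mapping.keys e. Poly_Mapping.lookup e i)"

definition xmon :: "mon \<Rightarrow> 'k::field mpol" where
  "xmon e = Poly_Mapping.single e 1"

definition xvar :: "nat \<Rightarrow> 'k::field mpol" where
  "xvar i = xmon (Poly_Mapping.single i 1)"

definition vars :: "'k::field mpol \<Rightarrow> nat set" where
  "vars f = (\<Union>e\<in>Poly_Mapping.keys f. Poly_Mapping.keys e)"

definition Rpoly :: "nat \<Rightarrow> 'k::field mpol set" where
  "Rpoly n = {f. vars f \<subseteq> {1..n}}"

definition Rdeg :: "nat \<Rightarrow> nat \<Rightarrow> 'k::field mpol set" where
  "Rdeg n d = {f \<in> Rpoly n. \<forall>e\<in>Poly_Mapping.keys f. mdeg e = d}"

definition polyring :: "nat \<Rightarrow> 'k::field mpol ring" where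
  "polyring n = \<lparr>carrier = Rpoly n, monoid.mult = (*), one = 1, zero = 0, add = (+)\<rparr>"

definition perm_mon :: "(nat \<Rightarrow> nat) \<Rightarrow> mon \<Rightarrow> mon" where
  "perm_mon \<sigma> e = (\<Sum>i\<in>Poly_Mapping.keys e. Poly_Mapping.single (\<sigma> i) (Poly_Mapping.lookup e i))"

definition perm_act :: "(nat \<Rightarrow> nat) \<Rightarrow> (mon \<Rightarrow>\<^sub>0 'k::field) \<Rightarrow> mon \<Rightarrow>\<^sub>0 'k" where
  "perm_act \<sigma> f =
     (\<Sum>e\<in>Poly_Mapping.keys f. Poly_Mapping.single (perm_mon \<sigma> e) (Poly_Mapping.lookup f e))"

definition rho :: "nat \<Rightarrow> 'k::field mpol \<Rightarrow> 'k mpol" where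
  "rho n f = pscale (1 / of_nat (fact n)) (\<Sum>\<sigma> | \<sigma> permutes {1..n}. perm_act \<sigma> f)"

lemma Rpoly_iff: "f \<in> Rpoly n \<longleftrightarrow> (\<forall>e\<in>Poly_Mapping.keys f. Poly_Mapping.keys e \<subseteq> {1..n})"
  by (auto simp: Rpoly_def vars_def)

lemma Rpoly_closed:
  assumes "f \<in> Rpoly n" "g \<in> Rpoly n"
  shows "f + g \<in> Rpoly n" "f * g \<in> Rpoly n" "- f \<in> Rpoly n"
proof -
  show "f + g \<in> Rpoly n"
    using assms Poly_Mapping.keys_add[of f g] unfolding Rpoly_iff by blast
  show "f * g \<in> Rpoly n"
    unfolding Rpoly_iff
  proof
    fix e assume "e \<in> Poly_Mapping.keys (f * g)"
    then obtain a b where ab: "a \<in> Poly_Mapping.keys f" "b \<in> Poly_Mapping.keys g" "e = a + b"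
      using keys_mult[of f g] by blast
    show "Poly_Mapping.keys e \<subseteq> {1..n}"
      using assms ab Poly_Mapping.keys_add[of a b] unfolding Rpoly_iff by blast
  qed
  show "- f \<in> Rpoly n"
    using assms by (simp add: Rpoly_iff)
qed

lemma Rpoly_01: "0 \<in> Rpoly n" "1 \<in> Rpoly n"
  by (simp_all add: Rpoly_iff)

lemma polyring_cring: "cring (polyring n :: 'k::field mpol ring)"
proof (rule cringI)
  show "abelian_group (polyring n :: 'k mpol ring)"
  proof (rule abelian_groupI)
    show "\<exists>g\<in>carrier (polyring n). g \<oplus>\<^bsub>polyring n\<^esub> f = \<zero>\<^bsub>polyring n\<^esub>"
      if "f \<in> carrier (polyring n)" for f :: "'k mpol"
      using that by (intro bexI[of _ "- f"]) (auto simp: polyring_def Rpoly_closed Rpoly_01)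
  qed (auto simp: polyring_def add_ac Rpoly_closed Rpoly_01)
  show "comm_monoid (polyring n :: 'k mpol ring)"
    by unfold_locales (auto simp: polyring_def mult_ac Rpoly_closed Rpoly_01)
qed (auto simp: polyring_def algebra_simps)

text \<open>\<open>(A)\<^bsub>\<SS>\<^sub>n\<^esub>\<close>, an ideal of \<open>R\<^sub>n\<close>.\<close>

definition sym_ideal :: "nat \<Rightarrow> 'k::field mpol set \<Rightarrow> 'k mpol set" where
  "sym_ideal n A = genideal (polyring n) {perm_act \<sigma> f |\<sigma> f. \<sigma> permutes {1..n} \<and> f \<in> A}"

subsection \<open>The divided power module\<close>

definition Sdp :: "nat \<Rightarrow> 'k::field dpow set" where
  "Sdp n = {w. \<forall>e\<in>Poly_Mapping.keys w. Poly_Mapping.keys e \<subseteq> {1..n}}"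

definition Sdeg :: "nat \<Rightarrow> int \<Rightarrow> 'k::field dpow set" where
  "Sdeg n j = {w \<in> Sdp n. \<forall>e\<in>Poly_Mapping.keys w. - int (mdeg e) = j}"

definition Sge :: "nat \<Rightarrow> int \<Rightarrow> 'k::field dpow set" where
  "Sge n j = {w \<in> Sdp n. \<forall>e\<in>Poly_Mapping.keys w. - int (mdeg e) \<ge> j}"

definition Sinv :: "nat \<Rightarrow> int \<Rightarrow> 'k::field dpow set" where
  "Sinv n j = {w \<in> Sdeg n j. \<forall>\<sigma>. \<sigma> permutes {1..n} \<longrightarrow> perm_act \<sigma> w = w}"

definition mon_le :: "mon \<Rightarrow> mon \<Rightarrow> bool" where
  "mon_le a b \<longleftrightarrow> (\<forall>i. Poly_Mapping.lookup a i \<le> Poly_Mapping.lookup b i)"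

definition contract :: "'k::field mpol \<Rightarrow> 'k dpow \<Rightarrow> 'k dpow" where
  "contract f w = (\<Sum>a\<in>Poly_Mapping.keys f. \<Sum>e\<in>Poly_Mapping.keys w.
     if mon_le a e
     then Poly_Mapping.single (e - a) (Poly_Mapping.lookup f a * Poly_Mapping.lookup w e)
     else 0)"

definition annih :: "nat \<Rightarrow> 'k::field dpow set \<Rightarrow> 'k mpol set" where
  "annih n W = {f \<in> Rpoly n. \<forall>w\<in>W. contract f w = 0}"

definition perp :: "nat \<Rightarrow> nat \<Rightarrow> 'k::field mpol set \<Rightarrow> 'k dpow set" where
  "perp n d U = {w \<in> Sinv n (- int d). \<forall>u\<in>U. contract u w = 0}"

subsection \<open>Partitions and symmetric polynomials\<close>

text \<open>A partition is the multiset of its (positive) parts.\<close>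

definition Par :: "nat \<Rightarrow> nat multiset set" where
  "Par d = {p. 0 \<notin># p \<and> sum_mset p = d}"

definition num_parts :: "nat \<Rightarrow> nat" where
  "num_parts d = card (Par d)"

text \<open>The exponent vector of \<open>x\<^sub>1\<^bsup>\<lambda>\<^sub>1\<^esup> \<cdots> x\<^sub>p\<^bsup>\<lambda>\<^sub>p\<^esup>\<close> with \<open>\<lambda>\<^sub>1 \<ge> \<dots> \<ge> \<lambda>\<^sub>p\<close>.\<close>

definition part_mon :: "nat multiset \<Rightarrow> mon" where
  "part_mon p = (let l = rev (sorted_list_of_multiset p) in
     \<Sum>i<length l. Poly_Mapping.single (Suc i) (l ! i))"

definition has_type :: "nat \<Rightarrow> nat multiset \<Rightarrow> mon \<Rightarrow> bool" where
  "has_type n p M \<longleftrightarrow> (\<exists>\<sigma>. \<sigma> permutes {1..n} \<and> M = perm_mon \<sigma> (part_mon p))"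

definition msym :: "nat \<Rightarrow> nat multiset \<Rightarrow> 'k::field mpol" where
  "msym n p = (\<Sum>M | has_type n p M. xmon M)"

definition kvec :: "nat \<Rightarrow> (nat multiset \<Rightarrow>\<^sub>0 'k::field) set" where
  "kvec d = {a. Poly_Mapping.keys a \<subseteq> Par d}"

text \<open>
  The identification of \<open>k\<^bsup>P(d)\<^esup>\<close> with the degree \<open>d\<close> invariants of \<open>R\<^sub>n\<close>, \<open>n \<ge> d\<close>.  The basis element
  belonging to \<open>\<lambda>\<close> is the monomial symmetric polynomial \<open>m\<^sub>\<lambda>\<close> divided by its number of monomials,
  that is \<open>\<rho>(x\<^sup>\<lambda>)\<close>.  The normalisation is essential for comparing different \<open>n\<close>:  the coordinates of
  \<open>\<rho>(f)\<close> with respect to the \<open>m\<^sub>\<lambda>\<close> themselves depend on \<open>n\<close>, since the number of monomials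
  of \<open>m\<^sub>\<lambda>\<close> does, whereas in the basis \<open>\<rho>(x\<^sup>\<lambda>)\<close> the \<open>\<lambda>\<close>-coordinate of \<open>\<rho>(f)\<close> is the sum of the
  coefficients of the monomials of type \<open>\<lambda>\<close> in \<open>f\<close>.
\<close>

definition ident :: "nat \<Rightarrow> nat \<Rightarrow> (nat multiset \<Rightarrow>\<^sub>0 'k::field) \<Rightarrow> 'k mpol" where
  "ident n d a = (\<Sum>p\<in>Par d.
     pscale (Poly_Mapping.lookup a p) (pscale (1 / of_nat (card {M. has_type n p M})) (msym n p)))"

subsection \<open>The Zariski topology on a Grassmannian of a coordinate space\<close>

text \<open>
  A closed subset of the Grassmannian is the zero locus of a family of homogeneous polynomials in the
  Pluecker coordinates.  The coordinates are indexed by all \<open>r\<close>-tuples \<open>J\<close> of coordinates of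
  the ambient space; a different choice of basis multiplies all of them by one nonzero scalar.
\<close>

definition pluecker :: "('i \<Rightarrow>\<^sub>0 'k::field) list \<Rightarrow> 'i list \<Rightarrow> 'k" where
  "pluecker vs J =
     det (mat (length vs) (length vs) (\<lambda>(i, j). Poly_Mapping.lookup (vs ! i) (J ! j)))"

definition pluecker_form :: "'i set \<Rightarrow> nat \<Rightarrow> (('i list \<Rightarrow>\<^sub>0 nat) \<Rightarrow>\<^sub>0 'k::field) \<Rightarrow> bool" where
  "pluecker_form I r F \<longleftrightarrow>
     (\<forall>e\<in>Poly_Mapping.keys F. \<forall>J\<in>Poly_Mapping.keys e. length J = r \<and> set J \<subseteq> I) \<and>
     (\<exists>D. \<forall>e\<in>Poly_Mapping.keys F. mdeg e = D)"

definition eval_form :: "(('j \<Rightarrow>\<^sub>0 nat) \<Rightarrow>\<^sub>0 'k::field) \<Rightarrow> ('j \<Rightarrow> 'k) \<Rightarrow> 'k" where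
  "eval_form F p = (\<Sum>e\<in>Poly_Mapping.keys F.
     Poly_Mapping.lookup F e * (\<Prod>J\<in>Poly_Mapping.keys e. p J ^ Poly_Mapping.lookup e J))"

definition zariski_closed :: "nat \<Rightarrow> nat \<Rightarrow> (nat multiset \<Rightarrow>\<^sub>0 'k::field) set set \<Rightarrow> bool" where
  "zariski_closed r d Z \<longleftrightarrow> (\<exists>\<F>. (\<forall>F\<in>\<F>. pluecker_form (Par d) r F) \<and>
     Z = {U \<in> Grass r (kvec d). \<forall>vs. is_basis vs U \<longrightarrow> (\<forall>F\<in>\<F>. eval_form F (pluecker vs) = 0)})"

definition zariski_open :: "nat \<Rightarrow> nat \<Rightarrow> (nat multiset \<Rightarrow>\<^sub>0 'k::field) set set \<Rightarrow> bool" where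
  "zariski_open r d G \<longleftrightarrow> G \<subseteq> Grass r (kvec d) \<and> zariski_closed r d (Grass r (kvec d) - G)"

subsection \<open>Linear relations of an inverse system and the open set \<open>G\<close>\<close>

text \<open>The list \<open>Fs\<close> is the chosen basis \<open>F\<^sub>1, \<dots>, F\<^sub>b\<close> of \<open>W\<close>; its entries are numbered from 0.\<close>

definition lin_rels :: "nat \<Rightarrow> 'k::field dpow list \<Rightarrow> (nat \<Rightarrow>\<^sub>0 'k mpol) set" where
  "lin_rels n Fs = {l. Poly_Mapping.keys l \<subseteq> {..<length Fs} \<and>
     (\<forall>j<length Fs. Poly_Mapping.lookup l j \<in> Rdeg n 1) \<and>
     (\<Sum>j<length Fs. contract (Poly_Mapping.lookup l j) (Fs ! j)) = 0}"

definition propP :: "nat \<Rightarrow> 'k::field dpow list \<Rightarrow> bool" where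
  "propP n Fs \<longleftrightarrow> (\<forall>c :: nat \<Rightarrow> nat \<Rightarrow> 'k.
     (\<Sum>j<length Fs. Poly_Mapping.single j (\<Sum>i=1..n. pscale (c i j) (xvar i))) \<in> lin_rels n Fs \<longrightarrow>
     (\<forall>j<length Fs. \<forall>i\<in>{1..n}. \<forall>i'\<in>{1..n}. c i j = c i' j))"

definition propQ :: "'k::field dpow set \<Rightarrow> bool" where
  "propQ W \<longleftrightarrow> (\<forall>F\<in>W. contract (xvar 1 - xvar 2) F = 0 \<longrightarrow> F = 0)"

definition good_open :: "nat \<Rightarrow> nat \<Rightarrow> (nat multiset \<Rightarrow>\<^sub>0 'k::field) set set \<Rightarrow> bool" where
  "good_open r d G \<longleftrightarrow> G \<noteq> {} \<and> zariski_open r d G \<and>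
     (\<forall>n\<ge>d. \<forall>U\<in>G. let W = perp n d (ident n d ` U) in
        propQ W \<and>
        (\<forall>Fs. is_basis Fs W \<longrightarrow>
           propP n Fs \<and>
           int (tvs.dim (lin_rels n Fs)) = max (int (num_parts d) - int (num_parts (d - 1)) - int r) 0))"

subsection \<open>The maps and general symmetric ideals\<close>

definition Phi :: "nat \<Rightarrow> 'k::field mpol set \<Rightarrow> 'k mpol set" where
  "Phi n V = sym_ideal n V"

definition eta :: "nat \<Rightarrow> nat \<Rightarrow> 'k::field mpol set \<Rightarrow> 'k mpol set" where
  "eta m n I = sym_ideal n I"

definition pi_incl :: "nat \<Rightarrow> nat \<Rightarrow> 'k::field mpol set \<Rightarrow> 'k mpol set" where
  "pi_incl m n V = V"

text \<open>The subspace \<open>\<alpha>\<^sub>n(V)\<close> of the invariants is read in \<open>k\<^bsup>P(d)\<^esup>\<close> through the identification above.\<close>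

definition alpha :: "nat \<Rightarrow> nat \<Rightarrow> 'k::field mpol set \<Rightarrow> (nat multiset \<Rightarrow>\<^sub>0 'k) set" where
  "alpha n d V = {a \<in> kvec d. ident n d a \<in> pvs.span (rho n ` V)}"

definition Psi :: "nat \<Rightarrow> nat \<Rightarrow> (nat multiset \<Rightarrow>\<^sub>0 'k::field) set \<Rightarrow> 'k mpol set" where
  "Psi n d U = annih n {w + w' |w w'. w \<in> perp n d (ident n d ` U) \<and> w' \<in> Sge n (- int d + 1)}"

definition Otilde :: "nat \<Rightarrow> nat \<Rightarrow> nat \<Rightarrow> 'k::field mpol set set" where
  "Otilde r d n = {V \<in> Grass r (Rdeg n d).
     int (pvs.dim (sym_ideal n V \<inter> Rdeg n d))
       \<ge> int (pvs.dim (Rdeg n d :: 'k mpol set)) - max (int (num_parts d) - int r) 0}"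

definition Oset ::
  "(nat multiset \<Rightarrow>\<^sub>0 'k::field) set set \<Rightarrow> nat \<Rightarrow> nat \<Rightarrow> nat \<Rightarrow> 'k mpol set set" where
  "Oset G r d n = (if r < num_parts d then {V \<in> Otilde r d n. alpha n d V \<in> G} else Otilde r d n)"

text \<open>
  The restriction \<open>n > d\<close>, \<open>n \<ge> 1 + (1/r) \<Sum>\<^sub>i\<^sub><\<^sub>d P(i)\<close> under which general symmetric ideals are considered is
  not part of the set; for \<open>d \<ge> 2\<close> it holds whenever \<open>n\<close> is at least a number that is large
  enough for the binomial construction below.
\<close>

definition SIg ::
  "(nat multiset \<Rightarrow>\<^sub>0 'k::field) set set \<Rightarrow> nat \<Rightarrow> nat \<Rightarrow> nat \<Rightarrow> 'k mpol set set" where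
  "SIg G r d n = {sym_ideal n V |V. V \<in> Oset G r d n}"

subsection \<open>The binomial construction\<close>

definition mon_gcd :: "mon \<Rightarrow> mon \<Rightarrow> mon" where
  "mon_gcd a b = (\<Sum>i\<in>Poly_Mapping.keys a.
     Poly_Mapping.single i (min (Poly_Mapping.lookup a i) (Poly_Mapping.lookup b i)))"

text \<open>\<open>b\<close> is an admissible \<open>p\<close>-binomial of \<open>R\<^sub>m\<close> with \<open>g(b)\<close> of type \<open>q\<close>.\<close>

definition admissible_binomial ::
  "nat \<Rightarrow> nat multiset \<Rightarrow> nat multiset \<Rightarrow> 'k::field mpol \<Rightarrow> bool" where
  "admissible_binomial m p q b \<longleftrightarrow> b \<in> Rpoly m \<and>
     (\<exists>M M'. b = xmon M - xmon M' \<and> M \<noteq> M' \<and> has_type m p M \<and> has_type m p M' \<and>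
       (let g = mon_gcd M M' in
          mon_gcd g (M - g) = 0 \<and> mon_gcd g (M' - g) = 0 \<and> has_type m q g))"

definition hpoly :: "nat \<Rightarrow> (nat multiset \<Rightarrow>\<^sub>0 'k::field) \<Rightarrow> 'k mpol" where
  "hpoly d a = (\<Sum>p\<in>Par d. pscale (Poly_Mapping.lookup a p) (xmon (part_mon p)))"

text \<open>
  The relation \<open>ord\<close> is the order fixed on the partitions of \<open>d\<close>.  The condition that \<open>hpoly d a\<close> lies in
  \<open>R\<^sub>m\<close> says that the whole construction takes place in \<open>R\<^sub>m\<close>.
\<close>

definition large_enough :: "'k::field itself \<Rightarrow> nat multiset rel \<Rightarrow> nat \<Rightarrow> nat \<Rightarrow> bool" where
  "large_enough _ ord d m \<longleftrightarrow>
     (\<forall>a :: nat multiset \<Rightarrow>\<^sub>0 'k. \<forall>t. a \<in> kvec d \<longrightarrow> a \<noteq> 0 \<longrightarrow>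
        t \<in> Poly_Mapping.keys a \<longrightarrow> (\<forall>p\<in>Poly_Mapping.keys a. (t, p) \<in> ord) \<longrightarrow>
        hpoly d a \<in> Rpoly m \<and>
        (\<exists>b :: nat multiset \<Rightarrow> nat multiset \<Rightarrow> 'k mpol.
           (\<forall>p\<in>Par d - {t}. \<forall>q. q \<subset># p \<longrightarrow>
              admissible_binomial m p q (b p q) \<and> vars (b p q) \<inter> vars (hpoly d a) = {}) \<and>
           (\<forall>p\<in>Par d - {t}. \<forall>p'\<in>Par d - {t}. \<forall>q q'. q \<subset># p \<longrightarrow> q' \<subset># p' \<longrightarrow>
              (p, q) \<noteq> (p', q') \<longrightarrow> vars (b p q) \<inter> vars (b p' q') = {})))"

end

theory Submission
  imports Defs
begin

text \<open>
  For \<open>f\<close> of degree \<open>d\<close> let \<open>T f \<in> k\<^bsup>P(d)\<^esup>\<close> collect, for each type \<open>\<lambda>\<close>, the sum of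
  the coefficients of \<open>f\<close> at monomials of type \<open>\<lambda>\<close>.  Then \<open>\<rho>(f)\<close> corresponds to \<open>T f\<close> for every
  \<open>n\<close>, so \<open>\<alpha>\<^sub>n(V) = T(V)\<close> does not depend on \<open>n\<close>, and the kernel \<open>K\<^sub>n\<close> of \<open>T\<close> is spanned by differences
  of monomials of the same type.  Rank and nullity of \<open>T\<close> show that the dimension bound
  in \<open>O\<^sub>n\<close> means exactly that \<open>K\<^sub>n\<close> lies in the span of the orbit of \<open>V\<close> and \<open>dim T(V) = r\<close>;
  hence the degree \<open>d\<close> part of \<open>(V)\<^bsub>\<SS>\<^sub>n\<^esub>\<close> is \<open>T\<^sup>-\<^sup>1(T(V))\<close>.

  In degree \<open>d + 1\<close> the ideal is everything: a functional vanishing on it is a \<open>w\<close> of degree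
  \<open>- d - 1\<close> with all \<open>x\<^sub>i \<circ> w \<in> T(V)\<^sup>\<bottom>\<close>, and since \<open>x\<^sub>p\<close> and \<open>x\<^sub>q\<close> commute, property
  \<open>\<P>\<close> with a third variable makes all \<open>x\<^sub>i \<circ> w\<close> vanish.  So \<open>(V)\<^bsub>\<SS>\<^sub>n\<^esub> = \<Psi>\<^sub>n(T(V))\<close>, by double annihilation.

  Surjectivity onto \<open>G\<close> comes from the binomials: adding them to \<open>h\<^sub>\<alpha>\<close> does not change \<open>T\<close>, a transposition
  that reverses the sign of one binomial and fixes everything else puts this binomial into the orbit span, and
  its permutations connect all monomials of its type.  Finally \<open>K\<^sub>m\<close> generates \<open>K\<^sub>n\<close> under \<open>\<SS>\<^sub>n\<close> because
  a monomial of degree \<open>d\<close> and its image under a transposition involve at most \<open>d + 1 \<le> m\<close> variables.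
\<close>

subsection \<open>Dimensions and linear maps\<close>

text \<open>The polynomial spaces are infinite-dimensional, so every dimension argument is run
  inside the span of a fixed finite set \<open>B\<close>. This supplies a basis of \<open>S\<close>
  together with its finiteness.\<close>

lemma (in vector_space) finite_basis_of_subset:
  assumes "finite B" "S \<subseteq> span B"
  obtains C where "C \<subseteq> S" "independent C" "S \<subseteq> span C" "finite C" "card C = dim S"
proof -
  obtain C where C: "C \<subseteq> S" "independent C" "S \<subseteq> span C" "card C = dim S"
    using basis_exists by blast
  moreover have "finite C"
    using independent_span_bound[OF assms(1) C(2)] C(1) assms(2) by blast
  ultimately show ?thesis using that by blast
qed

lemma (in vector_space) dim_mono_finite:
  assumes "finite B" "T \<subseteq> span B" "S \<subseteq> T"
  shows "dim S \<le> dim T"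
proof -
  obtain C where "T \<subseteq> span C" "finite C" "card C = dim T"
    using finite_basis_of_subset[OF assms(1,2)] by metis
  then show ?thesis
    using dim_le_card[of S C] assms(3) by auto
qed

text \<open>A vector of \<open>T\<close> outside \<open>S\<close> would extend a basis of
  \<open>S\<close> to an independent set with more elements than a spanning set of
  \<open>T\<close>.\<close>

lemma (in vector_space) subspace_eq_if_dim_ge:
  assumes "finite B" "T \<subseteq> span B" "S \<subseteq> T" "subspace S" "dim T \<le> dim S"
  shows "S = T"
proof (rule ccontr)
  assume "S \<noteq> T"
  then obtain x where x: "x \<in> T" "x \<notin> S" using assms(3) by blast
  obtain A where A: "A \<subseteq> S" "independent A" "S \<subseteq> span A" "finite A" "card A = dim S"
    using finite_basis_of_subset[OF assms(1), of S] assms(2,3) by blast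
  obtain C where C: "T \<subseteq> span C" "finite C" "card C = dim T"
    using finite_basis_of_subset[OF assms(1,2)] by metis
  have "x \<notin> span A" using span_minimal[OF A(1) assms(4)] x by blast
  then have "independent (insert x A)" using A(2) by (rule independent_insertI)
  then have "card (insert x A) \<le> card C"
    using independent_span_bound[OF C(2)] A(1) x(1) assms(3) C(1) by blast
  moreover have "x \<notin> A" using x A by blast
  ultimately show False using A(4,5) C(3) assms(5) by simp
qed

lemma (in Vector_Spaces.linear) rank_nullity_on:
  assumes S: "vs1.subspace S" and "finite B" "S \<subseteq> vs1.span B"
  shows "vs1.dim S = vs1.dim {x \<in> S. f x = 0} + vs2.dim (f ` S)"
proof (rule antisym)
  let ?N = "{x \<in> S. f x = 0}"
  have N: "?N \<subseteq> vs1.span B" using assms(3) by blast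
  obtain A where A: "A \<subseteq> ?N" "vs1.independent A" "?N \<subseteq> vs1.span A" "finite A" "card A = vs1.dim ?N"
    by (rule vs1.finite_basis_of_subset[OF assms(2) N])
  have "f ` S \<subseteq> vs2.span (f ` B)" using spans_image[OF assms(3)] .
  then obtain E where E: "E \<subseteq> f ` S" "f ` S \<subseteq> vs2.span E" "finite E" "card E = vs2.dim (f ` S)"
    by (rule vs2.finite_basis_of_subset[OF finite_imageI[OF assms(2)]])
  obtain D where D: "D \<subseteq> S" "f ` D = E" "finite D" "card D \<le> card E"
  proof -
    obtain D where D: "D \<subseteq> S" "inj_on f D" "E = f ` D"
      using E(1) subset_image_inj[of E f S] by blast
    then show ?thesis using that E(3) by (simp add: card_image finite_image_iff)
  qed
  have "S \<subseteq> vs1.span (A \<union> D)"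
  proof
    fix x assume x: "x \<in> S"
    then have "f x \<in> f ` vs1.span D" using E(2) D(2) span_image[of D] by blast
    then obtain y where y: "y \<in> vs1.span D" "f x = f y" by blast
    have "y \<in> S" using vs1.span_minimal[OF D(1) S] y by blast
    then have "x - y \<in> ?N" using x y S by (simp add: vs1.subspace_diff diff)
    then have "x - y \<in> vs1.span (A \<union> D)"
      using A(3) vs1.span_mono[of A "A \<union> D"] by blast
    moreover have "y \<in> vs1.span (A \<union> D)" using y vs1.span_mono[of D "A \<union> D"] by blast
    ultimately have "(x - y) + y \<in> vs1.span (A \<union> D)" by (rule vs1.span_add)
    then show "x \<in> vs1.span (A \<union> D)" by simp
  qed
  then have "vs1.dim S \<le> card (A \<union> D)" using A(4) D(3) by (intro vs1.dim_le_card) auto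
  also have "\<dots> \<le> card A + card D" by (rule card_Un_le)
  finally show "vs1.dim S \<le> vs1.dim ?N + vs2.dim (f ` S)" using A D E by simp
  obtain C where C: "A \<subseteq> C" "C \<subseteq> S" "vs1.independent C" "S \<subseteq> vs1.span C"
    by (rule vs1.maximal_independent_subset_extend[OF _ A(2), of S]) (use A(1) in auto)
  have Cf: "finite C" using vs1.independent_span_bound[OF assms(2) C(3)] C(2) assms(3) by blast
  have "vs2.span (f ` C) \<subseteq> vs2.span (f ` (C - A))"
  proof (rule vs2.span_minimal)
    show "f ` C \<subseteq> vs2.span (f ` (C - A))"
    proof (rule image_subsetI)
      fix x assume "x \<in> C"
      then show "f x \<in> vs2.span (f ` (C - A))"
        using A(1) vs2.span_zero by (cases "x \<in> A") (fastforce, auto intro: vs2.span_base)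
    qed
  qed simp
  with spans_image[OF C(4)] have "f ` S \<subseteq> vs2.span (f ` (C - A))" by (rule order_trans)
  then have "vs2.dim (f ` S) \<le> card (f ` (C - A))" using Cf by (intro vs2.dim_le_card) auto
  also have "\<dots> \<le> card (C - A)" using Cf by (intro card_image_le) auto
  also have "\<dots> = card C - card A" using A(4) C(1) by (intro card_Diff_subset)
  finally have "vs2.dim (f ` S) \<le> card C - card A" .
  moreover have "card A \<le> card C" using C(1) Cf by (rule card_mono[rotated])
  moreover have "card C = vs1.dim S" using C vs1.basis_card_eq_dim by blast
  ultimately show "vs1.dim ?N + vs2.dim (f ` S) \<le> vs1.dim S" using A(5) by simp
qed

text \<open>A basis of \<open>Y\<close> stays independent after adding \<open>x\<close>, so the
  functional can be prescribed on it. No finite dimension is required, which allows \<open>Y\<close>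
  to be a whole ideal later on.\<close>

lemma (in vector_space) separating_functional:
  assumes Y: "subspace Y" and x: "x \<notin> Y"
  shows "\<exists>\<phi>. Vector_Spaces.linear scale (*) \<phi> \<and> (\<forall>y\<in>Y. \<phi> y = 0) \<and> \<phi> x = 1"
proof -
  interpret k: vector_space "(*) :: 'a \<Rightarrow> _"
    by unfold_locales (auto simp: algebra_simps)
  interpret p: vector_space_pair scale "(*) :: 'a \<Rightarrow> _" by unfold_locales
  obtain B where B: "B \<subseteq> Y" "independent B" "Y \<subseteq> span B"
    by (rule basis_exists)
  have sB: "span B = Y" using B Y span_subspace by blast
  then have "independent (insert x B)" using B(2) x by (intro independent_insertI) auto
  then obtain g where g: "Vector_Spaces.linear scale (*) g"
    "\<forall>z\<in>insert x B. g z = (if z = x then 1 else 0)"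
    using p.linear_independent_extend[of "insert x B" "\<lambda>z. if z = x then 1 else 0"] by auto
  interpret g: Vector_Spaces.linear scale "(*)" g by (fact g(1))
  have "g y = 0" if "y \<in> Y" for y
    by (rule g.eq_0_on_span[of B]) (use that g(2) B(1) x sB in auto)
  then show ?thesis using g by auto
qed

section \<open>Linear extension from basis elements\<close>

lemma pvs_linearI:
  assumes "\<And>f g. h (f + g) = h f + h g" "\<And>c f. h (pscale c f) = pscale c (h f)"
  shows "Vector_Spaces.linear pscale pscale h"
  by unfold_locales (use assms in auto)

text \<open>The linear extension of a map given on basis elements. Permutations, type sums,
  homogeneous components, the identification of invariants and contraction in its first argument are
  all brought into this form, so that linearity is proved once and identities are checked on
  monomials.\<close>

definition lext :: "('i \<Rightarrow> 'j \<Rightarrow>\<^sub>0 'k) \<Rightarrow> ('i \<Rightarrow>\<^sub>0 'k::field) \<Rightarrow> 'j \<Rightarrow>\<^sub>0 'k" where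
  "lext u f = (\<Sum>e\<in>Poly_Mapping.keys f. pscale (Poly_Mapping.lookup f e) (u e))"

text \<open>The defining sum runs over \<open>keys f\<close>, which changes under addition and
  scaling. A common larger index set makes such sums comparable.\<close>

lemma lext_superset:
  "finite A \<Longrightarrow> Poly_Mapping.keys f \<subseteq> A \<Longrightarrow>
     lext u f = (\<Sum>e\<in>A. pscale (Poly_Mapping.lookup f e) (u e))"
  unfolding lext_def by (rule sum.mono_neutral_left) (auto simp: in_keys_iff)

lemma linear_lext:
  fixes u :: "'i \<Rightarrow> 'j \<Rightarrow>\<^sub>0 'k::field"
  shows "Vector_Spaces.linear pscale pscale (lext u)"
proof (rule pvs_linearI)
  fix f g :: "'i \<Rightarrow>\<^sub>0 'k"
  let ?A = "Poly_Mapping.keys f \<union> Poly_Mapping.keys g"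
  show "lext u (f + g) = lext u f + lext u g"
    using Poly_Mapping.keys_add[of f g]
    by (simp add: lext_superset[of ?A] lookup_add pvs.scale_left_distrib sum.distrib)
next
  fix c :: 'k and f :: "'i \<Rightarrow>\<^sub>0 'k"
  have "Poly_Mapping.keys (pscale c f) \<subseteq> Poly_Mapping.keys f"
    by (auto simp: in_keys_iff lookup_pscale)
  then show "lext u (pscale c f) = pscale c (lext u f)"
    by (simp add: lext_superset[of "Poly_Mapping.keys f"] lookup_pscale pvs.scale_sum_right)
qed

lemma lext_single [simp]: "lext u (Poly_Mapping.single e c) = pscale c (u e)"
  by (simp add: lext_superset[of "{e}"])

lemma pscale_single: "pscale c (Poly_Mapping.single e a) = Poly_Mapping.single e (c * a)"
  by (auto intro!: poly_mapping_eqI simp: lookup_pscale lookup_single when_def)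

lemma poly_mapping_expand: "f = (\<Sum>e\<in>Poly_Mapping.keys f. pscale (Poly_Mapping.lookup f e) (Poly_Mapping.single e 1))"
  by (rule poly_mapping_eqI)
    (simp add: lookup_sum lookup_pscale lookup_single when_def in_keys_iff if_distrib cong: if_cong)

lemma linear_eq_lext:
  assumes "Vector_Spaces.linear pscale pscale h"
  shows "h = lext (\<lambda>e. h (Poly_Mapping.single e 1))"
proof
  fix f
  interpret Vector_Spaces.linear pscale pscale h by fact
  show "h f = lext (\<lambda>e. h (Poly_Mapping.single e 1)) f"
    by (subst poly_mapping_expand[of f]) (simp add: sum scale lext_def)
qed

lemma linear_eqI:
  assumes "Vector_Spaces.linear pscale pscale g" "Vector_Spaces.linear pscale pscale h"
    "\<And>e. g (Poly_Mapping.single e 1) = h (Poly_Mapping.single e 1)"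
  shows "g f = h f"
  using linear_eq_lext[OF assms(1)] linear_eq_lext[OF assms(2)] assms(3) by simp

lemma lookup_lext:
  "Poly_Mapping.lookup (lext u f) i =
     (\<Sum>e\<in>Poly_Mapping.keys f. Poly_Mapping.lookup f e * Poly_Mapping.lookup (u e) i)"
  by (simp add: lext_def lookup_sum lookup_pscale)

subsection \<open>Monomials and their types\<close>

text \<open>The type of a monomial, defined without reference to a number of variables. It agrees
  with \<open>has_type\<close> once the partition fits into the available variables
  (\<open>has_type_iff\<close>).\<close>

definition mon_type :: "mon \<Rightarrow> nat multiset" where
  "mon_type e = image_mset (Poly_Mapping.lookup e) (mset_set (Poly_Mapping.keys e))"

lemma sum_mset_mon_type: "sum_mset (mon_type e) = mdeg e"
  by (simp add: mon_type_def mdeg_def sum_unfold_sum_mset)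

lemma zero_notin_mon_type: "0 \<notin># mon_type e"
  by (auto simp: mon_type_def in_keys_iff)

lemma mon_type_in_Par: "mon_type e \<in> Par d \<longleftrightarrow> mdeg e = d"
  by (simp add: Par_def zero_notin_mon_type sum_mset_mon_type)

lemma size_mon_type: "size (mon_type e) = card (Poly_Mapping.keys e)"
  by (simp add: mon_type_def)

lemma mdeg_superset:
  "finite A \<Longrightarrow> Poly_Mapping.keys e \<subseteq> A \<Longrightarrow> mdeg e = (\<Sum>i\<in>A. Poly_Mapping.lookup e i)"
  unfolding mdeg_def by (rule sum.mono_neutral_left) (auto simp: in_keys_iff)

lemma keys_add_mon: "Poly_Mapping.keys (a + b :: 'i \<Rightarrow>\<^sub>0 nat) = Poly_Mapping.keys a \<union> Poly_Mapping.keys b"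
  by (auto simp: in_keys_iff lookup_add)

lemma mdeg_add: "mdeg (a + b) = mdeg a + mdeg b"
proof -
  let ?A = "Poly_Mapping.keys a \<union> Poly_Mapping.keys b"
  show ?thesis
    by (simp add: mdeg_superset[of ?A] keys_add_mon lookup_add sum.distrib)
qed

lemma mdeg_single [simp]: "mdeg (Poly_Mapping.single i c) = c"
  by (simp add: mdeg_def)

lemma mdeg_0 [simp]: "mdeg 0 = 0"
  by (simp add: mdeg_def)

lemma mdeg_eq_0_iff: "mdeg e = 0 \<longleftrightarrow> e = 0"
  by (auto simp: mdeg_def in_keys_iff intro!: poly_mapping_eqI)

lemma lookup_le_mdeg: "Poly_Mapping.lookup e i \<le> mdeg e"
  by (cases "i \<in> Poly_Mapping.keys e")
    (auto simp: mdeg_def in_keys_iff intro: member_le_sum)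

lemma card_keys_le_mdeg: "card (Poly_Mapping.keys e) \<le> mdeg e"
proof -
  have "(\<Sum>i\<in>Poly_Mapping.keys e. 1) \<le> mdeg e"
    unfolding mdeg_def by (rule sum_mono) (simp add: in_keys_iff Suc_le_eq)
  then show ?thesis by simp
qed

lemma mon_type_add_disjoint:
  assumes "Poly_Mapping.keys a \<inter> Poly_Mapping.keys b = {}"
  shows "mon_type (a + b) = mon_type a + mon_type b"
proof -
  have "image_mset (Poly_Mapping.lookup (a + b)) (mset_set (Poly_Mapping.keys a)) = mon_type a"
    unfolding mon_type_def using assms
    by (intro image_mset_cong) (auto simp: lookup_add in_keys_iff disjoint_iff)
  moreover have "image_mset (Poly_Mapping.lookup (a + b)) (mset_set (Poly_Mapping.keys b)) = mon_type b"
    unfolding mon_type_def using assms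
    by (intro image_mset_cong) (auto simp: lookup_add in_keys_iff disjoint_iff)
  ultimately show ?thesis
    using assms by (simp add: mon_type_def[of "a + b"] keys_add_mon mset_set_Union)
qed

lemma mon_type_single: "v \<noteq> 0 \<Longrightarrow> mon_type (Poly_Mapping.single i v) = {#v#}"
  by (simp add: mon_type_def)

lemma finite_Par: "finite (Par d)"
proof (rule finite_subset)
  show "Par d \<subseteq> mset ` {xs. set xs \<subseteq> {..d} \<and> length xs \<le> d}"
  proof
    fix p assume "p \<in> Par d"
    then have p: "0 \<notin># p" "sum_mset p = d" by (auto simp: Par_def)
    obtain xs where xs: "p = mset xs" by (metis ex_mset)
    have "length xs \<le> sum_list xs" using p(1) unfolding xs
      by (induction xs) (auto simp: Suc_le_eq intro: add_mono)
    moreover have "x \<le> sum_list xs" if "x \<in> set xs" for x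
      using that member_le_sum_list by blast
    ultimately show "p \<in> mset ` {xs. set xs \<subseteq> {..d} \<and> length xs \<le> d}"
      using p(2) xs by (auto simp: sum_mset_sum_list)
  qed
  show "finite (mset ` {xs. set xs \<subseteq> {..d} \<and> length xs \<le> d})"
    by (intro finite_imageI finite_lists_length_le) simp
qed

lemma size_le_of_Par: "p \<in> Par d \<Longrightarrow> size p \<le> d"
proof -
  assume "p \<in> Par d"
  then have "0 \<notin># p" "sum_mset p = d" by (auto simp: Par_def)
  moreover have "size p \<le> sum_mset p" if "0 \<notin># p" for p :: "nat multiset"
    using that by (induction p) (auto simp: Suc_le_eq intro: add_mono)
  ultimately show ?thesis by blast
qed

definition mons :: "nat \<Rightarrow> nat \<Rightarrow> mon set" where
  "mons n d = {e. Poly_Mapping.keys e \<subseteq> {1..n} \<and> mdeg e = d}"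

lemma finite_mons: "finite (mons n d)"
proof (rule finite_imageD)
  have "Poly_Mapping.lookup ` mons n d \<subseteq>
      {f. \<forall>i. (i \<in> {1..n} \<longrightarrow> f i \<in> {..d}) \<and> (i \<notin> {1..n} \<longrightarrow> f i = 0)}"
    using lookup_le_mdeg by (fastforce simp: mons_def in_keys_iff)
  then show "finite (Poly_Mapping.lookup ` mons n d)"
    by (rule finite_subset) (intro finite_set_of_finite_funs; simp)
  show "inj_on Poly_Mapping.lookup (mons n d)"
    by (auto intro!: inj_onI poly_mapping_eqI)
qed

subsection \<open>The action of permutations\<close>

lemma lookup_perm_mon:
  assumes "bij \<sigma>"
  shows "Poly_Mapping.lookup (perm_mon \<sigma> e) (\<sigma> i) = Poly_Mapping.lookup e i"
  using bij_is_inj[OF assms]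
  by (simp add: perm_mon_def lookup_sum lookup_single when_def inj_eq in_keys_iff cong: if_cong)

lemma perm_mon_eqI:
  assumes "bij \<sigma>" "\<And>i. Poly_Mapping.lookup e' (\<sigma> i) = Poly_Mapping.lookup e i"
  shows "perm_mon \<sigma> e = e'"
proof (rule poly_mapping_eqI)
  fix j
  obtain i where "j = \<sigma> i" using bij_is_surj[OF assms(1)] by (metis surjD)
  then show "Poly_Mapping.lookup (perm_mon \<sigma> e) j = Poly_Mapping.lookup e' j"
    using assms lookup_perm_mon by simp
qed

lemma keys_perm_mon: "bij \<sigma> \<Longrightarrow> Poly_Mapping.keys (perm_mon \<sigma> e) = \<sigma> ` Poly_Mapping.keys e"
proof -
  assume s: "bij \<sigma>"
  have "j \<in> Poly_Mapping.keys (perm_mon \<sigma> e) \<longleftrightarrow> j \<in> \<sigma> ` Poly_Mapping.keys e" for j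
  proof -
    obtain i where "j = \<sigma> i" using bij_is_surj[OF s] by (metis surjD)
    then show ?thesis
      using lookup_perm_mon[OF s] bij_is_inj[OF s] by (auto simp: in_keys_iff inj_image_mem_iff)
  qed
  then show ?thesis by blast
qed

lemma perm_mon_id [simp]: "perm_mon id e = e"
  by (rule perm_mon_eqI) auto

lemma perm_mon_comp:
  "bij \<sigma> \<Longrightarrow> bij \<tau> \<Longrightarrow> perm_mon \<sigma> (perm_mon \<tau> e) = perm_mon (\<sigma> \<circ> \<tau>) e"
  by (rule sym, rule perm_mon_eqI) (auto simp: lookup_perm_mon intro: bij_comp)

lemma perm_mon_add: "bij \<sigma> \<Longrightarrow> perm_mon \<sigma> (a + b) = perm_mon \<sigma> a + perm_mon \<sigma> b"
  by (rule perm_mon_eqI) (auto simp: lookup_perm_mon lookup_add)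

lemma perm_mon_0 [simp]: "perm_mon \<sigma> 0 = 0"
  by (simp add: perm_mon_def)

lemma perm_mon_single [simp]: "perm_mon \<sigma> (Poly_Mapping.single i v) = Poly_Mapping.single (\<sigma> i) v"
  by (cases "v = 0") (auto simp: perm_mon_def)

lemma perm_mon_fixed: "bij \<sigma> \<Longrightarrow> (\<And>i. i \<in> Poly_Mapping.keys e \<Longrightarrow> \<sigma> i = i) \<Longrightarrow> perm_mon \<sigma> e = e"
proof -
  assume s: "bij \<sigma>" and f: "\<And>i. i \<in> Poly_Mapping.keys e \<Longrightarrow> \<sigma> i = i"
  show ?thesis
  proof (rule perm_mon_eqI[OF s])
    fix i
    show "Poly_Mapping.lookup e (\<sigma> i) = Poly_Mapping.lookup e i"
    proof (cases "\<sigma> i \<in> Poly_Mapping.keys e")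
      case True
      \<comment> \<open>Injectivity of \<open>\<sigma>\<close> cancels one application and leaves
        \<open>\<sigma> i = i\<close>.\<close>
      then have "\<sigma> (\<sigma> i) = \<sigma> i" by (rule f)
      then show ?thesis using bij_is_inj[OF s] by (simp add: inj_eq)
    next
      case False
      moreover have "i \<notin> Poly_Mapping.keys e" using f False by force
      ultimately show ?thesis by (simp add: in_keys_iff)
    qed
  qed
qed

lemma perm_mon_inj: "bij \<sigma> \<Longrightarrow> perm_mon \<sigma> a = perm_mon \<sigma> b \<longleftrightarrow> a = b"
  by (metis lookup_perm_mon poly_mapping_eqI)

lemma mon_type_perm_mon: "bij \<sigma> \<Longrightarrow> mon_type (perm_mon \<sigma> e) = mon_type e"
proof -
  assume s: "bij \<sigma>"
  have "inj_on \<sigma> (Poly_Mapping.keys e)" using bij_is_inj[OF s] inj_on_subset by blast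
  then have "mset_set (\<sigma> ` Poly_Mapping.keys e) = image_mset \<sigma> (mset_set (Poly_Mapping.keys e))"
    by (simp add: image_mset_mset_set)
  then show ?thesis
    using s by (simp add: mon_type_def keys_perm_mon multiset.map_comp comp_def lookup_perm_mon)
qed

lemma mdeg_perm_mon: "bij \<sigma> \<Longrightarrow> mdeg (perm_mon \<sigma> e) = mdeg e"
  by (metis mon_type_perm_mon sum_mset_mon_type)

text \<open>Padding both types with zeros up to \<open>card A\<close> turns equality of types into
  equality of the multisets of all exponents over \<open>A\<close>. Two functions on
  \<open>A\<close> with the same multiset of values differ by a permutation of
  \<open>A\<close>.\<close>

lemma mon_type_eq_imp_perm:
  assumes A: "finite A" "Poly_Mapping.keys e \<subseteq> A" "Poly_Mapping.keys e' \<subseteq> A"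
    and t: "mon_type e = mon_type e'"
  obtains \<sigma> where "\<sigma> permutes A" "perm_mon \<sigma> e = e'"
proof -
  have *: "image_mset (Poly_Mapping.lookup x) (mset_set A)
      = mon_type x + replicate_mset (card A - size (mon_type x)) 0"
    if x: "Poly_Mapping.keys x \<subseteq> A" for x :: mon
  proof -
    have "A = Poly_Mapping.keys x \<union> (A - Poly_Mapping.keys x)" using x by blast
    then have "mset_set A = mset_set (Poly_Mapping.keys x) + mset_set (A - Poly_Mapping.keys x)"
      using A(1) mset_set_Union[of "Poly_Mapping.keys x" "A - Poly_Mapping.keys x"] by simp
    moreover have "image_mset (Poly_Mapping.lookup x) (mset_set (A - Poly_Mapping.keys x))
        = image_mset (\<lambda>_. 0) (mset_set (A - Poly_Mapping.keys x))"
      using A(1) by (intro image_mset_cong) (auto simp: in_keys_iff)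
    moreover have "card (A - Poly_Mapping.keys x) = card A - size (mon_type x)"
      using x by (simp add: card_Diff_subset size_mon_type)
    ultimately show ?thesis
      by (simp add: mon_type_def image_mset_const_eq)
  qed
  have "image_mset (Poly_Mapping.lookup e) (mset_set A) = image_mset (Poly_Mapping.lookup e') (mset_set A)"
    using *[OF A(2)] *[OF A(3)] t by simp
  then obtain \<sigma> where s: "\<sigma> permutes A" "\<forall>x\<in>A. Poly_Mapping.lookup e x = Poly_Mapping.lookup e' (\<sigma> x)"
    by (rule image_mset_eq_implies_permutes[OF A(1)])
  have "Poly_Mapping.lookup e' (\<sigma> i) = Poly_Mapping.lookup e i" for i
  proof (cases "i \<in> A")
    case False
    then have "Poly_Mapping.lookup e i = 0" "Poly_Mapping.lookup e' i = 0" "\<sigma> i = i"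
      using A s(1) by (auto simp: in_keys_iff permutes_not_in)
    then show ?thesis by simp
  qed (use s in simp)
  then have "perm_mon \<sigma> e = e'" using s(1) by (intro perm_mon_eqI permutes_bij)
  with s(1) that show ?thesis by blast
qed

lemma part_mon_facts:
  assumes "0 \<notin># p"
  shows "mon_type (part_mon p) = p" "Poly_Mapping.keys (part_mon p) = {1..size p}"
proof -
  define l where "l = rev (sorted_list_of_multiset p)"
  have l: "mset l = p" "length l = size p"
    unfolding l_def by (simp_all flip: size_mset)
  have lk: "Poly_Mapping.lookup (part_mon p) (Suc i) = (if i < length l then l ! i else 0)" for i
    unfolding part_mon_def Let_def l_def[symmetric]
    by (simp add: lookup_sum lookup_single when_def)
  have lk0: "Poly_Mapping.lookup (part_mon p) 0 = 0"
    unfolding part_mon_def Let_def by (simp add: lookup_sum lookup_single when_def)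
  have nz: "l ! i \<noteq> 0" if "i < length l" for i
    using that assms l(1) nth_mem by (metis set_mset_mset)
  have k: "i \<in> Poly_Mapping.keys (part_mon p) \<longleftrightarrow> i \<in> {1..size p}" for i
    using lk lk0 nz l(2) by (cases i) (auto simp: in_keys_iff Suc_le_eq)
  then show keys: "Poly_Mapping.keys (part_mon p) = {1..size p}" by blast
  have "{1..size p} = Suc ` {..<length l}"
    using l(2) by (auto simp: image_iff Suc_le_eq gr0_conv_Suc)
  then have "mset_set {1..size p} = image_mset Suc (mset_set {..<length l})"
    by (simp add: image_mset_mset_set)
  then have "mon_type (part_mon p) = image_mset (\<lambda>i. l ! i) (mset_set {..<length l})"
    unfolding mon_type_def keys
    by (auto simp: multiset.map_comp comp_def lk intro!: image_mset_cong)
  also have "\<dots> = mset (map ((!) l) [0..<length l])"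
    by (simp only: mset_map mset_upt atLeast0LessThan)
  also have "\<dots> = p" using l(1) by (simp only: map_nth)
  finally show "mon_type (part_mon p) = p" .
qed

lemma mdeg_part_mon: "p \<in> Par d \<Longrightarrow> mdeg (part_mon p) = d"
  by (simp add: Par_def part_mon_facts flip: sum_mset_mon_type)

lemma part_mon_in_mons: "p \<in> Par d \<Longrightarrow> d \<le> n \<Longrightarrow> part_mon p \<in> mons n d"
  using size_le_of_Par[of p d] mdeg_part_mon[of p d]
  by (auto simp: mons_def part_mon_facts Par_def)

lemma has_type_imp:
  assumes "has_type n p M" "0 \<notin># p" "size p \<le> n"
  shows "Poly_Mapping.keys M \<subseteq> {1..n}" "mon_type M = p"
proof -
  obtain \<sigma> where s: "\<sigma> permutes {1..n}" "M = perm_mon \<sigma> (part_mon p)"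
    using assms(1) by (auto simp: has_type_def)
  have b: "bij \<sigma>" using s(1) by (rule permutes_bij)
  show "mon_type M = p" using s(2) b assms(2) by (simp add: mon_type_perm_mon part_mon_facts)
  have "\<sigma> ` {1..size p} \<subseteq> \<sigma> ` {1..n}" using assms(3) by (intro image_mono) auto
  then show "Poly_Mapping.keys M \<subseteq> {1..n}"
    using s b assms(2) by (simp add: keys_perm_mon part_mon_facts permutes_image)
qed

text \<open>The bound on \<open>size p\<close> places \<open>part_mon p\<close> inside the first
  \<open>n\<close> variables, so that permutations of \<open>{1..n}\<close> reach every monomial of
  type \<open>p\<close> there.\<close>

lemma has_type_iff:
  assumes "0 \<notin># p" "size p \<le> n"
  shows "has_type n p M \<longleftrightarrow> Poly_Mapping.keys M \<subseteq> {1..n} \<and> mon_type M = p"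
proof
  assume M: "Poly_Mapping.keys M \<subseteq> {1..n} \<and> mon_type M = p"
  obtain \<sigma> where "\<sigma> permutes {1..n}" "perm_mon \<sigma> (part_mon p) = M"
    by (rule mon_type_eq_imp_perm[of "{1..n}" "part_mon p" M])
      (use M assms in \<open>auto simp: part_mon_facts\<close>)
  then show "has_type n p M" by (auto simp: has_type_def)
qed (use has_type_imp assms in blast)

section \<open>The permutation action on polynomials\<close>

lemma perm_act_eq_lext: "perm_act \<sigma> = lext (\<lambda>e. Poly_Mapping.single (perm_mon \<sigma> e) 1)"
  by (simp add: fun_eq_iff perm_act_def lext_def pscale_single)

lemma linear_perm_act: "Vector_Spaces.linear pscale pscale (perm_act \<sigma>)"
  unfolding perm_act_eq_lext by (rule linear_lext)

lemma perm_act_single [simp]: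
  "perm_act \<sigma> (Poly_Mapping.single e c) = Poly_Mapping.single (perm_mon \<sigma> e) c"
  by (simp add: perm_act_eq_lext pscale_single)

lemma perm_act_xmon [simp]: "perm_act \<sigma> (xmon e) = xmon (perm_mon \<sigma> e)"
  by (simp add: xmon_def)

lemma lookup_perm_act:
  "bij \<sigma> \<Longrightarrow> Poly_Mapping.lookup (perm_act \<sigma> f) (perm_mon \<sigma> e) = Poly_Mapping.lookup f e"
  by (simp add: perm_act_eq_lext lookup_lext lookup_single when_def perm_mon_inj in_keys_iff
      if_distrib cong: if_cong)

lemmas linear_compose = Vector_Spaces.linear_compose[unfolded comp_def]

lemma perm_act_comp:
  assumes "bij \<sigma>" "bij \<tau>"
  shows "perm_act \<sigma> (perm_act \<tau> f) = perm_act (\<sigma> \<circ> \<tau>) f"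
  by (rule linear_eqI[of "\<lambda>f. perm_act \<sigma> (perm_act \<tau> f)"])
    (use assms in \<open>auto intro!: linear_compose[OF linear_perm_act linear_perm_act] linear_perm_act simp: perm_mon_comp comp_def\<close>)

lemma perm_act_id [simp]: "perm_act id f = f"
  by (rule linear_eqI[of "perm_act id" "\<lambda>f. f"])
    (auto intro!: linear_perm_act pvs.linear_ident)

lemma keys_perm_act: "bij \<sigma> \<Longrightarrow> Poly_Mapping.keys (perm_act \<sigma> f) = perm_mon \<sigma> ` Poly_Mapping.keys f"
proof -
  assume s: "bij \<sigma>"
  have "e \<in> Poly_Mapping.keys (perm_act \<sigma> f) \<longleftrightarrow> e \<in> perm_mon \<sigma> ` Poly_Mapping.keys f" for e
  proof -
    have "e = perm_mon \<sigma> (perm_mon (inv_into UNIV \<sigma>) e)"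
      using s by (simp add: perm_mon_comp bij_imp_bij_inv surj_iff[THEN iffD1] bij_is_surj)
    then obtain a where "e = perm_mon \<sigma> a" by blast
    then show ?thesis by (auto simp: in_keys_iff lookup_perm_act s perm_mon_inj)
  qed
  then show ?thesis by blast
qed

lemma perm_act_fixed:
  assumes "bij \<sigma>" "\<And>i. i \<in> vars f \<Longrightarrow> \<sigma> i = i"
  shows "perm_act \<sigma> f = f"
proof (rule poly_mapping_eqI)
  fix e
  show "Poly_Mapping.lookup (perm_act \<sigma> f) e = Poly_Mapping.lookup f e"
  proof (cases "e \<in> Poly_Mapping.keys (perm_act \<sigma> f) \<union> Poly_Mapping.keys f")
    case True
    have "perm_mon \<sigma> a = a" if "a \<in> Poly_Mapping.keys f" for a
      using that assms by (intro perm_mon_fixed) (auto simp: vars_def)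
    with True have "perm_mon \<sigma> e = e" by (auto simp: keys_perm_act assms(1))
    then show ?thesis using lookup_perm_act[OF assms(1), of f e] by simp
  qed (auto simp: in_keys_iff)
qed

lemma pscale_eq_mult: "pscale c f = Poly_Mapping.single 0 c * f"
  by (simp add: pscale_def mult_map_scale_conv_mult)

lemma linear_mult: "Vector_Spaces.linear pscale pscale (\<lambda>f. g * f :: 'k::field mpol)"
  by (rule pvs_linearI) (simp_all add: algebra_simps pscale_eq_mult)

lemma perm_act_xmon_mult:
  fixes f :: "'k::field mpol"
  assumes "bij \<sigma>"
  shows "perm_act \<sigma> (xmon e * f) = xmon (perm_mon \<sigma> e) * perm_act \<sigma> f"
proof (rule linear_eqI[of "\<lambda>f. perm_act \<sigma> (xmon e * f)" "\<lambda>f. xmon (perm_mon \<sigma> e) * perm_act \<sigma> f"])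
  show "perm_act \<sigma> (xmon e * Poly_Mapping.single a 1)
      = xmon (perm_mon \<sigma> e) * perm_act \<sigma> (Poly_Mapping.single a 1 :: 'k mpol)" for a
    using assms by (simp add: xmon_def mult_single perm_mon_add)
  show "Vector_Spaces.linear pscale pscale (\<lambda>f :: 'k mpol. perm_act \<sigma> (xmon e * f))"
    by (rule linear_compose[OF linear_mult linear_perm_act])
  show "Vector_Spaces.linear pscale pscale (\<lambda>f :: 'k mpol. xmon (perm_mon \<sigma> e) * perm_act \<sigma> f)"
    by (rule linear_compose[OF linear_perm_act linear_mult])
qed

section \<open>Graded pieces as spaces of functions with prescribed support\<close>

lemma xmon_in_Rpoly: "xmon e \<in> Rpoly n \<longleftrightarrow> Poly_Mapping.keys e \<subseteq> {1..n}"
  by (simp add: Rpoly_iff xmon_def)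

lemma Rdeg_iff: "f \<in> Rdeg n d \<longleftrightarrow> Poly_Mapping.keys f \<subseteq> mons n d"
  by (auto simp: Rdeg_def Rpoly_iff mons_def)

lemma subspace_keys_subset: "pvs.subspace {f :: 'i \<Rightarrow>\<^sub>0 'k::field. Poly_Mapping.keys f \<subseteq> A}"
proof (rule pvs.subspaceI)
  show "x + y \<in> {f :: 'i \<Rightarrow>\<^sub>0 'k. Poly_Mapping.keys f \<subseteq> A}"
    if "x \<in> {f. Poly_Mapping.keys f \<subseteq> A}" "y \<in> {f. Poly_Mapping.keys f \<subseteq> A}" for x y :: "'i \<Rightarrow>\<^sub>0 'k"
    using that Poly_Mapping.keys_add[of x y] by blast
qed (auto simp: in_keys_iff lookup_pscale)

text \<open>Both \<open>Rdeg n d\<close> and \<open>kvec d\<close> are of this form with a finite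
  set \<open>A\<close>. This is the source of their finite spanning sets and, through
  \<open>dim_keys_subset\<close>, of the dimension \<open>P(d)\<close>.\<close>

lemma keys_subset_eq_span:
  "{f :: 'i \<Rightarrow>\<^sub>0 'k::field. Poly_Mapping.keys f \<subseteq> A} = pvs.span ((\<lambda>i. Poly_Mapping.single i 1) ` A)"
proof (rule sym, rule pvs.span_unique)
  show "(\<lambda>i. Poly_Mapping.single i (1 :: 'k)) ` A \<subseteq> {f. Poly_Mapping.keys f \<subseteq> A}" by auto
  show "pvs.subspace {f :: 'i \<Rightarrow>\<^sub>0 'k. Poly_Mapping.keys f \<subseteq> A}" by (rule subspace_keys_subset)
  fix W :: "('i \<Rightarrow>\<^sub>0 'k) set"
  assume W: "(\<lambda>i. Poly_Mapping.single i (1 :: 'k)) ` A \<subseteq> W" "pvs.subspace W"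
  show "{f. Poly_Mapping.keys f \<subseteq> A} \<subseteq> W"
  proof
    fix f :: "'i \<Rightarrow>\<^sub>0 'k" assume "f \<in> {f. Poly_Mapping.keys f \<subseteq> A}"
    then show "f \<in> W"
      using W by (subst poly_mapping_expand[of f]) (auto intro!: pvs.subspace_sum pvs.subspace_scale)
  qed
qed

lemma dim_keys_subset:
  "pvs.dim {f :: 'i \<Rightarrow>\<^sub>0 'k::field. Poly_Mapping.keys f \<subseteq> A} = card A"
proof -
  let ?s = "\<lambda>i. Poly_Mapping.single i (1 :: 'k)"
  have "pvs.independent (?s ` A)"
    unfolding pvs.dependent_def
  proof clarify
    fix i assume i: "i \<in> A" "?s i \<in> pvs.span (?s ` A - {?s i})"
    have "?s ` A - {?s i} \<subseteq> ?s ` (A - {i})" by auto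
    then have "?s i \<in> pvs.span (?s ` (A - {i}))" using i(2) pvs.span_mono by blast
    then show False unfolding keys_subset_eq_span[symmetric] by simp
  qed
  then have "pvs.dim (pvs.span (?s ` A)) = card (?s ` A)" by (rule pvs.dim_span_eq_card_independent)
  also have "\<dots> = card A" by (rule card_image) (auto intro!: inj_onI simp: inj_eq dest!: arg_cong[where f = Poly_Mapping.keys])
  finally show ?thesis unfolding keys_subset_eq_span .
qed

lemma Rdeg_eq: "Rdeg n d = {f. Poly_Mapping.keys f \<subseteq> mons n d}"
  by (auto simp: Rdeg_iff)

lemma subspace_Rdeg: "pvs.subspace (Rdeg n d)"
  unfolding Rdeg_eq by (rule subspace_keys_subset)

lemma Rdeg_finite_span:
  obtains B where "finite B" "(Rdeg n d :: 'k::field mpol set) \<subseteq> pvs.span B"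
  using finite_mons unfolding Rdeg_eq keys_subset_eq_span by blast

lemma subspace_kvec: "pvs.subspace (kvec d)"
  unfolding kvec_def by (rule subspace_keys_subset)

lemma kvec_finite_span:
  obtains B where "finite B" "(kvec d :: (nat multiset \<Rightarrow>\<^sub>0 'k::field) set) \<subseteq> pvs.span B"
  using finite_Par unfolding kvec_def keys_subset_eq_span by blast

lemma dim_kvec: "pvs.dim (kvec d :: (nat multiset \<Rightarrow>\<^sub>0 'k::field) set) = num_parts d"
  unfolding kvec_def num_parts_def by (rule dim_keys_subset)

lemma subspace_Rpoly: "pvs.subspace (Rpoly n :: 'k::field mpol set)"
proof -
  have "Rpoly n = {f :: 'k mpol. Poly_Mapping.keys f \<subseteq> {e. Poly_Mapping.keys e \<subseteq> {1..n}}}"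
    unfolding set_eq_iff mem_Collect_eq Rpoly_iff subset_iff by blast
  then show ?thesis by (simp only: subspace_keys_subset)
qed

lemma Rdeg_mono: "m \<le> n \<Longrightarrow> Rdeg m d \<subseteq> Rdeg n d"
  by (fastforce simp: Rdeg_iff mons_def)

lemma Rpoly_mono: "m \<le> n \<Longrightarrow> Rpoly m \<subseteq> Rpoly n"
  by (fastforce simp: Rpoly_iff)

lemma xmon_in_Rdeg: "xmon e \<in> Rdeg n d \<longleftrightarrow> e \<in> mons n d"
  by (simp add: Rdeg_iff xmon_def)

lemma perm_mon_in_mons: "\<sigma> permutes {1..n} \<Longrightarrow> e \<in> mons n d \<Longrightarrow> perm_mon \<sigma> e \<in> mons n d"
  using permutes_image[of \<sigma> "{1..n}"] permutes_bij[of \<sigma> "{1..n}"]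
  by (force simp: mons_def keys_perm_mon mdeg_perm_mon)

lemma perm_act_in_Rdeg: "\<sigma> permutes {1..n} \<Longrightarrow> f \<in> Rdeg n d \<Longrightarrow> perm_act \<sigma> f \<in> Rdeg n d"
  using permutes_bij[of \<sigma> "{1..n}"] perm_mon_in_mons
  by (fastforce simp: Rdeg_iff keys_perm_act)

lemma perm_act_in_Rpoly: "\<sigma> permutes {1..n} \<Longrightarrow> f \<in> Rpoly n \<Longrightarrow> perm_act \<sigma> f \<in> Rpoly n"
  using permutes_bij[of \<sigma> "{1..n}"] permutes_image[of \<sigma> "{1..n}"]
  by (force simp: Rpoly_iff keys_perm_act keys_perm_mon)

subsection \<open>Coefficient sums by monomial type\<close>

text \<open>This is the map \<open>T\<close> of the overview. Monomials of degree other than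
  \<open>d\<close> are sent to \<open>0\<close>, which makes the map linear on all polynomials with
  values in \<open>kvec d\<close>.\<close>

definition type_sums :: "nat \<Rightarrow> 'k::field mpol \<Rightarrow> nat multiset \<Rightarrow>\<^sub>0 'k" where
  "type_sums d = lext (\<lambda>e. if mdeg e = d then Poly_Mapping.single (mon_type e) 1 else 0)"

lemma linear_type_sums: "Vector_Spaces.linear pscale pscale (type_sums d)"
  unfolding type_sums_def by (rule linear_lext)

lemma type_sums_xmon: "type_sums d (xmon e) = (if mdeg e = d then Poly_Mapping.single (mon_type e) 1 else 0)"
  by (simp add: type_sums_def xmon_def)

lemma type_sums_in_kvec: "type_sums d f \<in> kvec d"
  unfolding type_sums_def lext_def
  by (intro pvs.subspace_sum pvs.subspace_scale subspace_kvec)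
    (auto simp: kvec_def mon_type_in_Par)

lemma type_sums_perm_act: "bij \<sigma> \<Longrightarrow> type_sums d (perm_act \<sigma> f) = type_sums d f"
  by (rule linear_eqI[of "\<lambda>f. type_sums d (perm_act \<sigma> f)" "type_sums d"])
    (auto intro!: linear_compose[OF linear_perm_act linear_type_sums] linear_type_sums
      simp: mdeg_perm_mon mon_type_perm_mon type_sums_xmon simp flip: xmon_def)

text \<open>\<open>hpoly\<close> sums over \<open>Par d\<close> whereas \<open>lext\<close> sums
  over \<open>keys a\<close>. The value \<open>0\<close> outside \<open>Par d\<close> reconciles the
  two for arbitrary \<open>a\<close>.\<close>

lemma hpoly_eq_lext: "(hpoly d :: _ \<Rightarrow> 'k::field mpol) = lext (\<lambda>p. if p \<in> Par d then xmon (part_mon p) else 0)"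
proof
  fix a :: "nat multiset \<Rightarrow>\<^sub>0 'k"
  show "hpoly d a = lext (\<lambda>p. if p \<in> Par d then xmon (part_mon p) else 0) a"
    unfolding hpoly_def
    by (subst lext_superset[of "Poly_Mapping.keys a \<union> Par d"])
      (auto simp: finite_Par intro!: sum.mono_neutral_cong_left)
qed

lemma linear_hpoly: "Vector_Spaces.linear pscale pscale (hpoly d)"
  unfolding hpoly_eq_lext by (rule linear_lext)

lemma ident_eq_lext: "(ident n d :: _ \<Rightarrow> 'k::field mpol) = lext (\<lambda>p. if p \<in> Par d then
    pscale (1 / of_nat (card {M. has_type n p M})) (msym n p) else 0)"
proof
  fix a :: "nat multiset \<Rightarrow>\<^sub>0 'k"
  show "ident n d a = lext (\<lambda>p. if p \<in> Par d then
      pscale (1 / of_nat (card {M. has_type n p M})) (msym n p) else 0) a"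
    unfolding ident_def
    by (subst lext_superset[of "Poly_Mapping.keys a \<union> Par d"])
      (auto simp: finite_Par intro!: sum.mono_neutral_cong_left)
qed

lemma linear_ident: "Vector_Spaces.linear pscale pscale (ident n d)"
  unfolding ident_eq_lext by (rule linear_lext)

lemma linear_eq_on_kvec:
  assumes "Vector_Spaces.linear pscale pscale g" "Vector_Spaces.linear pscale pscale h"
    and "\<And>p. p \<in> Par d \<Longrightarrow> g (Poly_Mapping.single p 1) = h (Poly_Mapping.single p 1)"
    and "a \<in> kvec d"
  shows "g a = h a"
proof -
  have "g a = lext (\<lambda>e. g (Poly_Mapping.single e 1)) a" by (rule fun_cong[OF linear_eq_lext[OF assms(1)]])
  also have "\<dots> = lext (\<lambda>e. h (Poly_Mapping.single e 1)) a"
    unfolding lext_def using assms(3,4) by (intro sum.cong) (auto simp: kvec_def)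
  also have "\<dots> = h a" by (rule fun_cong[OF linear_eq_lext[OF assms(2)], symmetric])
  finally show ?thesis .
qed

lemma mon_type_part_mon: "p \<in> Par d \<Longrightarrow> mon_type (part_mon p) = p"
  by (simp add: Par_def part_mon_facts)

lemma hpoly_single: "p \<in> Par d \<Longrightarrow> hpoly d (Poly_Mapping.single p 1) = xmon (part_mon p)"
  by (simp add: hpoly_eq_lext)

text \<open>\<open>h_\<alpha>\<close> contains exactly one monomial of each type, so
  \<open>hpoly\<close> is a linear section of \<open>type_sums\<close>. It serves below as the
  standard lift of coordinate vectors.\<close>

lemma type_sums_hpoly:
  assumes "a \<in> kvec d"
  shows "type_sums d (hpoly d a) = a"
  by (rule linear_eq_on_kvec[where g = "\<lambda>a. type_sums d (hpoly d a)" and h = "\<lambda>a. a", OF _ _ _ assms])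
    (auto intro!: linear_compose[OF linear_hpoly linear_type_sums] pvs.linear_ident
      simp: hpoly_single type_sums_xmon mdeg_part_mon mon_type_part_mon)

lemma hpoly_in_Rdeg: "d \<le> n \<Longrightarrow> hpoly d a \<in> Rdeg n d"
  unfolding hpoly_def
  by (intro pvs.subspace_sum pvs.subspace_scale subspace_Rdeg) (simp add: xmon_in_Rdeg part_mon_in_mons)

lemma has_type_iff_mons: "p \<in> Par d \<Longrightarrow> d \<le> n \<Longrightarrow> has_type n p M \<longleftrightarrow> M \<in> mons n d \<and> mon_type M = p"
proof -
  assume p: "p \<in> Par d" "d \<le> n"
  have "has_type n p M \<longleftrightarrow> Poly_Mapping.keys M \<subseteq> {1..n} \<and> mon_type M = p"
    using p size_le_of_Par[OF p(1)] by (intro has_type_iff) (auto simp: Par_def)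
  moreover have "mdeg M = d" if "mon_type M = p" using that p(1) mon_type_in_Par[of M d] by simp
  ultimately show ?thesis unfolding mons_def by blast
qed

lemma msym_in_Rdeg: "p \<in> Par d \<Longrightarrow> d \<le> n \<Longrightarrow> msym n p \<in> Rdeg n d"
  unfolding msym_def
  by (intro pvs.subspace_sum subspace_Rdeg) (simp add: xmon_in_Rdeg has_type_iff_mons)

lemma ident_in_Rdeg: "d \<le> n \<Longrightarrow> ident n d a \<in> Rdeg n d"
  unfolding ident_def
  by (intro pvs.subspace_sum pvs.subspace_scale subspace_Rdeg msym_in_Rdeg)

text \<open>The type sum of \<open>m_\<lambda>\<close> is its number of monomials, and the
  normalisation in \<open>ident\<close> divides by this number. Characteristic 0 makes the division
  legitimate.\<close>

lemma type_sums_ident: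
  fixes a :: "nat multiset \<Rightarrow>\<^sub>0 'k::field_char_0"
  assumes "d \<le> n" "a \<in> kvec d"
  shows "type_sums d (ident n d a) = a"
proof (rule linear_eq_on_kvec[where g = "\<lambda>a. type_sums d (ident n d a)" and h = "\<lambda>a. a", OF _ _ _ assms(2)])
  fix p assume p: "p \<in> Par d"
  interpret t: Vector_Spaces.linear pscale pscale "type_sums d :: 'k mpol \<Rightarrow> _" by (rule linear_type_sums)
  let ?A = "{M. has_type n p M}"
  have Aeq: "?A = {M \<in> mons n d. mon_type M = p}"
    using has_type_iff_mons[OF p assms(1)] by blast
  have A: "finite ?A" "?A \<noteq> {}"
    using finite_mons[of n d] part_mon_in_mons[OF p assms(1)] mon_type_part_mon[OF p]
    unfolding Aeq by auto
  have "type_sums d (msym n p :: 'k mpol) = (\<Sum>M\<in>?A. Poly_Mapping.single p 1)"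
    unfolding msym_def t.sum Aeq
    by (rule sum.cong) (simp_all add: type_sums_xmon mons_def)
  also have "\<dots> = pscale (of_nat (card ?A)) (Poly_Mapping.single p 1)"
    by (rule pvs.sum_constant_scale)
  finally show "type_sums d (ident n d (Poly_Mapping.single p 1)) = Poly_Mapping.single p (1 :: 'k)"
    using p A(1) A(2)[unfolded card_0_eq[OF A(1), symmetric]]
    by (simp add: ident_eq_lext t.scale pscale_single del: card_eq_0_iff card_0_eq)
qed (auto intro!: linear_compose[OF linear_ident linear_type_sums] pvs.linear_ident)

lemma perm_act_msym:
  assumes "p \<in> Par d" "d \<le> n" "\<sigma> permutes {1..n}"
  shows "perm_act \<sigma> (msym n p) = (msym n p :: 'k::field mpol)"
proof -
  interpret Vector_Spaces.linear pscale pscale "perm_act \<sigma> :: 'k mpol \<Rightarrow> _" by (rule linear_perm_act)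
  have b: "bij \<sigma>" "bij (inv_into UNIV \<sigma>)" using assms(3) by (auto intro: permutes_bij bij_imp_bij_inv)
  have inv: "perm_mon \<sigma> (perm_mon (inv_into UNIV \<sigma>) M) = M" for M
    using b by (simp add: perm_mon_comp surj_iff[THEN iffD1] bij_is_surj)
  have bb: "bij_betw (perm_mon \<sigma>) {M. has_type n p M} {M. has_type n p M}"
    unfolding bij_betw_def
  proof
    show "inj_on (perm_mon \<sigma>) {M. has_type n p M}" by (auto intro!: inj_onI simp: perm_mon_inj b)
    have "M \<in> perm_mon \<sigma> ` {M. has_type n p M}" if "has_type n p M" for M
      using that b permutes_inv[OF assms(3)]
      by (intro image_eqI[of _ _ "perm_mon (inv_into UNIV \<sigma>) M"])
        (auto simp: inv has_type_iff_mons[OF assms(1,2)] perm_mon_in_mons mon_type_perm_mon)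
    then show "perm_mon \<sigma> ` {M. has_type n p M} = {M. has_type n p M}"
      using assms(3) b by (auto simp: has_type_iff_mons[OF assms(1,2)] perm_mon_in_mons mon_type_perm_mon)
  qed
  show ?thesis
    unfolding msym_def sum by (simp add: sum.reindex_bij_betw[OF bb, of xmon])
qed

lemma perm_act_ident:
  assumes "d \<le> n" "\<sigma> permutes {1..n}"
  shows "perm_act \<sigma> (ident n d a) = (ident n d a :: 'k::field mpol)"
proof -
  interpret Vector_Spaces.linear pscale pscale "perm_act \<sigma> :: 'k mpol \<Rightarrow> _" by (rule linear_perm_act)
  show ?thesis
    unfolding ident_def sum scale using assms by (simp add: perm_act_msym cong: sum.cong)
qed

lemma invariant_coeff_eq:
  assumes "\<And>\<sigma>. \<sigma> permutes {1..n} \<Longrightarrow> perm_act \<sigma> w = w"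
    and "Poly_Mapping.keys e \<subseteq> {1..n}" "Poly_Mapping.keys e' \<subseteq> {1..n}" "mon_type e = mon_type e'"
  shows "Poly_Mapping.lookup w e = Poly_Mapping.lookup w e'"
proof -
  obtain \<sigma> where "\<sigma> permutes {1..n}" "perm_mon \<sigma> e = e'"
    by (rule mon_type_eq_imp_perm[OF _ assms(2-4)]) auto
  then show ?thesis using assms(1) lookup_perm_act permutes_bij by metis
qed

lemma lookup_type_sums:
  assumes "f \<in> Rdeg n d" "p \<in> Par d"
  shows "Poly_Mapping.lookup (type_sums d f) p
    = (\<Sum>e | e \<in> mons n d \<and> mon_type e = p. Poly_Mapping.lookup f e)"
proof -
  have "Poly_Mapping.lookup (type_sums d f) p
      = (\<Sum>e\<in>mons n d. Poly_Mapping.lookup f e * (if mon_type e = p then 1 else 0))"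
    unfolding type_sums_def lookup_lext
    using assms finite_mons[of n d]
    by (intro sum.mono_neutral_cong_left) (auto simp: Rdeg_iff mons_def in_keys_iff lookup_single when_def)
  also have "\<dots> = (\<Sum>e | e \<in> mons n d \<and> mon_type e = p. Poly_Mapping.lookup f e)"
    using finite_mons[of n d] by (simp add: sum.inter_filter if_distrib cong: if_cong)
  finally show ?thesis .
qed

text \<open>The coefficients of an invariant are constant on each type, so each type sum is a
  positive integer times that coefficient. In characteristic 0 a vanishing sum forces a vanishing
  coefficient.\<close>

lemma invariant_eq_0:
  fixes f :: "'k::field_char_0 mpol"
  assumes f: "f \<in> Rdeg n d" "type_sums d f = 0"
    and inv: "\<And>\<sigma>. \<sigma> permutes {1..n} \<Longrightarrow> perm_act \<sigma> f = f"
  shows "f = 0"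
proof (rule poly_mapping_eqI)
  fix e
  show "Poly_Mapping.lookup f e = Poly_Mapping.lookup 0 e"
  proof (cases "e \<in> mons n d")
    case True
    let ?A = "{e'. e' \<in> mons n d \<and> mon_type e' = mon_type e}"
    have "mon_type e \<in> Par d" using True by (simp add: mon_type_in_Par mons_def)
    then have "0 = (\<Sum>e'\<in>?A. Poly_Mapping.lookup f e')"
      using lookup_type_sums[OF f(1)] f(2) by simp
    also have "\<dots> = (\<Sum>e'\<in>?A. Poly_Mapping.lookup f e)"
      using True by (intro sum.cong invariant_coeff_eq[OF inv]) (auto simp: mons_def)
    also have "\<dots> = of_nat (card ?A) * Poly_Mapping.lookup f e" by simp
    finally have "of_nat (card ?A) * Poly_Mapping.lookup f e = 0" by simp
    moreover have "card ?A \<noteq> 0" using True finite_mons[of n d] by auto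
    ultimately show ?thesis by simp
  next
    case False
    then have "e \<notin> Poly_Mapping.keys f" using f(1) by (auto simp: Rdeg_iff)
    then show ?thesis by (simp add: in_keys_iff)
  qed
qed

text \<open>Both sides are invariants of degree \<open>d\<close> with the same type sums, so
  \<open>invariant_eq_0\<close> applies to their difference. The right-hand coordinates are free of
  \<open>n\<close>, and this is what makes the maps for \<open>m\<close> and \<open>n\<close>
  comparable.\<close>

lemma rho_eq_ident:
  fixes f :: "'k::field_char_0 mpol"
  assumes f: "f \<in> Rdeg n d" and "d \<le> n"
  shows "rho n f = ident n d (type_sums d f)"
proof -
  interpret t: Vector_Spaces.linear pscale pscale "type_sums d :: 'k mpol \<Rightarrow> _" by (rule linear_type_sums)
  let ?S = "{\<sigma>. \<sigma> permutes {1..n}}"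
  let ?s = "\<Sum>\<sigma>\<in>?S. perm_act \<sigma> f"
  have "type_sums d ?s = (\<Sum>\<sigma>\<in>?S. type_sums d f)"
    unfolding t.sum by (rule sum.cong) (auto simp: type_sums_perm_act permutes_bij)
  then have "type_sums d (rho n f) = type_sums d f"
    \<comment> \<open>Each permutation contributes the same type sums, so the \<open>n!\<close>
      summands cancel the factor \<open>1 / n!\<close>.\<close>
    by (simp add: rho_def t.scale pvs.sum_constant_scale card_permutations[of "{1..n}" n] del: sum_constant One_nat_def)
  moreover have "perm_act \<tau> ?s = ?s" if \<tau>: "\<tau> permutes {1..n}" for \<tau>
  proof -
    interpret Vector_Spaces.linear pscale pscale "perm_act \<tau> :: 'k mpol \<Rightarrow> _" by (rule linear_perm_act)
    have "perm_act \<tau> ?s = (\<Sum>\<sigma>\<in>?S. perm_act (\<tau> \<circ> \<sigma>) f)"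
      unfolding sum by (rule sum.cong) (auto simp: perm_act_comp permutes_bij \<tau> permutes_bij[OF \<tau>])
    also have "\<dots> = ?s"
      \<comment> \<open>Composition with \<open>\<tau>\<close> only reorders the permutations that
        are summed over.\<close>
      using setum_permutations_compose_left[OF \<tau>, of "\<lambda>\<sigma>. perm_act \<sigma> f"] by simp
    finally show ?thesis .
  qed
  moreover have "?s \<in> Rdeg n d"
    using f by (auto intro!: pvs.subspace_sum subspace_Rdeg perm_act_in_Rdeg)
  ultimately have "rho n f - ident n d (type_sums d f) = 0"
  proof (intro invariant_eq_0)
    show "perm_act \<sigma> (rho n f - ident n d (type_sums d f)) = rho n f - ident n d (type_sums d f)"
      if s: "\<sigma> permutes {1..n}" and inv: "\<And>\<tau>. \<tau> permutes {1..n} \<Longrightarrow> perm_act \<tau> ?s = ?s" for \<sigma>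
    proof -
      interpret Vector_Spaces.linear pscale pscale "perm_act \<sigma> :: 'k mpol \<Rightarrow> _" by (rule linear_perm_act)
      show ?thesis
        using s inv[OF s] assms(2) by (simp add: diff perm_act_ident rho_def scale)
    qed
  qed (use assms in \<open>auto simp: rho_def t.diff type_sums_ident type_sums_in_kvec
      intro!: pvs.subspace_diff pvs.subspace_scale subspace_Rdeg ident_in_Rdeg\<close>)
  then show ?thesis by simp
qed

lemma alpha_eq:
  fixes V :: "'k::field_char_0 mpol set"
  assumes V: "pvs.subspace V" "V \<subseteq> Rdeg n d" and "d \<le> n"
  shows "alpha n d V = type_sums d ` V"
proof -
  interpret t: Vector_Spaces.linear pscale pscale "type_sums d :: 'k mpol \<Rightarrow> _" by (rule linear_type_sums)
  interpret i: Vector_Spaces.linear pscale pscale "ident n d :: _ \<Rightarrow> 'k mpol" by (rule linear_ident)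
  have "rho n ` V = ident n d ` type_sums d ` V"
    using rho_eq_ident[OF _ assms(3)] V(2) by (force simp: image_image)
  then have span: "pvs.span (rho n ` V) = ident n d ` type_sums d ` V"
    using V(1) by (simp add: i.subspace_image t.subspace_image)
  show ?thesis
  proof
    show "alpha n d V \<subseteq> type_sums d ` V"
    proof
      fix a assume "a \<in> alpha n d V"
      then obtain f where "a \<in> kvec d" "f \<in> V" "ident n d a = ident n d (type_sums d f)"
        unfolding alpha_def span by blast
      then have "a = type_sums d f"
        using type_sums_ident[OF assms(3)] type_sums_in_kvec by metis
      then show "a \<in> type_sums d ` V" using \<open>f \<in> V\<close> by blast
    qed
    show "type_sums d ` V \<subseteq> alpha n d V"
      unfolding alpha_def span using type_sums_in_kvec by blast
  qed
qed

subsection \<open>Symmetric ideals as spans\<close>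

text \<open>For generators of degree \<open>d\<close> this is the degree \<open>d\<close> part of
  the symmetric ideal, see \<open>sym_ideal_Rdeg\<close>.\<close>

definition orbit_span :: "nat \<Rightarrow> 'k::field mpol set \<Rightarrow> 'k mpol set" where
  "orbit_span n A = pvs.span {perm_act \<sigma> f |\<sigma> f. \<sigma> permutes {1..n} \<and> f \<in> A}"

lemma xmon_mult_Rpoly: "Poly_Mapping.keys e \<subseteq> {1..n} \<Longrightarrow> f \<in> Rpoly n \<Longrightarrow> xmon e * f \<in> Rpoly n"
  by (rule Rpoly_closed) (simp_all add: xmon_in_Rpoly)

lemma xmon_0 [simp]: "xmon 0 = 1"
  by (simp add: xmon_def)

lemma xmon_add: "xmon (a + b) = xmon a * xmon b"
  by (simp add: xmon_def mult_single)

text \<open>Turns the generated ideal into linear algebra. The span is an ideal because its spanning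
  set is stable under multiplication by monomials. Conversely the ideal is a linear subspace because
  constants belong to \<open>R_n\<close>.\<close>

lemma sym_ideal_eq_span:
  fixes A :: "'k::field mpol set"
  assumes A: "A \<subseteq> Rpoly n"
  shows "sym_ideal n A = pvs.span {xmon e * perm_act \<sigma> f |e \<sigma> f.
    Poly_Mapping.keys e \<subseteq> {1..n} \<and> \<sigma> permutes {1..n} \<and> f \<in> A}" (is "_ = pvs.span ?D")
proof -
  let ?R = "polyring n :: 'k mpol ring"
  let ?G = "{perm_act \<sigma> f |\<sigma> f. \<sigma> permutes {1..n} \<and> f \<in> A}"
  interpret cring ?R by (rule polyring_cring)
  have R: "carrier ?R = Rpoly n" "monoid.mult ?R = (*)" "add ?R = (+)" "\<zero>\<^bsub>?R\<^esub> = 0"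
    by (simp_all add: polyring_def)
  \<comment> \<open>Negation in the ring record is an abstract inverse and has to be matched with
    negation of polynomials.\<close>
  have minus: "\<ominus>\<^bsub>?R\<^esub> x = - x" if "x \<in> Rpoly n" for x
    using that by (intro minus_equality) (simp_all add: R Rpoly_closed)
  have G: "?G \<subseteq> Rpoly n" using A by (auto intro: perm_act_in_Rpoly)
  have "?D \<subseteq> Rpoly n" using A by (auto intro!: xmon_mult_Rpoly perm_act_in_Rpoly)
  then have D: "pvs.span ?D \<subseteq> Rpoly n" by (rule pvs.span_minimal) (rule subspace_Rpoly)
  have xmonD: "xmon e * f \<in> pvs.span ?D" if e: "Poly_Mapping.keys e \<subseteq> {1..n}" and f: "f \<in> pvs.span ?D" for e f
  proof -
    interpret l: Vector_Spaces.linear pscale pscale "\<lambda>f. xmon e * f :: 'k mpol" by (rule linear_mult)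
    have "(\<lambda>f. xmon e * f) ` ?D \<subseteq> ?D"
    proof clarify
      fix e' :: mon and \<sigma> and f :: "'k mpol"
      assume *: "Poly_Mapping.keys e' \<subseteq> {1..n}" "\<sigma> permutes {1..n}" "f \<in> A"
      have "xmon e * (xmon e' * perm_act \<sigma> f) = xmon (e + e') * perm_act \<sigma> f"
        by (simp add: xmon_add mult_ac)
      moreover have "Poly_Mapping.keys (e + e') \<subseteq> {1..n}" using e * by (simp add: keys_add_mon)
      ultimately show "\<exists>e'' \<sigma>' f'. xmon e * (xmon e' * perm_act \<sigma> f) = xmon e'' * perm_act \<sigma>' f'
          \<and> Poly_Mapping.keys e'' \<subseteq> {1..n} \<and> \<sigma>' permutes {1..n} \<and> f' \<in> A"
        using * by blast
    qed
    then have "pvs.span ((\<lambda>f. xmon e * f) ` ?D) \<subseteq> pvs.span ?D" by (rule pvs.span_mono)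
    then show ?thesis using f unfolding l.span_image by blast
  qed
  have multD: "x * f \<in> pvs.span ?D" if x: "x \<in> Rpoly n" and f: "f \<in> pvs.span ?D" for x f
  proof -
    have "x * f = (\<Sum>e\<in>Poly_Mapping.keys x. pscale (Poly_Mapping.lookup x e) (xmon e * f))"
      by (subst poly_mapping_expand[of x]) (simp add: sum_distrib_right sum_distrib_left xmon_def pscale_eq_mult mult_ac)
    also have "\<dots> \<in> pvs.span ?D"
      using x f by (intro pvs.span_sum pvs.span_scale xmonD) (auto simp: Rpoly_iff)
    finally show ?thesis .
  qed
  have id: "ideal (pvs.span ?D) ?R"
  proof (rule idealI)
    show "ring ?R" ..
    show "subgroup (pvs.span ?D) (add_monoid ?R)"
    proof (rule group.subgroupI)
      show "group (add_monoid ?R)" by (rule add.is_group)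
      show "inv\<^bsub>add_monoid ?R\<^esub> x \<in> pvs.span ?D" if "x \<in> pvs.span ?D" for x
      proof -
        have "inv\<^bsub>add_monoid ?R\<^esub> x = - x" using minus[of x] that D by (auto simp: a_inv_def)
        then show ?thesis using that by (simp add: pvs.span_neg)
      qed
      show "pvs.span ?D \<noteq> {}" using pvs.span_zero by blast
    qed (use D pvs.span_add in \<open>auto simp: R\<close>)
    fix a x assume "a \<in> pvs.span ?D" "x \<in> carrier ?R"
    then have "x * a \<in> pvs.span ?D" by (intro multD) (simp only: R)
    then show "x \<otimes>\<^bsub>?R\<^esub> a \<in> pvs.span ?D" "a \<otimes>\<^bsub>?R\<^esub> x \<in> pvs.span ?D"
      by (simp_all only: R mult.commute[of a x])
  qed
  have GD: "?G \<subseteq> ?D"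
  proof clarify
    fix \<sigma> and f :: "'k mpol" assume "\<sigma> permutes {1..n}" "f \<in> A"
    then show "\<exists>e \<sigma>' f'. perm_act \<sigma> f = xmon e * perm_act \<sigma>' f'
        \<and> Poly_Mapping.keys e \<subseteq> {1..n} \<and> \<sigma>' permutes {1..n} \<and> f' \<in> A"
      by (intro exI[of _ 0] exI[of _ \<sigma>] exI[of _ f]) simp
  qed
  have "genideal ?R ?G \<subseteq> pvs.span ?D"
    by (rule genideal_minimal[OF id order_trans[OF GD pvs.span_superset]])
  moreover have "pvs.span ?D \<subseteq> genideal ?R ?G"
  proof (rule pvs.span_minimal)
    interpret I: ideal "genideal ?R ?G" ?R using G by (intro genideal_ideal) (simp add: R)
    have mult: "x * f \<in> genideal ?R ?G" if "x \<in> Rpoly n" "f \<in> genideal ?R ?G" for x f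
      using I.I_l_closed[of f x] that by (simp add: R)
    show "pvs.subspace (genideal ?R ?G)"
    proof (rule pvs.subspaceI)
      show "pscale c x \<in> genideal ?R ?G" if "x \<in> genideal ?R ?G" for c x
        unfolding pscale_eq_mult using that by (intro mult) (auto simp: Rpoly_iff)
    qed (use I.a_closed I.zero_closed in \<open>auto simp: R\<close>)
    show "?D \<subseteq> genideal ?R ?G"
    proof clarify
      fix e :: mon and \<sigma> and f :: "'k mpol"
      assume *: "Poly_Mapping.keys e \<subseteq> {1..n}" "\<sigma> permutes {1..n}" "f \<in> A"
      have "?G \<subseteq> genideal ?R ?G" by (rule genideal_self) (simp only: R G)
      moreover have "perm_act \<sigma> f \<in> ?G" using * by blast
      ultimately show "xmon e * perm_act \<sigma> f \<in> genideal ?R ?G"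
        using * by (intro mult) (auto simp only: xmon_in_Rpoly)
    qed
  qed
  ultimately show ?thesis by (simp add: sym_ideal_def)
qed

lemma orbit_span_subset_sym_ideal: "A \<subseteq> Rpoly n \<Longrightarrow> orbit_span n A \<subseteq> sym_ideal n A"
  unfolding orbit_span_def sym_ideal_eq_span
  by (rule pvs.span_mono, clarify, rule exI[of _ 0]) auto

lemma subspace_sym_ideal: "A \<subseteq> Rpoly n \<Longrightarrow> pvs.subspace (sym_ideal n A)"
  by (simp add: sym_ideal_eq_span)

lemma subspace_orbit_span [simp]: "pvs.subspace (orbit_span n A)"
  by (simp add: orbit_span_def)

lemma sym_ideal_subset: "A \<subseteq> Rpoly n \<Longrightarrow> sym_ideal n A \<subseteq> Rpoly n"
  unfolding sym_ideal_eq_span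
  by (intro pvs.span_minimal subspace_Rpoly) (auto intro!: xmon_mult_Rpoly perm_act_in_Rpoly)

lemma xmon_mult_sym_ideal:
  fixes A :: "'k::field mpol set"
  assumes A: "A \<subseteq> Rpoly n" and "Poly_Mapping.keys e \<subseteq> {1..n}" "f \<in> sym_ideal n A"
  shows "xmon e * f \<in> sym_ideal n A"
proof -
  interpret I: ideal "sym_ideal n A" "polyring n"
    unfolding sym_ideal_def using A
    by (intro ring.genideal_ideal cring.axioms(1) polyring_cring)
      (auto simp: polyring_def intro: perm_act_in_Rpoly)
  show ?thesis
    using I.I_l_closed[of f "xmon e"] assms by (simp add: polyring_def xmon_in_Rpoly)
qed

lemma perm_act_sym_ideal:
  fixes A :: "'k::field mpol set"
  assumes A: "A \<subseteq> Rpoly n" and s: "\<sigma> permutes {1..n}" and "f \<in> sym_ideal n A"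
  shows "perm_act \<sigma> f \<in> sym_ideal n A"
proof -
  let ?D = "{xmon e * perm_act \<sigma> f |e \<sigma> f.
    Poly_Mapping.keys e \<subseteq> {1..n} \<and> \<sigma> permutes {1..n} \<and> f \<in> A}"
  interpret l: Vector_Spaces.linear pscale pscale "perm_act \<sigma> :: 'k mpol \<Rightarrow> _" by (rule linear_perm_act)
  have b: "bij \<sigma>" using s by (rule permutes_bij)
  have "perm_act \<sigma> ` ?D \<subseteq> ?D"
  proof clarify
    fix e :: mon and \<tau> and f :: "'k mpol"
    assume *: "Poly_Mapping.keys e \<subseteq> {1..n}" "\<tau> permutes {1..n}" "f \<in> A"
    have "Poly_Mapping.keys (perm_mon \<sigma> e) \<subseteq> {1..n}"
      using *(1) b permutes_image[OF s] by (auto simp: keys_perm_mon)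
    moreover have "perm_act \<sigma> (xmon e * perm_act \<tau> f) = xmon (perm_mon \<sigma> e) * perm_act (\<sigma> \<circ> \<tau>) f"
      using *(2) b by (simp add: perm_act_xmon_mult perm_act_comp permutes_bij)
    ultimately show "\<exists>e' \<sigma>' f'. perm_act \<sigma> (xmon e * perm_act \<tau> f) = xmon e' * perm_act \<sigma>' f'
        \<and> Poly_Mapping.keys e' \<subseteq> {1..n} \<and> \<sigma>' permutes {1..n} \<and> f' \<in> A"
      using * s permutes_compose[OF *(2) s] by blast
  qed
  then have "pvs.span (perm_act \<sigma> ` ?D) \<subseteq> pvs.span ?D" by (rule pvs.span_mono)
  then show ?thesis
    using assms(3) unfolding sym_ideal_eq_span[OF A] l.span_image by blast
qed

lemma sym_ideal_least:
  fixes A :: "'k::field mpol set"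
  assumes "A \<subseteq> Rpoly n" "B \<subseteq> Rpoly n" "A \<subseteq> sym_ideal n B"
  shows "sym_ideal n A \<subseteq> sym_ideal n B"
  unfolding sym_ideal_eq_span[OF assms(1)]
  using assms by (intro pvs.span_minimal subspace_sym_ideal)
    (auto intro!: xmon_mult_sym_ideal perm_act_sym_ideal)

lemma subset_sym_ideal: "A \<subseteq> Rpoly n \<Longrightarrow> A \<subseteq> sym_ideal n A"
proof -
  assume A: "A \<subseteq> Rpoly n"
  have "f \<in> orbit_span n A" if "f \<in> A" for f
    unfolding orbit_span_def using that
    by (intro pvs.span_base CollectI exI[of _ id] exI[of _ f]) (simp add: permutes_id)
  then show ?thesis using orbit_span_subset_sym_ideal[OF A] by blast
qed

lemma permutes_mono: "\<sigma> permutes {1..m} \<Longrightarrow> m \<le> n \<Longrightarrow> \<sigma> permutes {1..n :: nat}"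
  by (erule permutes_subset) auto

text \<open>Permutations of the first \<open>m\<close> variables are permutations of all
  \<open>n\<close>, so orbits and multiples formed in \<open>R_m\<close> are absorbed by the larger
  ideal. This is the commutation of \<open>eta\<close> with \<open>Phi\<close>.\<close>

lemma sym_ideal_sym_ideal:
  fixes A :: "'k::field mpol set"
  assumes A: "A \<subseteq> Rpoly m" and "m \<le> n"
  shows "sym_ideal n (sym_ideal m A) = sym_ideal n A"
proof
  have An: "A \<subseteq> Rpoly n" using A Rpoly_mono[OF assms(2)] by blast
  have Im: "sym_ideal m A \<subseteq> Rpoly n" using sym_ideal_subset[OF A] Rpoly_mono[OF assms(2)] by blast
  have "sym_ideal m A \<subseteq> sym_ideal n A"
    unfolding sym_ideal_eq_span[OF A] sym_ideal_eq_span[OF An]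
    using assms(2) permutes_mono[OF _ assms(2)] by (intro pvs.span_mono) fastforce
  then show "sym_ideal n (sym_ideal m A) \<subseteq> sym_ideal n A" by (intro sym_ideal_least Im An)
  show "sym_ideal n A \<subseteq> sym_ideal n (sym_ideal m A)"
    using subset_sym_ideal[OF A] subset_sym_ideal[OF Im] by (intro sym_ideal_least Im An) blast
qed

section \<open>Homogeneous components and the degree \<open>d\<close> part of a symmetric
  ideal\<close>

definition hcomp :: "nat \<Rightarrow> 'k::field mpol \<Rightarrow> 'k mpol" where
  "hcomp d = lext (\<lambda>e. if mdeg e = d then xmon e else 0)"

lemma linear_hcomp: "Vector_Spaces.linear pscale pscale (hcomp d)"
  unfolding hcomp_def by (rule linear_lext)

lemma lookup_hcomp: "Poly_Mapping.lookup (hcomp d f) e = (if mdeg e = d then Poly_Mapping.lookup f e else 0)"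
proof -
  have "Poly_Mapping.lookup (hcomp d f) e
      = (\<Sum>a\<in>Poly_Mapping.keys f. if a = e then (if mdeg e = d then Poly_Mapping.lookup f e else 0) else 0)"
    unfolding hcomp_def lookup_lext by (rule sum.cong) (auto simp: xmon_def lookup_single)
  then show ?thesis by (simp add: in_keys_iff)
qed

lemma hcomp_Rdeg: "f \<in> Rdeg n d \<Longrightarrow> hcomp d f = f"
  by (rule poly_mapping_eqI) (auto simp: lookup_hcomp Rdeg_iff mons_def in_keys_iff)

lemma hcomp_in_Rdeg: "f \<in> Rpoly n \<Longrightarrow> hcomp d f \<in> Rdeg n d"
  unfolding Rdeg_iff Rpoly_iff mons_def by (auto simp: in_keys_iff lookup_hcomp simp del: One_nat_def split: if_splits)

lemma lookup_xmon_mult: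
  "Poly_Mapping.lookup (xmon a * f) e \<noteq> 0 \<Longrightarrow> \<exists>b\<in>Poly_Mapping.keys f. e = a + b"
  using keys_mult[of "xmon a" f] by (auto simp: xmon_def in_keys_iff)

lemma degree_sym_ideal_gen:
  fixes f :: "'k::field mpol"
  assumes "f \<in> Rdeg n d" "\<sigma> permutes {1..n}" "e' \<in> Poly_Mapping.keys (xmon e * perm_act \<sigma> f)"
  shows "mdeg e' = mdeg e + d"
  using lookup_xmon_mult[where a = e and f = "perm_act \<sigma> f" and e = e'] assms perm_act_in_Rdeg[OF assms(2,1)]
  by (auto simp: in_keys_iff Rdeg_iff mons_def mdeg_add)

lemma Rdeg_subset_Rpoly: "Rdeg n d \<subseteq> Rpoly n"
  by (auto simp: Rdeg_def)

text \<open>Projection to degree \<open>d\<close> fixes the orbit elements and kills their products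
  with monomials other than 1, which lie in higher degree. Hence it sends the ideal into the orbit
  span.\<close>

lemma sym_ideal_Rdeg:
  fixes V :: "'k::field mpol set"
  assumes V: "V \<subseteq> Rdeg n d"
  shows "sym_ideal n V \<inter> Rdeg n d = orbit_span n V"
proof
  have VR: "V \<subseteq> Rpoly n" using V Rdeg_subset_Rpoly by blast
  interpret h: Vector_Spaces.linear pscale pscale "hcomp d :: 'k mpol \<Rightarrow> _" by (rule linear_hcomp)
  have "pvs.subspace {f :: 'k mpol. hcomp d f \<in> orbit_span n V}"
    by (rule h.subspace_linear_preimage) simp
  moreover have "hcomp d (xmon e * perm_act \<sigma> f) \<in> orbit_span n V"
    if "Poly_Mapping.keys e \<subseteq> {1..n}" and s: "\<sigma> permutes {1..n}" and f: "f \<in> V" for e \<sigma> f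
  proof (cases "e = 0")
    case True
    have "perm_act \<sigma> f \<in> orbit_span n V"
      unfolding orbit_span_def using s f by (intro pvs.span_base) auto
    moreover have "perm_act \<sigma> f \<in> Rdeg n d" using s f V by (auto intro: perm_act_in_Rdeg)
    ultimately show ?thesis using True by (simp add: hcomp_Rdeg)
  next
    case False
    have "hcomp d (xmon e * perm_act \<sigma> f) = 0"
    proof (rule poly_mapping_eqI)
      fix e'
      have "mdeg e > 0" using False by (simp add: mdeg_eq_0_iff zero_less_iff_neq_zero)
      then have "\<not> (e' \<in> Poly_Mapping.keys (xmon e * perm_act \<sigma> f) \<and> mdeg e' = d)"
        using degree_sym_ideal_gen[OF subsetD[OF V f] s, of e' e] by auto
      then show "Poly_Mapping.lookup (hcomp d (xmon e * perm_act \<sigma> f)) e' = Poly_Mapping.lookup 0 e'"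
        by (auto simp: lookup_hcomp in_keys_iff)
    qed
    then show ?thesis by (simp add: pvs.subspace_0)
  qed
  ultimately have "sym_ideal n V \<subseteq> {f. hcomp d f \<in> orbit_span n V}"
    unfolding sym_ideal_eq_span[OF VR] by (intro pvs.span_minimal) auto
  then show "sym_ideal n V \<inter> Rdeg n d \<subseteq> orbit_span n V" by (auto simp: hcomp_Rdeg dest!: subsetD)
  have "orbit_span n V \<subseteq> Rdeg n d"
    unfolding orbit_span_def using V
    by (intro pvs.span_minimal subspace_Rdeg) (auto intro: perm_act_in_Rdeg)
  then show "orbit_span n V \<subseteq> sym_ideal n V \<inter> Rdeg n d"
    using orbit_span_subset_sym_ideal[OF VR] by blast
qed

lemma orbit_span_subset_Rdeg: "V \<subseteq> Rdeg n d \<Longrightarrow> orbit_span n V \<subseteq> Rdeg n d"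
  using sym_ideal_Rdeg by blast

lemma perm_act_orbit_span:
  fixes V :: "'k::field mpol set"
  assumes V: "V \<subseteq> Rdeg n d" and s: "\<sigma> permutes {1..n}" and "f \<in> orbit_span n V"
  shows "perm_act \<sigma> f \<in> orbit_span n V"
  using assms Rdeg_subset_Rpoly perm_act_sym_ideal[OF _ s, of V f] perm_act_in_Rdeg[OF s]
  unfolding sym_ideal_Rdeg[OF V, symmetric] by blast

lemma subset_orbit_span: "V \<subseteq> orbit_span n V"
  unfolding orbit_span_def
  by (rule subsetI, rule pvs.span_base, rule CollectI, rule exI[of _ id]) (force simp: permutes_id)

lemma orbit_span_mono: "m \<le> n \<Longrightarrow> orbit_span m V \<subseteq> orbit_span n V"
  unfolding orbit_span_def by (rule pvs.span_mono) (use permutes_mono[of _ m n] in blast)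

text \<open>Type sums do not see permutations, so passing to orbits enlarges only the kernel
  part.\<close>

lemma type_sums_orbit_span:
  fixes V :: "'k::field mpol set"
  assumes V: "pvs.subspace V"
  shows "type_sums d ` orbit_span n V = type_sums d ` V"
proof
  interpret t: Vector_Spaces.linear pscale pscale "type_sums d :: 'k mpol \<Rightarrow> _" by (rule linear_type_sums)
  have "type_sums d ` orbit_span n V
      = pvs.span (type_sums d ` {perm_act \<sigma> f |\<sigma> f. \<sigma> permutes {1..n} \<and> f \<in> V})"
    unfolding orbit_span_def t.span_image ..
  also have "\<dots> \<subseteq> type_sums d ` V"
    using V by (intro pvs.span_minimal t.subspace_image)
      (auto simp: type_sums_perm_act permutes_bij)
  finally show "type_sums d ` orbit_span n V \<subseteq> type_sums d ` V" .
  show "type_sums d ` V \<subseteq> type_sums d ` orbit_span n V" by (intro image_mono subset_orbit_span)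
qed

subsection \<open>The maximality condition on the degree \<open>d\<close> part\<close>

text \<open>The kernel \<open>K_n\<close> of the overview.\<close>

definition type_null :: "nat \<Rightarrow> nat \<Rightarrow> 'k::field mpol set" where
  "type_null n d = {f \<in> Rdeg n d. type_sums d f = 0}"

lemma image_type_sums_Rdeg: "d \<le> n \<Longrightarrow> type_sums d ` Rdeg n d = (kvec d :: (nat multiset \<Rightarrow>\<^sub>0 'k::field) set)"
proof -
  assume d: "d \<le> n"
  have "a \<in> type_sums d ` Rdeg n d" if "a \<in> kvec d" for a :: "nat multiset \<Rightarrow>\<^sub>0 'k"
    using type_sums_hpoly[OF that] hpoly_in_Rdeg[OF d] by (rule image_eqI[OF sym])
  then show ?thesis by (auto simp: type_sums_in_kvec)
qed

text \<open>With \<open>J\<close> the orbit span, \<open>N\<close> its part in the kernel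
  \<open>K\<close> and \<open>T\<close> the type sums, rank and nullity give
  \<open>dim J = dim N + dim T(V)\<close> and \<open>dim R_d = dim K + P(d)\<close>. As
  \<open>r \<le> P(d)\<close>, the bound reads \<open>dim N + dim T(V) \<ge> dim K + r\<close>.
  Since \<open>dim N \<le> dim K\<close> and \<open>dim T(V) \<le> r\<close> always hold, both must
  be equalities.\<close>

lemma Otilde_iff:
  fixes V :: "'k::field mpol set"
  assumes V: "V \<in> Grass r (Rdeg n d)" and "d \<le> n" "r \<le> num_parts d"
  shows "V \<in> Otilde r d n \<longleftrightarrow> type_null n d \<subseteq> orbit_span n V \<and> pvs.dim (type_sums d ` V) = r"
proof -
  interpret t: Vector_Spaces.linear pscale pscale "type_sums d :: 'k mpol \<Rightarrow> _" by (rule linear_type_sums)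
  have Vs: "pvs.subspace V" "V \<subseteq> Rdeg n d" "pvs.dim V = r" using V by (auto simp: Grass_def)
  obtain B where B: "finite B" "(Rdeg n d :: 'k mpol set) \<subseteq> pvs.span B" by (rule Rdeg_finite_span)
  let ?J = "orbit_span n V"
  have J: "?J \<subseteq> Rdeg n d" by (rule orbit_span_subset_Rdeg[OF Vs(2)])
  let ?N = "{f \<in> ?J. type_sums d f = 0}"
  have "pvs.dim ?J = pvs.dim ?N + pvs.dim (type_sums d ` ?J)"
    using J B by (intro t.rank_nullity_on[of _ B]) auto
  then have 1: "pvs.dim ?J = pvs.dim ?N + pvs.dim (type_sums d ` V)"
    by (simp add: type_sums_orbit_span Vs)
  have "pvs.dim V = pvs.dim {f \<in> V. type_sums d f = 0} + pvs.dim (type_sums d ` V)"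
    using Vs B by (intro t.rank_nullity_on[of _ B]) auto
  then have 2: "pvs.dim (type_sums d ` V) \<le> r" using Vs by simp
  have "pvs.dim (Rdeg n d :: 'k mpol set) = pvs.dim (type_null n d :: 'k mpol set)
      + pvs.dim (type_sums d ` (Rdeg n d :: 'k mpol set))"
    unfolding type_null_def using B by (intro t.rank_nullity_on[of _ B] subspace_Rdeg)
  then have 3: "pvs.dim (Rdeg n d :: 'k mpol set) = pvs.dim (type_null n d :: 'k mpol set) + num_parts d"
    by (simp add: image_type_sums_Rdeg[OF assms(2)] dim_kvec)
  have N: "?N \<subseteq> type_null n d" using J by (auto simp: type_null_def)
  have T: "type_null n d \<subseteq> pvs.span B" using B by (auto simp: type_null_def)
  have 4: "pvs.dim ?N \<le> pvs.dim (type_null n d :: 'k mpol set)"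
    by (rule pvs.dim_mono_finite[OF B(1) T N])
  have sN: "pvs.subspace ?N"
    using pvs.subspace_inter[OF subspace_orbit_span t.subspace_kernel] by (simp add: Int_def)
  have 5: "type_null n d \<subseteq> ?J \<longleftrightarrow> pvs.dim ?N = pvs.dim (type_null n d :: 'k mpol set)"
  proof
    assume "type_null n d \<subseteq> ?J"
    then have "?N = type_null n d" using N by (auto simp: type_null_def)
    then show "pvs.dim ?N = pvs.dim (type_null n d :: 'k mpol set)" by simp
  next
    assume "pvs.dim ?N = pvs.dim (type_null n d :: 'k mpol set)"
    then have "?N = type_null n d" using pvs.subspace_eq_if_dim_ge[OF B(1) T N sN] by simp
    then show "type_null n d \<subseteq> ?J" by blast
  qed
  show ?thesis
    unfolding Otilde_def using V 1 2 3 4 assms(3) by (auto simp: sym_ideal_Rdeg[OF Vs(2)] 5)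
qed

lemma Grass_kvec_full:
  assumes "U \<in> Grass (num_parts d) (kvec d :: (nat multiset \<Rightarrow>\<^sub>0 'k::field) set)"
  shows "U = kvec d"
proof -
  obtain B where "finite B" "(kvec d :: (nat multiset \<Rightarrow>\<^sub>0 'k) set) \<subseteq> pvs.span B" by (rule kvec_finite_span)
  then show ?thesis
    using assms by (intro pvs.subspace_eq_if_dim_ge) (auto simp: Grass_def dim_kvec)
qed

lemma Oset_iff:
  fixes V :: "'k::field_char_0 mpol set"
  assumes "d \<le> n" "r \<le> num_parts d" "G \<noteq> {}" "G \<subseteq> Grass r (kvec d)"
  shows "V \<in> Oset G r d n \<longleftrightarrow>
    V \<in> Grass r (Rdeg n d) \<and> type_null n d \<subseteq> orbit_span n V \<and> type_sums d ` V \<in> G"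
proof (cases "V \<in> Grass r (Rdeg n d)")
  case V: True
  interpret t: Vector_Spaces.linear pscale pscale "type_sums d :: 'k mpol \<Rightarrow> _" by (rule linear_type_sums)
  have Vs: "pvs.subspace V" "V \<subseteq> Rdeg n d" using V by (auto simp: Grass_def)
  have *: "type_sums d ` V \<in> G \<Longrightarrow> pvs.dim (type_sums d ` V) = r"
    using assms(4) by (auto simp: Grass_def)
  show ?thesis
  proof (cases "r < num_parts d")
    case True
    then show ?thesis using V * by (auto simp: Oset_def Otilde_iff[OF V assms(1,2)] alpha_eq[OF Vs assms(1)])
  next
    case False
    then have r: "r = num_parts d" using assms(2) by simp
    then have "U = kvec d" if "U \<in> G" for U
      using that assms(4) by (intro Grass_kvec_full) auto
    then have G: "kvec d \<in> G" using assms(3) by blast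
    have full: "type_sums d ` V = kvec d" if "pvs.dim (type_sums d ` V) = r"
    proof (rule Grass_kvec_full)
      show "type_sums d ` V \<in> Grass (num_parts d) (kvec d)"
        unfolding Grass_def mem_Collect_eq
      proof (intro conjI)
        show "pvs.subspace (type_sums d ` V)" by (rule t.subspace_image[OF Vs(1)])
        show "type_sums d ` V \<subseteq> kvec d" by (rule image_subsetI) (rule type_sums_in_kvec)
        show "pvs.dim (type_sums d ` V) = num_parts d" by (rule trans[OF that r])
      qed
    qed
    have "type_sums d ` V \<in> G \<longleftrightarrow> pvs.dim (type_sums d ` V) = r" by (metis full G *)
    then show ?thesis
      using V False by (simp add: Oset_def Otilde_iff[OF V assms(1,2)])
  qed
qed (auto simp: Oset_def Otilde_def)

subsection \<open>Contraction\<close>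

text \<open>Subtraction of exponents is truncated, but under \<open>mon_le a e\<close> the condition
  \<open>e - a = c\<close> means \<open>e = a + c\<close>. In this form linearity in
  \<open>w\<close> and the commutation of monomials can be read off coefficientwise.\<close>

lemma lookup_contract:
  "Poly_Mapping.lookup (contract f w) c
    = (\<Sum>a\<in>Poly_Mapping.keys f. Poly_Mapping.lookup f a * Poly_Mapping.lookup w (a + c))"
  unfolding contract_def lookup_sum
proof (rule sum.cong[OF refl])
  fix a
  have *: "mon_le a e \<and> e - a = c \<longleftrightarrow> e = a + c" for e
  proof
    assume "mon_le a e \<and> e - a = c"
    then show "e = a + c"
      by (auto intro!: poly_mapping_eqI simp: mon_le_def lookup_add lookup_minus)
  qed (auto simp: mon_le_def lookup_add)
  have "(\<Sum>e\<in>Poly_Mapping.keys w. Poly_Mapping.lookup (if mon_le a e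
      then Poly_Mapping.single (e - a) (Poly_Mapping.lookup f a * Poly_Mapping.lookup w e) else 0) c)
    = (\<Sum>e\<in>Poly_Mapping.keys w. if e = a + c then Poly_Mapping.lookup f a * Poly_Mapping.lookup w (a + c) else 0)"
    by (rule sum.cong[OF refl]) (use * in \<open>auto simp: lookup_single when_def\<close>)
  then show "(\<Sum>e\<in>Poly_Mapping.keys w. Poly_Mapping.lookup (if mon_le a e
      then Poly_Mapping.single (e - a) (Poly_Mapping.lookup f a * Poly_Mapping.lookup w e) else 0) c)
    = Poly_Mapping.lookup f a * Poly_Mapping.lookup w (a + c)"
    by (simp add: in_keys_iff)
qed

lemma lookup_contract_xmon: "Poly_Mapping.lookup (contract (xmon a) w) c = Poly_Mapping.lookup w (a + c)"
  by (simp add: lookup_contract xmon_def)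

lemma contract_eq_lext: "contract f w = lext (\<lambda>a. contract (xmon a) w) f"
  by (rule poly_mapping_eqI) (simp add: lookup_lext lookup_contract_xmon lookup_contract[of f w])

lemma linear_contract_left: "Vector_Spaces.linear pscale pscale (\<lambda>f. contract f w)"
proof -
  have "(\<lambda>f. contract f w) = lext (\<lambda>a. contract (xmon a) w)" by (rule ext) (rule contract_eq_lext)
  then show ?thesis by (simp only: linear_lext)
qed

lemma linear_contract_right: "Vector_Spaces.linear pscale pscale (contract f)"
  by (rule pvs_linearI)
    (auto intro!: poly_mapping_eqI
      simp: lookup_contract lookup_add lookup_pscale sum.distrib sum_distrib_left algebra_simps)

lemma contract_xmon_commute: "contract (xmon a) (contract (xmon b) w) = contract (xmon b) (contract (xmon a) w)"
  by (rule poly_mapping_eqI) (simp add: lookup_contract_xmon add_ac)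

lemma contract_degree_eq_0:
  assumes "\<And>a e. a \<in> Poly_Mapping.keys f \<Longrightarrow> e \<in> Poly_Mapping.keys w \<Longrightarrow> mdeg e < mdeg a"
  shows "contract f w = 0"
proof (rule poly_mapping_eqI)
  fix c
  have "Poly_Mapping.lookup w (a + c) = 0" if "a \<in> Poly_Mapping.keys f" for a
    using assms[OF that, of "a + c"] by (auto simp: mdeg_add in_keys_iff)
  then show "Poly_Mapping.lookup (contract f w) c = Poly_Mapping.lookup 0 c"
    by (simp add: lookup_contract)
qed

text \<open>When no exponent of \<open>w\<close> exceeds the degree of one of \<open>f\<close>,
  contraction is the dual-basis pairing of coefficients, stored as a constant at exponent
  \<open>0\<close>.\<close>

lemma contract_eq_const:
  assumes "\<And>a e. a \<in> Poly_Mapping.keys f \<Longrightarrow> e \<in> Poly_Mapping.keys w \<Longrightarrow> mdeg e \<le> mdeg a"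
  shows "contract f w = Poly_Mapping.single 0 (\<Sum>a\<in>Poly_Mapping.keys f. Poly_Mapping.lookup f a * Poly_Mapping.lookup w a)"
proof (rule poly_mapping_eqI)
  fix c
  have "Poly_Mapping.lookup w (a + c) = 0" if "a \<in> Poly_Mapping.keys f" "c \<noteq> 0" for a
    using assms[OF that(1), of "a + c"] that(2) by (auto simp: mdeg_add in_keys_iff mdeg_eq_0_iff)
  then show "Poly_Mapping.lookup (contract f w) c = Poly_Mapping.lookup (Poly_Mapping.single 0
      (\<Sum>a\<in>Poly_Mapping.keys f. Poly_Mapping.lookup f a * Poly_Mapping.lookup w a)) c"
    by (cases "c = 0") (simp_all add: lookup_contract lookup_single)
qed

section \<open>Annihilators of invariant divided powers\<close>

lemma Sinv_iff: "w \<in> Sinv n (- int d) \<longleftrightarrow>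
    Poly_Mapping.keys w \<subseteq> mons n d \<and> (\<forall>\<sigma>. \<sigma> permutes {1..n} \<longrightarrow> perm_act \<sigma> w = w)"
  unfolding Sinv_def Sdeg_def Sdp_def mons_def by auto

text \<open>An invariant \<open>w\<close> of degree \<open>-d\<close> has equal coefficients on
  monomials of equal type, so each degree \<open>d\<close> monomial may be replaced by the standard
  one of its type. Monomials of higher degree annihilate \<open>w\<close>.\<close>

lemma contract_by_type:
  fixes f :: "'k::field mpol"
  assumes f: "f \<in> Rpoly n" "\<And>e. e \<in> Poly_Mapping.keys f \<Longrightarrow> d \<le> mdeg e"
    and w: "w \<in> Sinv n (- int d)" and "d \<le> n"
  shows "contract f w = contract (hpoly d (type_sums d f)) w"
proof -
  let ?h = "\<lambda>f :: 'k mpol. contract (hpoly d (type_sums d f)) w"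
  have lin: "Vector_Spaces.linear pscale pscale ?h"
    by (rule linear_compose[OF linear_compose[OF linear_type_sums linear_hpoly] linear_contract_left])
  have "contract (xmon e) w = ?h (xmon e)" if e: "e \<in> Poly_Mapping.keys f" for e
  proof (cases "mdeg e = d")
    case False
    then have "mdeg e > d" using f(2)[OF e] by simp
    then have "contract (xmon e) w = 0"
      using w by (intro contract_degree_eq_0) (auto simp: xmon_def Sinv_iff mons_def)
    moreover have "hpoly d (0 :: nat multiset \<Rightarrow>\<^sub>0 'k) = 0" by (simp add: hpoly_def)
    moreover have "contract 0 w = 0" by (simp add: contract_def)
    ultimately show ?thesis using False by (simp add: type_sums_xmon)
  next
    case True
    then have p: "mon_type e \<in> Par d" by (simp add: mon_type_in_Par)
    let ?e = "part_mon (mon_type e)"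
    have e': "e \<in> mons n d" using f(1) e True by (auto simp: mons_def Rpoly_iff simp del: One_nat_def)
    have pm: "?e \<in> mons n d" by (rule part_mon_in_mons[OF p assms(4)])
    have eq: "Poly_Mapping.lookup w e = Poly_Mapping.lookup w ?e"
      using e' pm w mon_type_part_mon[OF p] by (intro invariant_coeff_eq[of n]) (auto simp: mons_def Sinv_iff)
    have "contract (xmon e) w = contract (xmon ?e) w"
      using w e' pm eq by (subst (1 2) contract_eq_const) (auto simp: xmon_def Sinv_iff mons_def)
    then show ?thesis using True by (simp add: type_sums_xmon hpoly_single[OF p])
  qed
  then have "lext (\<lambda>e. contract (xmon e) w) f = lext (\<lambda>e. ?h (xmon e)) f"
    unfolding lext_def by (intro sum.cong) auto
  then show ?thesis
    using fun_cong[OF linear_eq_lext[OF lin], of f] by (simp add: contract_eq_lext[of f] xmon_def)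
qed

text \<open>Exchanges the invariant \<open>ident n d a\<close> for the simpler lift
  \<open>hpoly d a\<close>, which has the same type sums and therefore the same contraction with
  every \<open>w\<close>.\<close>

lemma perp_ident_eq:
  fixes U :: "(nat multiset \<Rightarrow>\<^sub>0 'k::field_char_0) set"
  assumes "d \<le> n" "U \<subseteq> kvec d"
  shows "perp n d (ident n d ` U) = {w \<in> Sinv n (- int d). \<forall>a\<in>U. contract (hpoly d a) w = 0}"
proof -
  have "contract (ident n d a) w = contract (hpoly d a) w" if "w \<in> Sinv n (- int d)" "a \<in> U" for a w
  proof -
    have "ident n d a \<in> Rdeg n d" by (rule ident_in_Rdeg[OF assms(1)])
    then have "contract (ident n d a) w = contract (hpoly d (type_sums d (ident n d a))) w"
      using that assms(1) by (intro contract_by_type[of _ n]) (auto simp: Rdeg_def)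
    then show ?thesis using type_sums_ident[OF assms(1)] that(2) assms(2) by force
  qed
  then show ?thesis unfolding perp_def by auto
qed

text \<open>The nontrivial half of double annihilation: every functional on \<open>kvec d\<close> is
  contraction with some invariant, so a functional vanishing on \<open>U\<close> but not at
  \<open>b\<close> gives the required \<open>w\<close>.\<close>

lemma perp_separates:
  fixes U :: "(nat multiset \<Rightarrow>\<^sub>0 'k::field_char_0) set"
  assumes "d \<le> n" "U \<subseteq> kvec d" "pvs.subspace U" "b \<in> kvec d" "b \<notin> U"
  obtains w where "w \<in> perp n d (ident n d ` U)" "contract (hpoly d b) w \<noteq> 0"
proof -
  obtain \<phi> where \<phi>: "Vector_Spaces.linear pscale (*) \<phi>" "\<forall>y\<in>U. \<phi> y = 0" "\<phi> b = 1"
    using pvs.separating_functional[OF assms(3,5)] by blast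
  interpret \<phi>: Vector_Spaces.linear pscale "(*)" \<phi> by (rule \<phi>(1))
  \<comment> \<open>The coefficient at \<open>e\<close> depends only on the type of
    \<open>e\<close>, which makes \<open>w\<close> invariant; pairing with a form applies
    \<open>\<phi>\<close> to its type sums.\<close>
  define w where "w = (\<Sum>e\<in>mons n d. Poly_Mapping.single e (\<phi> (Poly_Mapping.single (mon_type e) 1)))"
  have lw: "Poly_Mapping.lookup w e = (if e \<in> mons n d then \<phi> (Poly_Mapping.single (mon_type e) 1) else 0)" for e
    using finite_mons by (simp add: w_def lookup_sum lookup_single when_def)
  then have keys: "Poly_Mapping.keys w \<subseteq> mons n d" by (auto simp: in_keys_iff split: if_splits)
  have "perm_act \<sigma> w = w" if s: "\<sigma> permutes {1..n}" for \<sigma>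
  proof (rule poly_mapping_eqI)
    fix e
    have b: "bij \<sigma>" "bij (inv_into UNIV \<sigma>)" using s by (auto intro: permutes_bij bij_imp_bij_inv)
    have inv: "perm_mon \<sigma> (perm_mon (inv_into UNIV \<sigma>) e) = e"
      using b by (simp add: perm_mon_comp surj_iff[THEN iffD1] bij_is_surj)
    have "perm_mon (inv_into UNIV \<sigma>) e \<in> mons n d \<longleftrightarrow> e \<in> mons n d"
      using inv perm_mon_in_mons[OF s, of "perm_mon (inv_into UNIV \<sigma>) e"]
        perm_mon_in_mons[OF permutes_inv[OF s], of e] by auto
    then show "Poly_Mapping.lookup (perm_act \<sigma> w) e = Poly_Mapping.lookup w e"
      using lookup_perm_act[OF b(1), of w "perm_mon (inv_into UNIV \<sigma>) e"] b(2)
      by (simp add: inv lw mon_type_perm_mon)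
  qed
  with keys have wS: "w \<in> Sinv n (- int d)" by (simp add: Sinv_iff)
  have pair: "contract (hpoly d a) w = Poly_Mapping.single 0 (\<phi> a)" if "a \<in> kvec d" for a
  proof -
    let ?f = "hpoly d a"
    have f: "Poly_Mapping.keys ?f \<subseteq> mons n d"
      using hpoly_in_Rdeg[OF assms(1), of a] by (simp add: Rdeg_iff)
    have "contract ?f w = Poly_Mapping.single 0
        (\<Sum>e\<in>Poly_Mapping.keys ?f. Poly_Mapping.lookup ?f e * Poly_Mapping.lookup w e)"
      using f keys by (intro contract_eq_const) (force simp: mons_def)
    also have "(\<Sum>e\<in>Poly_Mapping.keys ?f. Poly_Mapping.lookup ?f e * Poly_Mapping.lookup w e)
        = \<phi> (\<Sum>e\<in>Poly_Mapping.keys ?f. pscale (Poly_Mapping.lookup ?f e) (Poly_Mapping.single (mon_type e) 1))"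
      unfolding \<phi>.sum \<phi>.scale using f by (intro sum.cong) (auto simp: lw)
    also have "(\<Sum>e\<in>Poly_Mapping.keys ?f. pscale (Poly_Mapping.lookup ?f e) (Poly_Mapping.single (mon_type e) 1))
        = type_sums d ?f"
      unfolding type_sums_def lext_def using f by (intro sum.cong) (auto simp: mons_def)
    finally show ?thesis using type_sums_hpoly[OF that] by simp
  qed
  show ?thesis
  proof
    show "w \<in> perp n d (ident n d ` U)"
      unfolding perp_ident_eq[OF assms(1,2)] using wS pair assms(2) \<phi>(2) by auto
    show "contract (hpoly d b) w \<noteq> 0" using pair[OF assms(4)] \<phi>(3) by simp
  qed
qed

text \<open>Annihilating all of \<open>Sge\<close> excludes monomials of degree below
  \<open>d\<close>. On what remains, annihilating the complement of \<open>U\<close> depends only on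
  the type sums and means that they lie in \<open>U\<close>.\<close>

lemma Psi_iff:
  fixes U :: "(nat multiset \<Rightarrow>\<^sub>0 'k::field_char_0) set"
  assumes "d \<le> n" "U \<subseteq> kvec d" "pvs.subspace U"
  shows "f \<in> Psi n d U \<longleftrightarrow>
    f \<in> Rpoly n \<and> (\<forall>e\<in>Poly_Mapping.keys f. d \<le> mdeg e) \<and> type_sums d f \<in> U" (is "_ \<longleftrightarrow> ?R")
proof
  let ?W = "perp n d (ident n d ` U)"
  \<comment> \<open>Since \<open>0\<close> lies in both summands, annihilating all sums implies
    annihilating each summand separately.\<close>
  have W0: "0 \<in> ?W"
    unfolding perp_ident_eq[OF assms(1,2)] by (simp add: Sinv_iff contract_def perm_act_def)
  assume "f \<in> Psi n d U"
  then have f: "f \<in> Rpoly n"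
    and ann: "\<And>w w'. w \<in> ?W \<Longrightarrow> w' \<in> Sge n (- int d + 1) \<Longrightarrow> contract f (w + w') = 0"
    unfolding Psi_def annih_def by blast+
  have deg: "d \<le> mdeg e" if e: "e \<in> Poly_Mapping.keys f" for e
  proof (rule ccontr)
    assume "\<not> d \<le> mdeg e"
    \<comment> \<open>The dual basis element of \<open>e\<close> serves as a test: the constant term
      of its contraction by \<open>f\<close> is the coefficient of \<open>f\<close> at
      \<open>e\<close>.\<close>
    then have "Poly_Mapping.single e 1 \<in> Sge n (- int d + 1)"
      using e f by (auto simp: Sge_def Sdp_def Rpoly_iff)
    then have "contract f (0 + Poly_Mapping.single e 1) = 0" by (rule ann[OF W0])
    then have "Poly_Mapping.lookup (contract f (Poly_Mapping.single e 1)) 0 = 0" by simp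
    moreover have "Poly_Mapping.lookup (contract f (Poly_Mapping.single e 1)) 0
        = (\<Sum>a\<in>Poly_Mapping.keys f. if a = e then Poly_Mapping.lookup f a else 0)"
      unfolding lookup_contract by (rule sum.cong) (auto simp: lookup_single)
    ultimately show False using e by (simp add: in_keys_iff)
  qed
  have "type_sums d f \<in> U"
  proof (rule ccontr)
    assume "type_sums d f \<notin> U"
    then obtain w where w: "w \<in> ?W" "contract (hpoly d (type_sums d f)) w \<noteq> 0"
      by (rule perp_separates[OF assms type_sums_in_kvec])
    have "contract f (w + 0) = 0" using w(1) by (rule ann) (simp add: Sge_def Sdp_def)
    moreover have "contract f w = contract (hpoly d (type_sums d f)) w"
      using w(1) f deg assms(1) by (intro contract_by_type[of _ n]) (auto simp: perp_def)
    ultimately show False using w(2) by simp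
  qed
  with f deg show ?R by blast
next
  assume R: ?R
  have "contract f (w + w') = 0" if w: "w \<in> perp n d (ident n d ` U)" and w': "w' \<in> Sge n (- int d + 1)" for w w'
  proof -
    interpret Vector_Spaces.linear pscale pscale "contract f :: 'k dpow \<Rightarrow> _" by (rule linear_contract_right)
    have "contract f w = contract (hpoly d (type_sums d f)) w"
      using w R assms(1) by (intro contract_by_type[of _ n]) (auto simp: perp_def)
    also have "\<dots> = 0" using w R unfolding perp_ident_eq[OF assms(1,2)] by blast
    moreover have "contract f w' = 0"
      using R w' by (intro contract_degree_eq_0) (fastforce simp: Sge_def)
    ultimately show ?thesis by (simp add: add)
  qed
  then show "f \<in> Psi n d U" using R unfolding Psi_def annih_def by blast
qed

text \<open>A form with the same type sums as some \<open>g\<close> in \<open>V\<close> differs from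
  \<open>g\<close> by an element of the kernel, and the whole kernel lies in the orbit span.\<close>

lemma orbit_span_eq:
  fixes V :: "'k::field mpol set"
  assumes V: "pvs.subspace V" "V \<subseteq> Rdeg n d" and null: "type_null n d \<subseteq> orbit_span n V"
  shows "orbit_span n V = {f \<in> Rdeg n d. type_sums d f \<in> type_sums d ` V}"
proof
  interpret t: Vector_Spaces.linear pscale pscale "type_sums d :: 'k mpol \<Rightarrow> _" by (rule linear_type_sums)
  show "orbit_span n V \<subseteq> {f \<in> Rdeg n d. type_sums d f \<in> type_sums d ` V}"
    using orbit_span_subset_Rdeg[OF V(2)] type_sums_orbit_span[OF V(1), of d n] by blast
  show "{f \<in> Rdeg n d. type_sums d f \<in> type_sums d ` V} \<subseteq> orbit_span n V"
  proof clarify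
    fix f g assume f: "f \<in> Rdeg n d" "type_sums d f = type_sums d g" and g: "g \<in> V"
    have "f - g \<in> Rdeg n d" using f(1) g V(2) by (intro pvs.subspace_diff subspace_Rdeg) auto
    then have "f - g \<in> orbit_span n V" using f(2) null by (auto simp: type_null_def t.diff)
    moreover have "g \<in> orbit_span n V" using g subset_orbit_span by blast
    ultimately have "(f - g) + g \<in> orbit_span n V" by (rule pvs.subspace_add[OF subspace_orbit_span])
    then show "f \<in> orbit_span n V" by simp
  qed
qed

lemma mon_split:
  fixes e :: mon
  assumes "i \<in> Poly_Mapping.keys e"
  shows "e = Poly_Mapping.single i 1 + (e - Poly_Mapping.single i 1)"
  using assms by (intro poly_mapping_eqI) (auto simp: lookup_add lookup_minus lookup_single when_def in_keys_iff)

lemma mons_Suc_split: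
  assumes "e \<in> mons n (Suc d)"
  obtains i c where "i \<in> {1..n}" "c \<in> mons n d" "e = Poly_Mapping.single i 1 + c"
proof -
  have "e \<noteq> 0" using assms by (auto simp: mons_def)
  then obtain i where i: "i \<in> Poly_Mapping.keys e" by fastforce
  define c where "c = e - Poly_Mapping.single i 1"
  have e: "e = Poly_Mapping.single i 1 + c" using mon_split[OF i] by (simp add: c_def)
  have "mdeg e = 1 + mdeg c" by (subst e) (simp add: mdeg_add)
  moreover have "Poly_Mapping.keys e = {i} \<union> Poly_Mapping.keys c"
    by (subst e) (simp add: keys_add_mon)
  ultimately show ?thesis using assms e that[of i c] by (auto simp: mons_def)
qed

text \<open>Induction on the degree, peeling off one variable at a time.\<close>

lemma sym_ideal_higher:
  fixes V :: "'k::field mpol set"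
  assumes V: "V \<subseteq> Rpoly n" and gen: "\<And>e. e \<in> mons n c \<Longrightarrow> xmon e \<in> sym_ideal n V"
    and e: "Poly_Mapping.keys e \<subseteq> {1..n}" "c \<le> mdeg e"
  shows "xmon e \<in> sym_ideal n V"
proof -
  have "xmon e \<in> sym_ideal n V" if "e \<in> mons n (c + k)" for k e
    using that
  proof (induction k arbitrary: e)
    case 0
    then show ?case using gen by simp
  next
    case (Suc k)
    then have "e \<in> mons n (Suc (c + k))" by simp
    then obtain i b where "i \<in> {1..n}" "b \<in> mons n (c + k)" "e = Poly_Mapping.single i 1 + b"
      by (rule mons_Suc_split)
    then show ?case using Suc.IH by (simp add: xmon_add) (intro xmon_mult_sym_ideal[OF V]; simp)
  qed
  from this[of e "mdeg e - c"] e show ?thesis by (simp add: mons_def)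
qed

subsection \<open>Degrees above the generators\<close>

lemma finite_basis_list:
  fixes W :: "('i \<Rightarrow>\<^sub>0 'k::field) set"
  assumes "pvs.subspace W" "finite B" "W \<subseteq> pvs.span B"
  shows "\<exists>vs. is_basis vs W"
proof -
  obtain C where C: "C \<subseteq> W" "pvs.independent C" "W \<subseteq> pvs.span C" "finite C" "card C = pvs.dim W"
    by (rule pvs.finite_basis_of_subset[OF assms(2,3)])
  obtain vs where "set vs = C" "distinct vs" using finite_distinct_list[OF C(4)] by blast
  moreover have "pvs.span C = W" by (rule pvs.span_subspace[OF C(1,3) assms(1)])
  ultimately have "is_basis vs W" using C(2) by (simp add: is_basis_def)
  then show ?thesis ..
qed

lemma is_basis_expand:
  assumes "is_basis vs W" "F \<in> W"
  shows "\<exists>c. F = (\<Sum>j<length vs. pscale (c j) (vs ! j))"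
proof -
  have "F \<in> pvs.span (set vs)" "distinct vs" using assms by (auto simp: is_basis_def)
  then obtain u where "F = (\<Sum>v\<in>set vs. pscale (u v) v)"
    unfolding pvs.span_finite[OF finite_set] by blast
  also have "\<dots> = (\<Sum>j<length vs. pscale (u (vs ! j)) (vs ! j))"
    by (rule sum.reindex_bij_betw[OF bij_betw_nth, symmetric]) (use \<open>distinct vs\<close> in auto)
  finally show ?thesis by (rule exI[of _ "\<lambda>j. u (vs ! j)"])
qed

text \<open>
  Comparing \<open>x\<^sub>p \<circ> (x\<^sub>q \<circ> w)\<close> with \<open>x\<^sub>q \<circ> (x\<^sub>p \<circ> w)\<close> gives a linear relation of \<open>W\<close>
  in which a third variable does not occur, so that property \<open>\<P>\<close> forces its coefficients to vanish.
\<close>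

lemma propP_contractions_eq_0:
  fixes w :: "'k::field dpow"
  assumes basis: "is_basis Fs W" and P: "propP n Fs" and "3 \<le> n"
    and W: "\<And>i. i \<in> {1..n} \<Longrightarrow> contract (xvar i) w \<in> W"
    and p: "p \<in> {1..n}"
  shows "contract (xvar p) w = 0"
proof -
  let ?b = "length Fs"
  \<comment> \<open>Two further indices, taken from \<open>1, 2, 3\<close>: the pair is
    \<open>2, 3\<close> for \<open>p = 1\<close>, \<open>1, 3\<close> for \<open>p = 2\<close>, and
    \<open>1, 2\<close> otherwise.\<close>
  have "\<exists>q l. q \<in> {1..n} \<and> l \<in> {1..n} \<and> p \<noteq> q \<and> q \<noteq> l \<and> p \<noteq> l"
    by (rule exI[of _ "if p = 1 then 2 else 1"], rule exI[of _ "if p = 1 \<or> p = 2 then 3 else 2"])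
      (use assms(3) in auto)
  then obtain q l where ql: "q \<in> {1..n}" "l \<in> {1..n}" "p \<noteq> q" "q \<noteq> l" "p \<noteq> l" by blast
  obtain c where c: "contract (xvar p) w = (\<Sum>j<?b. pscale (c j) (Fs ! j))"
    using is_basis_expand[OF basis W[OF p]] by blast
  obtain c' where c': "contract (xvar q) w = (\<Sum>j<?b. pscale (c' j) (Fs ! j))"
    using is_basis_expand[OF basis W[OF ql(1)]] by blast
  \<comment> \<open>Coefficients of the relation with entries \<open>c j * x_q - c' j * x_p\<close>.
    Applied to the basis it gives \<open>x_q \<circ> (x_p \<circ> w) - x_p \<circ> (x_q \<circ> w) =
    0\<close>, and its coefficients at \<open>x_l\<close> are all \<open>0\<close>.\<close>
  define cc where "cc i j = (if i = q then c j else if i = p then - c' j else 0)" for i j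
  let ?l = "\<lambda>j. pscale (c j) (xvar q) - pscale (c' j) (xvar p) :: 'k mpol"
  have l: "(\<Sum>i=1..n. pscale (cc i j) (xvar i)) = ?l j" for j
  proof -
    have "(\<Sum>i=1..n. pscale (cc i j) (xvar i)) = (\<Sum>i=1..n. (if i = q then pscale (c j) (xvar q) else 0)
        + (if i = p then - pscale (c' j) (xvar p) else 0))"
      using ql(3) by (intro sum.cong) (auto simp: cc_def)
    also have "\<dots> = ?l j" using p ql(1) by (simp add: sum.distrib)
    finally show ?thesis .
  qed
  let ?L = "\<Sum>j<?b. Poly_Mapping.single j (\<Sum>i=1..n. pscale (cc i j) (xvar i :: 'k mpol))"
  have L: "Poly_Mapping.lookup ?L j = (if j < ?b then ?l j else 0)" for j
    unfolding l by (simp add: lookup_sum lookup_single when_def)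
  have "?L \<in> lin_rels n Fs"
    unfolding lin_rels_def mem_Collect_eq
  proof (intro conjI allI impI)
    show "Poly_Mapping.keys ?L \<subseteq> {..<?b}"
    proof
      fix j assume "j \<in> Poly_Mapping.keys ?L"
      then show "j \<in> {..<?b}" unfolding in_keys_iff L by (simp split: if_splits)
    qed
    have "xvar i \<in> (Rdeg n 1 :: 'k mpol set)" if "i \<in> {1..n}" for i
      using that by (auto simp: xvar_def xmon_in_Rdeg mons_def)
    then show "Poly_Mapping.lookup ?L j \<in> Rdeg n 1" if "j < ?b" for j
      using that p ql(1) unfolding L
      by (simp add: pvs.subspace_diff[OF subspace_Rdeg] pvs.subspace_scale[OF subspace_Rdeg] del: One_nat_def)
    have left: "contract (?l j) F = pscale (c j) (contract (xvar q) F) - pscale (c' j) (contract (xvar p) F)" for j F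
    proof -
      interpret Vector_Spaces.linear pscale pscale "\<lambda>f. contract f F" by (rule linear_contract_left)
      show ?thesis by (simp add: diff scale)
    qed
    have right: "(\<Sum>j<?b. pscale (u j) (contract f (Fs ! j))) = contract f (\<Sum>j<?b. pscale (u j) (Fs ! j))" for u f
    proof -
      interpret Vector_Spaces.linear pscale pscale "contract f" by (rule linear_contract_right)
      show ?thesis by (simp add: sum scale)
    qed
    have "(\<Sum>j<?b. contract (Poly_Mapping.lookup ?L j) (Fs ! j)) = (\<Sum>j<?b. contract (?l j) (Fs ! j))"
      unfolding L by (intro sum.cong) simp_all
    also have "\<dots> = contract (xvar q) (contract (xvar p) w) - contract (xvar p) (contract (xvar q) w)"
      unfolding left sum_subtractf right c[symmetric] c'[symmetric] ..
    also have "\<dots> = 0" by (simp add: xvar_def contract_xmon_commute)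
    finally show "(\<Sum>j<?b. contract (Poly_Mapping.lookup ?L j) (Fs ! j)) = 0" .
  qed
  then have "\<forall>j<?b. \<forall>i\<in>{1..n}. \<forall>i'\<in>{1..n}. cc i j = cc i' j"
    using P unfolding propP_def by blast
  then have "cc q j = cc l j" if "j < ?b" for j using that ql by blast
  then have "c j = 0" if "j < ?b" for j using that ql by (simp add: cc_def)
  then show ?thesis unfolding c by (intro sum.neutral) simp
qed

lemma sym_ideal_degree_Suc:
  fixes V :: "'k::field_char_0 mpol set"
  assumes V: "pvs.subspace V" "V \<subseteq> Rdeg n d" and null: "type_null n d \<subseteq> orbit_span n V"
    and "d \<le> n" "3 \<le> n"
    and P: "\<And>Fs. is_basis Fs (perp n d (ident n d ` type_sums d ` V)) \<Longrightarrow> propP n Fs"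
    and e: "e \<in> mons n (Suc d)"
  shows "xmon e \<in> sym_ideal n V"
proof (rule ccontr)
  let ?U = "type_sums d ` V"
  let ?W = "perp n d (ident n d ` ?U)"
  interpret t: Vector_Spaces.linear pscale pscale "type_sums d :: 'k mpol \<Rightarrow> _" by (rule linear_type_sums)
  have VR: "V \<subseteq> Rpoly n" using V(2) Rdeg_subset_Rpoly by blast
  have U: "?U \<subseteq> kvec d" by (rule image_subsetI) (rule type_sums_in_kvec)
  assume "xmon e \<notin> sym_ideal n V"
  then obtain \<phi> where \<phi>: "Vector_Spaces.linear pscale (*) \<phi>" "\<forall>y\<in>sym_ideal n V. \<phi> y = 0" "\<phi> (xmon e) = 1"
    using pvs.separating_functional[OF subspace_sym_ideal[OF VR]] by blast
  interpret \<phi>: Vector_Spaces.linear pscale "(*)" \<phi> by (rule \<phi>(1))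
  define w where "w = (\<Sum>e\<in>mons n (Suc d). Poly_Mapping.single e (\<phi> (xmon e)))"
  have lw: "Poly_Mapping.lookup w e = (if e \<in> mons n (Suc d) then \<phi> (xmon e) else 0)" for e
    using finite_mons by (simp add: w_def lookup_sum lookup_single when_def)
  have lF: "Poly_Mapping.lookup (contract (xvar i) w) c = (if c \<in> mons n d then \<phi> (xvar i * xmon c) else 0)"
    if i: "i \<in> {1..n}" for i c
  proof -
    have "Poly_Mapping.single i 1 + c \<in> mons n (Suc d) \<longleftrightarrow> c \<in> mons n d"
      using i unfolding mons_def by (simp add: keys_add_mon mdeg_add)
    then show ?thesis unfolding xvar_def lookup_contract_xmon lw by (simp add: xmon_add)
  qed
  have mem: "\<phi> (xvar i * g) = 0" if "i \<in> {1..n}" "g \<in> orbit_span n V" for i g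
  proof -
    have "xvar i * g \<in> sym_ideal n V"
      unfolding xvar_def using that orbit_span_subset_sym_ideal[OF VR]
      by (intro xmon_mult_sym_ideal[OF VR]) auto
    then show ?thesis using \<phi>(2) by blast
  qed
  have FW: "contract (xvar i) w \<in> ?W" if i: "i \<in> {1..n}" for i
    unfolding perp_ident_eq[OF assms(4) U] mem_Collect_eq Sinv_iff
  proof (intro conjI allI impI ballI)
    let ?F = "contract (xvar i) w"
    interpret m: Vector_Spaces.linear pscale pscale "\<lambda>g. xvar i * g :: 'k mpol" by (rule linear_mult)
    show keys: "Poly_Mapping.keys ?F \<subseteq> mons n d"
      by (rule subsetI) (simp add: in_keys_iff lF[OF i] split: if_splits)
    show "perm_act \<sigma> ?F = ?F" if s: "\<sigma> permutes {1..n}" for \<sigma>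
    proof (rule poly_mapping_eqI)
      fix c
      have b: "bij \<sigma>" "bij (inv_into UNIV \<sigma>)" using s by (auto intro: permutes_bij bij_imp_bij_inv)
      define a where "a = perm_mon (inv_into UNIV \<sigma>) c"
      have ca: "c = perm_mon \<sigma> a"
        using b by (simp add: a_def perm_mon_comp surj_iff[THEN iffD1] bij_is_surj)
      have mons: "a \<in> mons n d \<longleftrightarrow> c \<in> mons n d"
        using perm_mon_in_mons[OF s, of a] perm_mon_in_mons[OF permutes_inv[OF s], of c]
        by (auto simp flip: a_def ca)
      \<comment> \<open>The two coefficients are the values of \<open>\<phi>\<close> at
        \<open>x_i\<close> times monomials of equal type. Their difference comes from an element of
        the kernel, hence of the orbit span, and its multiple by \<open>x_i\<close> lies in the
        ideal.\<close>
      have "Poly_Mapping.lookup ?F a = Poly_Mapping.lookup ?F c"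
      proof (cases "c \<in> mons n d")
        case True
        have "mdeg a = d" "mdeg c = d" "mon_type c = mon_type a"
          using True mons b(1) by (simp_all add: mons_def ca mon_type_perm_mon)
        then have "type_sums d (xmon a - xmon c :: 'k mpol) = 0" by (simp add: t.diff type_sums_xmon)
        moreover have "xmon a - xmon c \<in> (Rdeg n d :: 'k mpol set)"
          using True mons by (intro pvs.subspace_diff[OF subspace_Rdeg]) (simp_all add: xmon_in_Rdeg)
        ultimately have "xmon a - xmon c \<in> (type_null n d :: 'k mpol set)" by (simp add: type_null_def)
        then have "\<phi> (xvar i * (xmon a - xmon c)) = 0" using null by (intro mem[OF i]) blast
        then show ?thesis using True mons by (simp add: lF[OF i] m.diff \<phi>.diff)
      qed (use mons in \<open>simp add: lF[OF i]\<close>)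
      then show "Poly_Mapping.lookup (perm_act \<sigma> ?F) c = Poly_Mapping.lookup ?F c"
        using lookup_perm_act[OF b(1), of ?F a] by (simp add: ca)
    qed
    show "contract (hpoly d a) ?F = 0" if a: "a \<in> ?U" for a
    proof -
      let ?f = "hpoly d a"
      have fR: "?f \<in> Rdeg n d" by (rule hpoly_in_Rdeg[OF assms(4)])
      then have f: "Poly_Mapping.keys ?f \<subseteq> mons n d" by (simp add: Rdeg_iff)
      have "contract ?f ?F = Poly_Mapping.single 0
          (\<Sum>e\<in>Poly_Mapping.keys ?f. Poly_Mapping.lookup ?f e * Poly_Mapping.lookup ?F e)"
        using f keys by (intro contract_eq_const) (force simp: mons_def)
      also have "(\<Sum>e\<in>Poly_Mapping.keys ?f. Poly_Mapping.lookup ?f e * Poly_Mapping.lookup ?F e)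
          = \<phi> (xvar i * (\<Sum>e\<in>Poly_Mapping.keys ?f. pscale (Poly_Mapping.lookup ?f e) (xmon e)))"
        unfolding m.sum m.scale \<phi>.sum \<phi>.scale using f by (intro sum.cong) (auto simp: lF[OF i])
      also have "(\<Sum>e\<in>Poly_Mapping.keys ?f. pscale (Poly_Mapping.lookup ?f e) (xmon e)) = ?f"
        unfolding xmon_def by (rule poly_mapping_expand[symmetric])
      also have "\<phi> (xvar i * ?f) = 0"
      proof (rule mem[OF i])
        have "type_sums d ?f = a" using a U by (intro type_sums_hpoly) blast
        then show "?f \<in> orbit_span n V" unfolding orbit_span_eq[OF V null] using fR a by simp
      qed
      finally show ?thesis by simp
    qed
  qed
  \<comment> \<open>Property \<open>\<P>\<close> is stated for bases given as lists. One exists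
    because the complement is a subspace of a finite-dimensional graded piece.\<close>
  obtain Fs where Fs: "is_basis Fs ?W"
  proof -
    have "pvs.subspace ?W"
      unfolding perp_ident_eq[OF assms(4) U]
    proof (rule pvs.subspaceI)
      show "0 \<in> {w \<in> Sinv n (- int d). \<forall>a\<in>?U. contract (hpoly d a) w = 0}"
        by (simp add: Sinv_iff contract_def perm_act_def)
    next
      fix x y assume xy: "x \<in> {w \<in> Sinv n (- int d). \<forall>a\<in>?U. contract (hpoly d a) w = 0}"
        "y \<in> {w \<in> Sinv n (- int d). \<forall>a\<in>?U. contract (hpoly d a) w = 0}"
      then show "x + y \<in> {w \<in> Sinv n (- int d). \<forall>a\<in>?U. contract (hpoly d a) w = 0}"
        using Poly_Mapping.keys_add[of x y]
        by (auto simp: Sinv_iff module_hom.add[OF linear_contract_right[THEN Vector_Spaces.linear.axioms(3)]]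
          module_hom.add[OF linear_perm_act[THEN Vector_Spaces.linear.axioms(3)]])
    next
      fix c x assume "x \<in> {w \<in> Sinv n (- int d). \<forall>a\<in>?U. contract (hpoly d a) w = 0}"
      moreover have "Poly_Mapping.keys (pscale c x) \<subseteq> Poly_Mapping.keys x" by (auto simp: in_keys_iff lookup_pscale)
      ultimately show "pscale c x \<in> {w \<in> Sinv n (- int d). \<forall>a\<in>?U. contract (hpoly d a) w = 0}"
        by (auto simp: Sinv_iff module_hom.scale[OF linear_contract_right[THEN Vector_Spaces.linear.axioms(3)]]
          module_hom.scale[OF linear_perm_act[THEN Vector_Spaces.linear.axioms(3)]])
    qed
    moreover have "?W \<subseteq> pvs.span ((\<lambda>i. Poly_Mapping.single i 1) ` mons n d)"
      unfolding keys_subset_eq_span[symmetric] perp_ident_eq[OF assms(4) U] by (auto simp: Sinv_iff)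
    ultimately show ?thesis
      using finite_basis_list[of ?W] finite_mons[of n d] that by blast
  qed
  obtain i c where ic: "i \<in> {1..n}" "c \<in> mons n d" "e = Poly_Mapping.single i 1 + c"
    by (rule mons_Suc_split[OF e])
  have "contract (xvar i) w = 0"
    by (rule propP_contractions_eq_0[OF Fs P[OF Fs] assms(5) FW ic(1)])
  then have "\<phi> (xvar i * xmon c) = 0" using lF[OF ic(1), of c] ic(2) by simp
  then show False using \<phi>(3) ic(3) by (simp add: xmon_add xvar_def)
qed

text \<open>Equality is checked by degree: in degree \<open>d\<close> it is
  \<open>orbit_span_eq\<close>, above it both sides contain every monomial. For at least three
  variables the latter starts from degree \<open>d + 1\<close>; in the remaining case the type sums
  fill \<open>kvec d\<close>, and all monomials of degree \<open>d\<close> are already in the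
  ideal.\<close>

lemma sym_ideal_eq_Psi:
  fixes V :: "'k::field_char_0 mpol set"
  assumes V: "pvs.subspace V" "V \<subseteq> Rdeg n d" and null: "type_null n d \<subseteq> orbit_span n V"
    and "d \<le> n" and n: "3 \<le> n \<or> type_sums d ` V = kvec d"
    and P: "\<And>Fs. is_basis Fs (perp n d (ident n d ` type_sums d ` V)) \<Longrightarrow> propP n Fs"
  shows "sym_ideal n V = Psi n d (type_sums d ` V)"
proof -
  let ?U = "type_sums d ` V"
  interpret t: Vector_Spaces.linear pscale pscale "type_sums d :: 'k mpol \<Rightarrow> _" by (rule linear_type_sums)
  have VR: "V \<subseteq> Rpoly n" using V(2) Rdeg_subset_Rpoly by blast
  have U: "?U \<subseteq> kvec d" by (rule image_subsetI) (rule type_sums_in_kvec)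
  have sU: "pvs.subspace ?U" by (rule t.subspace_image[OF V(1)])
  have iff: "f \<in> Psi n d ?U \<longleftrightarrow>
      f \<in> Rpoly n \<and> (\<forall>e\<in>Poly_Mapping.keys f. d \<le> mdeg e) \<and> type_sums d f \<in> ?U" for f
    by (rule Psi_iff[OF assms(4) U sU])
  have type0: "type_sums d f = 0" if "\<And>e. e \<in> Poly_Mapping.keys f \<Longrightarrow> mdeg e \<noteq> d" for f :: "'k mpol"
    unfolding type_sums_def lext_def using that by (intro sum.neutral) auto
  show ?thesis
  proof
    have "pvs.subspace (Psi n d ?U)"
    proof -
      have eq: "Psi n d ?U = Rpoly n \<inter> {f. Poly_Mapping.keys f \<subseteq> {e. d \<le> mdeg e}} \<inter> {f. type_sums d f \<in> ?U}"
        using iff by blast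
      show ?thesis
        unfolding eq by (intro pvs.subspace_inter subspace_Rpoly subspace_keys_subset t.subspace_linear_preimage sU)
    qed
    moreover have "xmon e * perm_act \<sigma> f \<in> Psi n d ?U"
      if e: "Poly_Mapping.keys e \<subseteq> {1..n}" and s: "\<sigma> permutes {1..n}" and f: "f \<in> V" for e \<sigma> f
      unfolding iff
    proof (intro conjI)
      have deg: "mdeg e' = mdeg e + d" if "e' \<in> Poly_Mapping.keys (xmon e * perm_act \<sigma> f)" for e'
        by (rule degree_sym_ideal_gen[OF subsetD[OF V(2) f] s that])
      then show "\<forall>e'\<in>Poly_Mapping.keys (xmon e * perm_act \<sigma> f). d \<le> mdeg e'" by simp
      show "xmon e * perm_act \<sigma> f \<in> Rpoly n"
        using f VR by (intro xmon_mult_Rpoly e perm_act_in_Rpoly s) blast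
      show "type_sums d (xmon e * perm_act \<sigma> f) \<in> ?U"
      proof (cases "e = 0")
        case True
        then show ?thesis using f by (simp add: type_sums_perm_act permutes_bij[OF s])
      next
        case False
        then have "mdeg e \<noteq> 0" by (simp add: mdeg_eq_0_iff)
        then have "type_sums d (xmon e * perm_act \<sigma> f) = 0" using deg by (intro type0) auto
        then show ?thesis using pvs.subspace_0[OF sU] by simp
      qed
    qed
    ultimately show "sym_ideal n V \<subseteq> Psi n d ?U"
      unfolding sym_ideal_eq_span[OF VR] by (intro pvs.span_minimal) blast
    have "xmon e \<in> sym_ideal n V" if "Poly_Mapping.keys e \<subseteq> {1..n}" "Suc d \<le> mdeg e" for e
    proof (cases "3 \<le> n")
      case True
      show ?thesis
        by (rule sym_ideal_higher[OF VR sym_ideal_degree_Suc[OF V null assms(4) True P] that])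
    next
      case False
      then have full: "?U = kvec d" using n by blast
      have "xmon e \<in> sym_ideal n V" if "e \<in> mons n d" for e
      proof -
        have "xmon e \<in> orbit_span n V"
          unfolding orbit_span_eq[OF V null] full using that by (simp add: xmon_in_Rdeg type_sums_in_kvec)
        then show ?thesis using orbit_span_subset_sym_ideal[OF VR] by blast
      qed
      then show ?thesis by (rule sym_ideal_higher[of V n d e, OF VR _ that(1)]) (use that(2) in simp_all)
    qed
    note high = this
    show "Psi n d ?U \<subseteq> sym_ideal n V"
    proof
      fix f assume "f \<in> Psi n d ?U"
      then have f: "f \<in> Rpoly n" "\<And>e. e \<in> Poly_Mapping.keys f \<Longrightarrow> d \<le> mdeg e" "type_sums d f \<in> ?U"
        unfolding iff by blast+
      \<comment> \<open>Removing the degree \<open>d\<close> component leaves only monomials of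
        degree above \<open>d\<close>, each of which lies in the ideal.\<close>
      let ?g = "f - hcomp d f"
      have lg: "Poly_Mapping.lookup ?g e = (if mdeg e = d then 0 else Poly_Mapping.lookup f e)" for e
        by (simp add: lookup_minus lookup_hcomp)
      have gk: "e \<in> Poly_Mapping.keys f \<and> mdeg e \<noteq> d" if "e \<in> Poly_Mapping.keys ?g" for e
        using that by (auto simp: in_keys_iff lg split: if_splits)
      have "?g \<in> sym_ideal n V"
      proof (subst poly_mapping_expand[of ?g], intro pvs.subspace_sum pvs.subspace_scale subspace_sym_ideal[OF VR])
        fix e assume "e \<in> Poly_Mapping.keys ?g"
        then have "e \<in> Poly_Mapping.keys f" "Suc d \<le> mdeg e" using gk f(2) by force+
        then show "Poly_Mapping.single e 1 \<in> sym_ideal n V"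
          using f(1) high[of e] unfolding xmon_def Rpoly_iff by blast
      qed
      moreover have "hcomp d f \<in> sym_ideal n V"
      proof -
        have "type_sums d ?g = 0" using gk by (intro type0) blast
        then have "type_sums d (hcomp d f) \<in> ?U" using f(3) by (simp add: t.diff)
        then have "hcomp d f \<in> orbit_span n V"
          unfolding orbit_span_eq[OF V null] using hcomp_in_Rdeg[OF f(1)] by blast
        then show ?thesis using orbit_span_subset_sym_ideal[OF VR] by blast
      qed
      ultimately have "?g + hcomp d f \<in> sym_ideal n V"
        by (rule pvs.subspace_add[OF subspace_sym_ideal[OF VR]])
      then show "f \<in> sym_ideal n V" by simp
    qed
  qed
qed

subsection \<open>Generating the monomial differences\<close>

text \<open>For \<open>f\<close> in the kernel, \<open>f = f - hpoly d (type_sums d f)\<close>. By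
  linearity the right side is a combination of differences between a monomial and the standard
  monomial of its type.\<close>

lemma type_null_subsetI:
  fixes J :: "'k::field mpol set"
  assumes J: "pvs.subspace J" and "d \<le> n"
    and diff: "\<And>M M'. M \<in> mons n d \<Longrightarrow> M' \<in> mons n d \<Longrightarrow> mon_type M = mon_type M' \<Longrightarrow> xmon M - xmon M' \<in> J"
  shows "type_null n d \<subseteq> J"
proof
  fix f :: "'k mpol" assume f: "f \<in> type_null n d"
  let ?h = "\<lambda>f :: 'k mpol. f - hpoly d (type_sums d f)"
  have "Vector_Spaces.linear pscale pscale (\<lambda>f :: 'k mpol. hpoly d (type_sums d f))"
    by (rule linear_compose[OF linear_type_sums linear_hpoly])
  then interpret h: Vector_Spaces.linear pscale pscale "\<lambda>f :: 'k mpol. hpoly d (type_sums d f)" .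
  have lin: "Vector_Spaces.linear pscale pscale ?h"
    by (rule pvs_linearI) (simp_all add: h.add h.scale pvs.scale_right_diff_distrib)
  have "f = ?h f" using f by (simp add: type_null_def hpoly_def)
  also have "\<dots> = lext (\<lambda>e. ?h (xmon e)) f"
    unfolding xmon_def by (rule fun_cong[OF linear_eq_lext[OF lin]])
  also have "\<dots> \<in> J"
    unfolding lext_def
  proof (intro pvs.subspace_sum[OF J] pvs.subspace_scale[OF J])
    fix e assume "e \<in> Poly_Mapping.keys f"
    then have e: "e \<in> mons n d" using f by (auto simp: type_null_def Rdeg_iff)
    then have p: "mon_type e \<in> Par d" by (simp add: mon_type_in_Par mons_def)
    have "xmon e - xmon (part_mon (mon_type e)) \<in> J"
      by (rule diff[OF e part_mon_in_mons[OF p assms(2)]]) (simp add: mon_type_part_mon[OF p])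
    then show "?h (xmon e) \<in> J" using e by (simp add: type_sums_xmon mons_def hpoly_single[OF p])
  qed
  finally show "f \<in> J" .
qed

text \<open>A permutation joining the two monomials is a product of transpositions, and the
  differences along this product telescope.\<close>

lemma same_type_diff_mem:
  fixes J :: "'k::field mpol set"
  assumes J: "pvs.subspace J"
    and swap: "\<And>M a b. M \<in> mons n d \<Longrightarrow> mon_type M = p \<Longrightarrow> a \<in> {1..n} \<Longrightarrow> b \<in> {1..n} \<Longrightarrow> a \<noteq> b \<Longrightarrow>
      xmon M - xmon (perm_mon (transpose a b) M) \<in> J"
    and M: "M \<in> mons n d" "M' \<in> mons n d" "mon_type M = p" "mon_type M' = p"
  shows "xmon M - xmon M' \<in> J"
proof -
  obtain \<sigma> where s: "\<sigma> permutes {1..n}" "perm_mon \<sigma> M = M'"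
    by (rule mon_type_eq_imp_perm[of "{1..n}" M M']) (use M in \<open>auto simp: mons_def\<close>)
  have "xmon M - xmon (perm_mon \<sigma> M) \<in> J"
    using s(1) finite_atLeastAtMost
  proof (induction rule: permutes_induct)
    case id
    show ?case using pvs.subspace_0[OF J] by (simp only: perm_mon_id diff_self)
  next
    case (swap a b \<sigma>)
    have b: "bij \<sigma>" by (rule permutes_bij[OF swap.hyps(4)])
    have "xmon (perm_mon \<sigma> M) - xmon (perm_mon (transpose a b) (perm_mon \<sigma> M)) \<in> J"
      using swap.hyps M b by (intro assms(2)) (simp_all add: perm_mon_in_mons mon_type_perm_mon)
    from pvs.subspace_add[OF J swap.IH this] show ?case
      using b by (simp add: perm_mon_comp comp_def)
  qed
  then show ?thesis using s(2) by simp
qed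

lemma mon_remove:
  fixes M :: mon
  assumes "a \<in> Poly_Mapping.keys M"
  obtains g v where "M = g + Poly_Mapping.single a v" "v \<noteq> 0" "Poly_Mapping.keys g = Poly_Mapping.keys M - {a}"
    "mon_type M = add_mset v (mon_type g)"
proof -
  define v where "v = Poly_Mapping.lookup M a"
  define g where "g = M - Poly_Mapping.single a v"
  have M: "M = g + Poly_Mapping.single a v"
    by (rule poly_mapping_eqI) (simp add: g_def v_def lookup_add lookup_minus lookup_single when_def)
  have v: "v \<noteq> 0" using assms by (simp add: v_def in_keys_iff)
  have k: "Poly_Mapping.keys g = Poly_Mapping.keys M - {a}"
    by (auto simp: g_def v_def in_keys_iff lookup_minus lookup_single when_def split: if_splits)
  then have "mon_type M = add_mset v (mon_type g)"
    using v by (subst M, subst mon_type_add_disjoint) (auto simp: mon_type_single)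
  with M v k that show ?thesis by blast
qed

lemma perm_mon_swap_add_single:
  assumes "a \<notin> Poly_Mapping.keys g" "b \<notin> Poly_Mapping.keys g"
  shows "perm_mon (transpose a b) (g + Poly_Mapping.single a v) = g + Poly_Mapping.single b v"
proof -
  have "perm_mon (transpose a b) g = g"
    using assms by (intro perm_mon_fixed) (auto simp: transpose_def)
  then show ?thesis by (simp add: perm_mon_add)
qed

text \<open>
  If both swapped variables occur in \<open>M\<close>, one moves an exponent to a free variable \<open>x\<^sub>l\<close> first.
\<close>

lemma swap_diff_mem:
  fixes J :: "'k::field mpol set"
  assumes J: "pvs.subspace J"
    and move: "\<And>g i j v. Poly_Mapping.keys g \<subseteq> {1..m} \<Longrightarrow> i \<in> {1..m} \<Longrightarrow> j \<in> {1..m} \<Longrightarrow> i \<noteq> j \<Longrightarrow>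
      i \<notin> Poly_Mapping.keys g \<Longrightarrow> j \<notin> Poly_Mapping.keys g \<Longrightarrow> add_mset v (mon_type g) = p \<Longrightarrow>
      xmon (g + Poly_Mapping.single i v) - xmon (g + Poly_Mapping.single j v) \<in> J"
    and "size p < m" and M: "Poly_Mapping.keys M \<subseteq> {1..m}" "mon_type M = p"
    and ab: "a \<in> {1..m}" "b \<in> {1..m}" "a \<noteq> b"
  shows "xmon M - xmon (perm_mon (transpose a b) M) \<in> J"
proof -
  \<comment> \<open>When exactly one of the two variables occurs, the transposition is a single move
    of an exponent.\<close>
  have one: "xmon M - xmon (perm_mon (transpose a b) M) \<in> J"
    if ab: "a \<in> Poly_Mapping.keys M" "b \<notin> Poly_Mapping.keys M" "a \<in> {1..m}" "b \<in> {1..m}" "a \<noteq> b" for a b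
  proof -
    obtain g v where g: "M = g + Poly_Mapping.single a v" "Poly_Mapping.keys g = Poly_Mapping.keys M - {a}"
      "mon_type M = add_mset v (mon_type g)"
      by (rule mon_remove[OF ab(1)])
    have n: "a \<notin> Poly_Mapping.keys g" "b \<notin> Poly_Mapping.keys g" "Poly_Mapping.keys g \<subseteq> {1..m}"
      using g(2) ab M(1) by auto
    have "perm_mon (transpose a b) M = g + Poly_Mapping.single b v"
      unfolding g(1) by (rule perm_mon_swap_add_single[OF n(1,2)])
    then show ?thesis
      using move[OF n(3) ab(3,4,5) n(1,2)] g(1,3) M(2) by simp
  qed
  consider "a \<in> Poly_Mapping.keys M" "b \<notin> Poly_Mapping.keys M"
    | "b \<in> Poly_Mapping.keys M" "a \<notin> Poly_Mapping.keys M"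
    | "a \<notin> Poly_Mapping.keys M" "b \<notin> Poly_Mapping.keys M"
    | "a \<in> Poly_Mapping.keys M" "b \<in> Poly_Mapping.keys M" by blast
  then show ?thesis
  proof cases
    case 1
    then show ?thesis using one ab by blast
  next
    case 2
    then show ?thesis using one[of b a] ab by (simp add: transpose_commute)
  next
    case 3
    then have "perm_mon (transpose a b) M = M" by (intro perm_mon_fixed) (auto simp: transpose_def)
    then show ?thesis using pvs.subspace_0[OF J] by simp
  next
    case 4
    obtain h u where h: "M = h + Poly_Mapping.single a u" "u \<noteq> 0" "Poly_Mapping.keys h = Poly_Mapping.keys M - {a}"
      "mon_type M = add_mset u (mon_type h)"
      by (rule mon_remove[OF 4(1)])
    have bh: "b \<in> Poly_Mapping.keys h" using h(3) 4(2) ab(3) by auto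
    obtain g v where g: "h = g + Poly_Mapping.single b v" "v \<noteq> 0" "Poly_Mapping.keys g = Poly_Mapping.keys h - {b}"
      "mon_type h = add_mset v (mon_type g)"
      by (rule mon_remove[OF bh])
    have "card (Poly_Mapping.keys M) < card {1..m}" using M(2) assms(3) by (simp flip: size_mon_type)
    then obtain l where l: "l \<in> {1..m}" "l \<notin> Poly_Mapping.keys M"
      by (metis card_mono finite_keys leD subsetI)
    have gk: "Poly_Mapping.keys g \<subseteq> {1..m}" "a \<notin> Poly_Mapping.keys g" "b \<notin> Poly_Mapping.keys g" "l \<notin> Poly_Mapping.keys g"
      "l \<noteq> a" "l \<noteq> b"
      using g(3) h(3) M(1) l(2) 4 by auto
    have t: "add_mset u (add_mset v (mon_type g)) = p" using M(2) h(4) g(4) by simp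
    let ?s = "Poly_Mapping.single :: nat \<Rightarrow> nat \<Rightarrow> mon"
    have type: "mon_type (g + ?s i w) = add_mset w (mon_type g)" if "i \<notin> Poly_Mapping.keys g" "w \<noteq> 0" for i w
      using that by (subst mon_type_add_disjoint) (auto simp: mon_type_single)
    have k: "Poly_Mapping.keys (g + ?s i w) = insert i (Poly_Mapping.keys g)" if "w \<noteq> 0" for i w
      using that by (simp add: keys_add_mon)
    \<comment> \<open>Three moves realise the swap: \<open>u\<close> goes from \<open>a\<close> to
      \<open>l\<close>, then \<open>v\<close> from \<open>b\<close> to \<open>a\<close>, then
      \<open>u\<close> from \<open>l\<close> to \<open>b\<close>. The three differences
      telescope.\<close>
    have 1: "xmon (g + ?s b v + ?s a u) - xmon (g + ?s b v + ?s l u) \<in> J"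
      using gk ab l(1) t g(2) by (intro move) (auto simp: k type simp del: One_nat_def)
    have 2: "xmon (g + ?s l u + ?s b v) - xmon (g + ?s l u + ?s a v) \<in> J"
      using gk ab l(1) t h(2) by (intro move) (auto simp: k type add_mset_commute simp del: One_nat_def)
    have 3: "xmon (g + ?s a v + ?s l u) - xmon (g + ?s a v + ?s b u) \<in> J"
      using gk ab l(1) t g(2) by (intro move) (auto simp: k type simp del: One_nat_def)
    have "perm_mon (transpose a b) g = g"
      using gk by (intro perm_mon_fixed) (auto simp: transpose_def)
    then have "perm_mon (transpose a b) M = g + ?s a v + ?s b u"
      unfolding h(1) g(1) by (simp add: perm_mon_add)
    moreover have "M = g + ?s b v + ?s a u" unfolding h(1) g(1) ..
    ultimately show ?thesis
      using pvs.subspace_add[OF J pvs.subspace_add[OF J 1 2] 3]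
      by (simp add: add_ac)
  qed
qed

text \<open>
  The permutation taking one configuration to the other is found by giving the two marked variables
  exponents that are larger than all the others.
\<close>

lemma move_transfer:
  fixes J :: "'k::field mpol set"
  assumes perm: "\<And>\<sigma> f. \<sigma> permutes {1..m} \<Longrightarrow> f \<in> J \<Longrightarrow> perm_act \<sigma> f \<in> J"
    and g0: "Poly_Mapping.keys g0 \<subseteq> {1..m}" "i0 \<in> {1..m}" "j0 \<in> {1..m}" "i0 \<noteq> j0"
      "i0 \<notin> Poly_Mapping.keys g0" "j0 \<notin> Poly_Mapping.keys g0"
    and g: "Poly_Mapping.keys g \<subseteq> {1..m}" "i \<in> {1..m}" "j \<in> {1..m}" "i \<noteq> j"
      "i \<notin> Poly_Mapping.keys g" "j \<notin> Poly_Mapping.keys g"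
    and t: "mon_type g = mon_type g0"
    and J: "xmon (g0 + Poly_Mapping.single i0 v) - xmon (g0 + Poly_Mapping.single j0 v) \<in> J"
  shows "xmon (g + Poly_Mapping.single i v) - xmon (g + Poly_Mapping.single j v) \<in> J"
proof -
  define N where "N = Suc (mdeg g)"
  let ?s = "Poly_Mapping.single :: nat \<Rightarrow> nat \<Rightarrow> mon"
  let ?e = "\<lambda>g i j. g + (?s i N + ?s j (Suc N))"
  have type: "mon_type (?e g i j) = mon_type g + {#N, Suc N#}"
    if "i \<noteq> j" "i \<notin> Poly_Mapping.keys g" "j \<notin> Poly_Mapping.keys g" for g i j
    using that by (subst mon_type_add_disjoint, simp add: keys_add_mon N_def)
      (subst mon_type_add_disjoint, auto simp: N_def mon_type_single)
  obtain \<sigma> where s: "\<sigma> permutes {1..m}" "perm_mon \<sigma> (?e g0 i0 j0) = ?e g i j"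
  proof (rule mon_type_eq_imp_perm)
    show "finite {1..m}" by simp
    show "Poly_Mapping.keys (?e g0 i0 j0) \<subseteq> {1..m}" "Poly_Mapping.keys (?e g i j) \<subseteq> {1..m}"
      using g0 g by (simp_all add: keys_add_mon N_def)
    show "mon_type (?e g0 i0 j0) = mon_type (?e g i j)"
      using g0 g t by (simp add: type)
  qed
  have b: "bij \<sigma>" by (rule permutes_bij[OF s(1)])
  have lk: "Poly_Mapping.lookup (?e g i j) (\<sigma> x) = Poly_Mapping.lookup (?e g0 i0 j0) x" for x
    using lookup_perm_mon[OF b, of "?e g0 i0 j0" x] s(2) by simp
  have small: "Poly_Mapping.lookup g x < N" for x
    using lookup_le_mdeg[of g x] by (simp add: N_def)
  have 0: "Poly_Mapping.lookup g i = 0" "Poly_Mapping.lookup g j = 0"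
    "Poly_Mapping.lookup g0 i0 = 0" "Poly_Mapping.lookup g0 j0 = 0"
    using g0 g by (simp_all add: in_keys_iff)
  have si: "\<sigma> i0 = i"
    using lk[of i0] small[of "\<sigma> i0"] g0(4) 0
    by (auto simp: lookup_add lookup_single when_def split: if_splits)
  have sj: "\<sigma> j0 = j"
    using lk[of j0] small[of "\<sigma> j0"] g0(4) 0
    by (auto simp: lookup_add lookup_single when_def split: if_splits)
  have "perm_mon \<sigma> g0 = g"
    using s(2) by (simp add: perm_mon_add[OF b] si sj)
  then have "perm_act \<sigma> (xmon (g0 + ?s i0 v) - xmon (g0 + ?s j0 v)) = (xmon (g + ?s i v) - xmon (g + ?s j v) :: 'k mpol)"
    by (simp add: module_hom.diff[OF linear_perm_act[THEN Vector_Spaces.linear.axioms(3)]]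
        perm_mon_add[OF b] si sj)
  then show ?thesis using perm[OF s(1) J] by simp
qed

subsection \<open>The binomial construction\<close>

lemma lookup_mon_gcd:
  "Poly_Mapping.lookup (mon_gcd a b) i = min (Poly_Mapping.lookup a i) (Poly_Mapping.lookup b i)"
  by (simp add: mon_gcd_def lookup_sum lookup_single when_def in_keys_iff)

text \<open>Relative primality makes the supports of \<open>g\<close> and \<open>M - g\<close>
  disjoint, so types add. The cofactor then has type \<open>{#v#}\<close>, that is, it is a power of
  one variable.\<close>

lemma coprime_cofactor:
  fixes g M :: mon
  assumes le: "\<And>i. Poly_Mapping.lookup g i \<le> Poly_Mapping.lookup M i"
    and gcd: "mon_gcd g (M - g) = 0" and t: "mon_type M = add_mset v (mon_type g)"
  obtains i where "i \<notin> Poly_Mapping.keys g" "M = g + Poly_Mapping.single i v"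
proof -
  define N where "N = M - g"
  have M: "M = g + N"
    by (rule poly_mapping_eqI) (use le in \<open>simp add: N_def lookup_add lookup_minus\<close>)
  have disj: "Poly_Mapping.keys g \<inter> Poly_Mapping.keys N = {}"
  proof -
    have "min (Poly_Mapping.lookup g i) (Poly_Mapping.lookup N i) = 0" for i
      using gcd by (simp flip: lookup_mon_gcd N_def)
    then show ?thesis by (auto simp: in_keys_iff min_def split: if_splits) (metis less_numeral_extra(3))+
  qed
  have tN: "mon_type N = {#v#}" using t mon_type_add_disjoint[OF disj] by (simp flip: M)
  then have "card (Poly_Mapping.keys N) = 1" by (simp flip: size_mon_type)
  then obtain i where i: "Poly_Mapping.keys N = {i}" by (auto simp: card_1_singleton_iff)
  then have "Poly_Mapping.lookup N i = v" using tN by (simp add: mon_type_def)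
  then have "N = Poly_Mapping.single i v"
    using i by (intro poly_mapping_eqI) (auto simp: lookup_single when_def in_keys_iff set_eq_iff)
  then show ?thesis using that[of i] M disj i by auto
qed

text \<open>When the gcd lacks a single part \<open>v\<close>, the binomial has the shape
  \<open>g * (x_i^v - x_j^v)\<close>, which is exactly the move used for generating
  transpositions.\<close>

lemma admissible_binomialE:
  assumes b: "admissible_binomial m p (p - {#v#}) b" and p: "p \<in> Par d" "v \<in># p" and "d \<le> m"
  obtains g i j where "b = xmon (g + Poly_Mapping.single i v) - xmon (g + Poly_Mapping.single j v)"
    "Poly_Mapping.keys g \<subseteq> {1..m}" "i \<in> {1..m}" "j \<in> {1..m}" "i \<noteq> j"
    "i \<notin> Poly_Mapping.keys g" "j \<notin> Poly_Mapping.keys g" "add_mset v (mon_type g) = p"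
proof -
  obtain M M' where M: "b = xmon M - xmon M'" "M \<noteq> M'" "has_type m p M" "has_type m p M'"
    and g: "mon_gcd (mon_gcd M M') (M - mon_gcd M M') = 0" "mon_gcd (mon_gcd M M') (M' - mon_gcd M M') = 0"
      "has_type m (p - {#v#}) (mon_gcd M M')"
    using b unfolding admissible_binomial_def Let_def by blast
  let ?g = "mon_gcd M M'"
  have p0: "0 \<notin># p" "size p \<le> m" using p size_le_of_Par[OF p(1)] assms(4) by (auto simp: Par_def)
  have v0: "v \<noteq> 0" using p0(1) p(2) by metis
  have q0: "0 \<notin># p - {#v#}" "size (p - {#v#}) \<le> m"
    using p(2) p0 by (auto dest: in_diffD simp: size_Diff_singleton)
  note tM = has_type_imp[OF M(3) p0(1,2)] and tM' = has_type_imp[OF M(4) p0(1,2)] and tg = has_type_imp[OF g(3) q0]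
  have t: "add_mset v (mon_type ?g) = p" using tg(2) p(2) by simp
  obtain i where i: "i \<notin> Poly_Mapping.keys ?g" "M = ?g + Poly_Mapping.single i v"
    by (rule coprime_cofactor[OF _ g(1)]) (use t tM in \<open>auto simp: lookup_mon_gcd\<close>)
  obtain j where j: "j \<notin> Poly_Mapping.keys ?g" "M' = ?g + Poly_Mapping.single j v"
    by (rule coprime_cofactor[OF _ g(2)]) (use t tM' in \<open>auto simp: lookup_mon_gcd\<close>)
  have "i \<in> Poly_Mapping.keys M" by (subst i(2)) (simp add: keys_add_mon v0)
  then have im: "i \<in> {1..m}" using tM(1) by blast
  have "j \<in> Poly_Mapping.keys M'" by (subst j(2)) (simp add: keys_add_mon v0)
  then have jm: "j \<in> {1..m}" using tM'(1) by blast
  have "i \<noteq> j" using i j M(2) by auto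
  moreover have "b = xmon (?g + Poly_Mapping.single i v) - xmon (?g + Poly_Mapping.single j v)"
    using M(1) i(2) j(2) by simp
  ultimately show ?thesis
    using that[OF _ tg(1) im jm _ i(1) j(1) t] by blast
qed

text \<open>The argument isolates each binomial, then obtains all differences of types other than
  \<open>t\<close>, then recovers \<open>hpoly d a\<close>. Modulo the differences already found, a
  permutation changes this polynomial only in its term of type \<open>t\<close>, whose coefficient
  is nonzero.\<close>

lemma binomial_type_null:
  fixes J :: "'k::field_char_0 mpol set"
  assumes J: "pvs.subspace J" and perm: "\<And>\<sigma> f. \<sigma> permutes {1..m} \<Longrightarrow> f \<in> J \<Longrightarrow> perm_act \<sigma> f \<in> J"
    and "d \<le> m" "d > 0" and a: "a \<in> kvec d" "t \<in> Poly_Mapping.keys a"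
    and adm: "\<And>p v. p \<in> Par d - {t} \<Longrightarrow> v \<in># p \<Longrightarrow> admissible_binomial m p (p - {#v#}) (b p v)"
    and disj_h: "\<And>p v. p \<in> Par d - {t} \<Longrightarrow> v \<in># p \<Longrightarrow> vars (b p v) \<inter> vars (hpoly d a) = {}"
    and disj: "\<And>p v p' v'. p \<in> Par d - {t} \<Longrightarrow> v \<in># p \<Longrightarrow> p' \<in> Par d - {t} \<Longrightarrow> v' \<in># p' \<Longrightarrow>
      (p, v) \<noteq> (p', v') \<Longrightarrow> vars (b p v) \<inter> vars (b p' v') = {}"
    and f: "hpoly d a + (\<Sum>p\<in>Par d - {t}. \<Sum>v\<in>set_mset p. b p v) \<in> J"
  shows "type_null m d \<subseteq> J"
proof -
  let ?X = "Sigma (Par d - {t}) set_mset"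
  let ?\<beta> = "\<lambda>x. b (fst x) (snd x)"
  let ?f = "hpoly d a + (\<Sum>x\<in>?X. ?\<beta> x)"
  have X: "finite ?X" using finite_Par by auto
  have fJ: "?f \<in> J" using f finite_Par by (simp add: sum.Sigma case_prod_beta)
  have binom: "b p v \<in> J" if p: "p \<in> Par d - {t}" "v \<in># p" for p v
  proof -
    obtain g i j where g: "b p v = xmon (g + Poly_Mapping.single i v) - xmon (g + Poly_Mapping.single j v)"
      "i \<in> {1..m}" "j \<in> {1..m}" "i \<noteq> j" "i \<notin> Poly_Mapping.keys g" "j \<notin> Poly_Mapping.keys g"
      using admissible_binomialE[OF adm[OF p] _ p(2) assms(3)] p(1) by blast
    \<comment> \<open>This transposition exchanges the two monomials of the binomial; disjointness
      of variables makes it fix all other summands of \<open>?f\<close>.\<close>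
    let ?\<sigma> = "transpose i j"
    interpret s: Vector_Spaces.linear pscale pscale "perm_act ?\<sigma> :: 'k mpol \<Rightarrow> _" by (rule linear_perm_act)
    have s: "?\<sigma> permutes {1..m}" using g by (intro permutes_swap_id)
    have "0 \<notin># p" using p(1) by (simp add: Par_def)
    then have v0: "v \<noteq> 0" using p(2) by metis
    let ?M = "g + Poly_Mapping.single i v" and ?M' = "g + Poly_Mapping.single j v"
    have MM: "?M \<noteq> ?M'" using g(4) v0 by (auto dest!: arg_cong[where f = "\<lambda>e. Poly_Mapping.lookup e i"] simp: lookup_single)
    have "Poly_Mapping.lookup (b p v) ?M = 1" "Poly_Mapping.lookup (b p v) ?M' = -1"
      unfolding g(1) xmon_def using MM by (simp_all add: lookup_minus lookup_single when_def)
    then have keys: "?M \<in> Poly_Mapping.keys (b p v)" "?M' \<in> Poly_Mapping.keys (b p v)"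
      by (simp_all add: in_keys_iff)
    have "i \<in> Poly_Mapping.keys ?M" "j \<in> Poly_Mapping.keys ?M'" using v0 by (simp_all add: keys_add_mon)
    with keys have ij: "i \<in> vars (b p v)" "j \<in> vars (b p v)" unfolding vars_def by blast+
    have fixed: "perm_act ?\<sigma> h = h" if "vars (b p v) \<inter> vars h = {}" for h :: "'k mpol"
      using that ij by (intro perm_act_fixed) (auto simp: transpose_def)
    have "perm_act ?\<sigma> (b p v) = - b p v"
      unfolding g(1) s.diff using g(5,6) perm_mon_swap_add_single[OF g(5,6)] perm_mon_swap_add_single[OF g(6,5)]
      by (simp add: transpose_commute)
    moreover have "perm_act ?\<sigma> (\<Sum>x\<in>?X - {(p,v)}. ?\<beta> x) = (\<Sum>x\<in>?X - {(p,v)}. ?\<beta> x)"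
      unfolding s.sum
    proof (rule sum.cong[OF refl])
      fix x assume x: "x \<in> ?X - {(p, v)}"
      show "perm_act ?\<sigma> (?\<beta> x) = ?\<beta> x"
        by (rule fixed, rule disj[OF p]) (use x in auto)
    qed
    moreover have "perm_act ?\<sigma> (hpoly d a) = hpoly d a" by (rule fixed[OF disj_h[OF p]])
    moreover have "?f = hpoly d a + (b p v + (\<Sum>x\<in>?X - {(p,v)}. ?\<beta> x))"
      using sum.remove[OF X, of "(p,v)" ?\<beta>] p by simp
    ultimately have "?f - perm_act ?\<sigma> ?f = b p v + b p v" by (simp add: s.add)
    \<comment> \<open>Only the sign of one binomial has changed, so twice that binomial remains, and
      2 is invertible.\<close>
    also have "\<dots> = pscale 2 (b p v)"
      by (rule poly_mapping_eqI) (simp only: lookup_add lookup_pscale mult_2)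
    finally have "?f - perm_act ?\<sigma> ?f = pscale 2 (b p v)" .
    moreover have "?f - perm_act ?\<sigma> ?f \<in> J" by (intro pvs.subspace_diff[OF J] perm s fJ)
    ultimately have "pscale (1/2) (pscale 2 (b p v)) \<in> J" by (simp only: pvs.subspace_scale[OF J])
    then show ?thesis by simp
  qed
  have other: "xmon M - xmon M' \<in> J"
    if p: "p \<in> Par d - {t}" and M: "M \<in> mons m d" "M' \<in> mons m d" "mon_type M = p" "mon_type M' = p" for p M M'
  proof (rule same_type_diff_mem[OF J _ M])
    have p0: "p \<noteq> {#}" using p assms(4) by (auto simp: Par_def)
    show "xmon L - xmon (perm_mon (transpose x y) L) \<in> J"
      if L: "L \<in> mons m d" "mon_type L = p" and xy: "x \<in> {1..m}" "y \<in> {1..m}" "x \<noteq> y" for L x y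
    proof (rule swap_diff_mem[OF J _ _ _ L(2) xy])
      show "Poly_Mapping.keys L \<subseteq> {1..m}" using L(1) by (simp add: mons_def)
      obtain v where v: "v \<in># p" using p0 by blast
      obtain g i j where g: "Poly_Mapping.keys g \<subseteq> {1..m}" "i \<in> {1..m}" "j \<in> {1..m}" "i \<noteq> j"
        "i \<notin> Poly_Mapping.keys g" "j \<notin> Poly_Mapping.keys g" "add_mset v (mon_type g) = p"
        using admissible_binomialE[OF adm[OF p v] _ v assms(3)] p by blast
      \<comment> \<open>A binomial of type \<open>p\<close> already involves one variable more than
        a monomial of that type. This yields the free variable demanded by
        \<open>swap_diff_mem\<close>.\<close>
      have "card (insert i (insert j (Poly_Mapping.keys g))) \<le> card {1..m}"
        using g by (intro card_mono) auto
      then have "Suc (Suc (size (mon_type g))) \<le> m" using g by (simp add: size_mon_type)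
      moreover have "size p = Suc (size (mon_type g))" by (subst g(7)[symmetric]) simp
      ultimately show "size p < m" by simp
    next
      fix g i j v
      assume g: "Poly_Mapping.keys g \<subseteq> {1..m}" "i \<in> {1..m}" "j \<in> {1..m}" "i \<noteq> j"
        "i \<notin> Poly_Mapping.keys g" "j \<notin> Poly_Mapping.keys g" and t: "add_mset v (mon_type g) = p"
      have v: "v \<in># p" using t by auto
      obtain g0 i0 j0 where b: "b p v = xmon (g0 + Poly_Mapping.single i0 v) - xmon (g0 + Poly_Mapping.single j0 v)"
        and g0: "Poly_Mapping.keys g0 \<subseteq> {1..m}" "i0 \<in> {1..m}" "j0 \<in> {1..m}" "i0 \<noteq> j0"
        "i0 \<notin> Poly_Mapping.keys g0" "j0 \<notin> Poly_Mapping.keys g0" and t0: "add_mset v (mon_type g0) = p"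
        using admissible_binomialE[OF adm[OF p v] _ v assms(3)] p by blast
      have tt: "mon_type g = mon_type g0" using t t0 by (metis add_mset_add_mset_same_iff)
      show "xmon (g + Poly_Mapping.single i v) - xmon (g + Poly_Mapping.single j v) \<in> J"
        by (rule move_transfer[OF perm g0 g tt]) (use binom[OF p v] b in auto)
    qed
  qed
  have hJ: "hpoly d a \<in> J"
  proof -
    have "(\<Sum>x\<in>?X. ?\<beta> x) \<in> J" by (intro pvs.subspace_sum[OF J]) (auto intro: binom)
    from pvs.subspace_diff[OF J fJ this] show ?thesis by simp
  qed
  have tP: "t \<in> Par d" using a by (auto simp: kvec_def)
  let ?m = part_mon
  have base: "xmon (?m t) - xmon (perm_mon \<sigma> (?m t)) \<in> J" if s: "\<sigma> permutes {1..m}" for \<sigma>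
  proof -
    interpret s: Vector_Spaces.linear pscale pscale "perm_act \<sigma> :: 'k mpol \<Rightarrow> _" by (rule linear_perm_act)
    let ?D = "\<lambda>p. pscale (Poly_Mapping.lookup a p) (xmon (?m p) - xmon (perm_mon \<sigma> (?m p)))"
    have "hpoly d a - perm_act \<sigma> (hpoly d a) = (\<Sum>p\<in>Par d. ?D p)"
      unfolding hpoly_def s.sum s.scale by (simp add: sum_subtractf pvs.scale_right_diff_distrib)
    also have "\<dots> = ?D t + (\<Sum>p\<in>Par d - {t}. ?D p)" by (rule sum.remove[OF finite_Par tP])
    \<comment> \<open>The terms of the other types have been settled, so the term of type
      \<open>t\<close> can be solved for and divided by its coefficient.\<close>
    finally have "?D t = (hpoly d a - perm_act \<sigma> (hpoly d a)) - (\<Sum>p\<in>Par d - {t}. ?D p)" by simp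
    also have "\<dots> \<in> J"
    proof (rule pvs.subspace_diff[OF J pvs.subspace_diff[OF J hJ perm[OF s hJ]]],
        intro pvs.subspace_sum[OF J] pvs.subspace_scale[OF J])
      fix p assume p: "p \<in> Par d - {t}"
      then have "?m p \<in> mons m d" "mon_type (?m p) = p"
        by (auto intro: part_mon_in_mons[OF _ assms(3)] mon_type_part_mon)
      then show "xmon (?m p) - xmon (perm_mon \<sigma> (?m p)) \<in> J"
        using s by (intro other[OF p]) (simp_all add: perm_mon_in_mons mon_type_perm_mon permutes_bij)
    qed
    finally have "pscale (1 / Poly_Mapping.lookup a t) (?D t) \<in> J" by (rule pvs.subspace_scale[OF J])
    then show ?thesis using a(2) by (simp add: in_keys_iff)
  qed
  show ?thesis
  proof (rule type_null_subsetI[OF J assms(3)])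
    fix M M' assume M: "M \<in> mons m d" "M' \<in> mons m d" "mon_type M = mon_type M'"
    show "xmon M - xmon M' \<in> J"
    proof (cases "mon_type M = t")
      case False
      moreover have "mon_type M \<in> Par d" using M(1) by (simp add: mon_type_in_Par mons_def)
      ultimately show ?thesis using M by (intro other[of "mon_type M"]) auto
    next
      case True
      have tm: "?m t \<in> mons m d" by (rule part_mon_in_mons[OF tP assms(3)])
      have "xmon (?m t) - xmon L \<in> J" if L: "L \<in> mons m d" "mon_type L = t" for L
      proof -
        obtain \<sigma> where "\<sigma> permutes {1..m}" "perm_mon \<sigma> (?m t) = L"
          by (rule mon_type_eq_imp_perm[of "{1..m}" "?m t" L])
            (use L tm mon_type_part_mon[OF tP] in \<open>auto simp: mons_def\<close>)
        then show ?thesis using base by blast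
      qed
      from pvs.subspace_diff[OF J this[of M'] this[of M]] show ?thesis using M True by simp
    qed
  qed
qed

subsection \<open>Lifting points of the Grassmannian and adding variables\<close>

lemma finite_has_least:
  assumes "linear_order_on A r" "finite F" "F \<noteq> {}" "F \<subseteq> A"
  shows "\<exists>t\<in>F. \<forall>p\<in>F. (t, p) \<in> r"
  using assms(2-4)
proof (induction rule: finite_ne_induct)
  case (singleton x)
  then show ?case using assms(1) by (auto simp: order_on_defs refl_on_def)
next
  case (insert x F)
  then obtain t where t: "t \<in> F" "\<forall>p\<in>F. (t, p) \<in> r" by auto
  have o: "trans r" "refl_on A r" "total_on A r" using assms(1) by (auto simp: order_on_defs)
  have xx: "(x, x) \<in> r" using o(2) insert.prems by (auto simp: refl_on_def)
  show ?case
  proof (cases "(t, x) \<in> r")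
    case False
    moreover have "x \<noteq> t" using t insert.hyps by blast
    ultimately have "(x, t) \<in> r" using o(3) t(1) insert.prems unfolding total_on_def by blast
    then have "\<forall>p\<in>F. (x, p) \<in> r" using t(2) o(1) by (meson transD)
    then show ?thesis using xx by blast
  qed (use t in blast)
qed

text \<open>For \<open>\<tau> = (1,...,1)\<close> the polynomial \<open>h_\<alpha>\<close> can be
  \<open>x_1 ... x_d\<close>, whence \<open>d \<le> m\<close>. For \<open>\<tau> = (d)\<close> with
  \<open>d \<ge> 2\<close>, a binomial of type \<open>(1,...,1)\<close> whose gcd has
  \<open>d - 1\<close> variables occupies \<open>d + 1\<close> variables.\<close>

lemma large_enough_bounds:
  assumes ord: "linear_order_on (Par d) ord" and le: "large_enough TYPE('k::field) ord d m" and "d > 0"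
  shows "d \<le> m" "2 \<le> d \<Longrightarrow> d < m"
proof -
  have refl: "(t, t) \<in> ord" if "t \<in> Par d" for t
    using ord that by (auto simp: order_on_defs refl_on_def)
  have spec: "hpoly d (Poly_Mapping.single t (1 :: 'k)) \<in> Rpoly m \<and>
      (\<exists>b :: nat multiset \<Rightarrow> nat multiset \<Rightarrow> 'k mpol. \<forall>p\<in>Par d - {t}. \<forall>q. q \<subset># p \<longrightarrow> admissible_binomial m p q (b p q))"
    if "t \<in> Par d" for t
  proof -
    let ?a = "Poly_Mapping.single t (1 :: 'k)"
    have "?a \<in> kvec d" "?a \<noteq> 0" "t \<in> Poly_Mapping.keys ?a" "\<forall>p\<in>Poly_Mapping.keys ?a. (t, p) \<in> ord"
      using that refl by (auto simp: kvec_def dest: arg_cong[where f = Poly_Mapping.keys])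
    with le[unfolded large_enough_def, rule_format, of ?a t] show ?thesis by blast
  qed
  let ?p = "replicate_mset d (1 :: nat)"
  have p: "?p \<in> Par d" by (auto simp: Par_def)
  have "xmon (part_mon ?p) \<in> (Rpoly m :: 'k mpol set)" using spec[OF p] unfolding hpoly_single[OF p] by blast
  then have "{1..d} \<subseteq> {1..m}" using part_mon_facts(2)[of ?p] by (simp add: xmon_in_Rpoly)
  then show dm: "d \<le> m" using assms(3) by auto
  show "d < m" if d2: "2 \<le> d"
  proof -
    have t: "{#d#} \<in> Par d" using assms(3) by (simp add: Par_def)
    have "size ?p \<noteq> size {#d#}" using d2 by simp
    then have ne: "?p \<noteq> {#d#}" by metis
    have one: "1 \<in># ?p" using assms(3) by simp
    obtain b :: "nat multiset \<Rightarrow> nat multiset \<Rightarrow> 'k mpol"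
      where "\<forall>p\<in>Par d - {{#d#}}. \<forall>q. q \<subset># p \<longrightarrow> admissible_binomial m p q (b p q)"
      using spec[OF t] by blast
    moreover have "?p - {#1#} \<subset># ?p" using one by (simp add: mset_subset_diff_self)
    ultimately have adm: "admissible_binomial m ?p (?p - {#1#}) (b ?p (?p - {#1#}))" using p ne by blast
    obtain g i j where g: "Poly_Mapping.keys g \<subseteq> {1..m}" "i \<in> {1..m}" "j \<in> {1..m}" "i \<noteq> j"
      "i \<notin> Poly_Mapping.keys g" "j \<notin> Poly_Mapping.keys g" "add_mset 1 (mon_type g) = ?p"
      by (rule admissible_binomialE[OF adm p one dm])
    have "card (insert i (insert j (Poly_Mapping.keys g))) \<le> card {1..m}"
      using g by (intro card_mono) auto
    then have "Suc (Suc (size (mon_type g))) \<le> m" using g by (simp add: size_mon_type)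
    moreover have "d = Suc (size (mon_type g))" using arg_cong[OF g(7), of size] by simp
    ultimately show ?thesis by simp
  qed
qed

text \<open>A basis of \<open>U\<close> is lifted by \<open>hpoly\<close>, and the lift of one basis
  vector \<open>a\<close> is perturbed by binomials, which have zero type sums. The number of
  generators bounds the dimension of \<open>V\<close> by \<open>r\<close> from above, the image
  \<open>U\<close> from below.\<close>

lemma Grass_lift:
  fixes U :: "(nat multiset \<Rightarrow>\<^sub>0 'k::field_char_0) set"
  assumes "d > 0" "r > 0" and ord: "linear_order_on (Par d) ord" and le: "large_enough TYPE('k) ord d m"
    and U: "U \<in> Grass r (kvec d)"
  obtains V where "V \<in> Grass r (Rdeg m d)" "type_null m d \<subseteq> orbit_span m V" "type_sums d ` V = U"
proof -
  have dm: "d \<le> m" by (rule large_enough_bounds[OF ord le assms(1)])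
  interpret t: Vector_Spaces.linear pscale pscale "type_sums d :: 'k mpol \<Rightarrow> _" by (rule linear_type_sums)
  have Us: "pvs.subspace U" "U \<subseteq> kvec d" "pvs.dim U = r" using U by (auto simp: Grass_def)
  obtain K where K: "finite K" "(kvec d :: (nat multiset \<Rightarrow>\<^sub>0 'k) set) \<subseteq> pvs.span K" by (rule kvec_finite_span)
  obtain B where B: "B \<subseteq> U" "pvs.independent B" "U \<subseteq> pvs.span B" "finite B" "card B = pvs.dim U"
    by (rule pvs.finite_basis_of_subset[OF K(1) order_trans[OF Us(2) K(2)]])
  have "B \<noteq> {}" using B(5) Us(3) assms(2) by auto
  then obtain a where aB: "a \<in> B" by blast
  then have a: "a \<in> kvec d" "a \<noteq> 0" using B Us(2) pvs.dependent_zero by blast+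
  have "Poly_Mapping.keys a \<noteq> {}" "Poly_Mapping.keys a \<subseteq> Par d" using a by (auto simp: kvec_def)
  then obtain t where t: "t \<in> Poly_Mapping.keys a" "\<forall>p\<in>Poly_Mapping.keys a. (t, p) \<in> ord"
    using finite_has_least[OF ord finite_keys] by blast
  obtain b' :: "nat multiset \<Rightarrow> nat multiset \<Rightarrow> 'k mpol" where
    b1: "\<forall>p\<in>Par d - {t}. \<forall>q. q \<subset># p \<longrightarrow>
      admissible_binomial m p q (b' p q) \<and> vars (b' p q) \<inter> vars (hpoly d a) = {}" and
    b2: "\<forall>p\<in>Par d - {t}. \<forall>p'\<in>Par d - {t}. \<forall>q q'. q \<subset># p \<longrightarrow> q' \<subset># p' \<longrightarrow>
      (p, q) \<noteq> (p', q') \<longrightarrow> vars (b' p q) \<inter> vars (b' p' q') = {}"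
    using le[unfolded large_enough_def, rule_format, OF a t(1)] t(2) by blast
  \<comment> \<open>The binomials selected are those whose gcd type arises by deleting a single
    part.\<close>
  define b where "b p v = b' p (p - {#v#})" for p v
  have sub: "p - {#v#} \<subset># p" if "v \<in># p" for p :: "nat multiset" and v
    using that by (simp add: mset_subset_diff_self)
  have adm: "admissible_binomial m p (p - {#v#}) (b p v)" if "p \<in> Par d - {t}" "v \<in># p" for p v
    unfolding b_def using b1 that sub by blast
  let ?f = "hpoly d a + (\<Sum>p\<in>Par d - {t}. \<Sum>v\<in>set_mset p. b p v)"
  have b_facts: "b p v \<in> Rdeg m d \<and> type_sums d (b p v) = 0" if p: "p \<in> Par d - {t}" "v \<in># p" for p v
  proof -
    obtain M M' where M: "b p v = xmon M - xmon M'" "has_type m p M" "has_type m p M'"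
      using adm[OF p] unfolding admissible_binomial_def by blast
    have *: "M \<in> mons m d" "mon_type M = p" "M' \<in> mons m d" "mon_type M' = p"
      using M p has_type_iff_mons[of p d m] dm by auto
    then have "b p v \<in> Rdeg m d" unfolding M(1)
      by (intro pvs.subspace_diff[OF subspace_Rdeg]) (simp_all add: xmon_in_Rdeg)
    moreover have "type_sums d (b p v) = 0"
      unfolding M(1) using * by (simp add: t.diff type_sums_xmon mons_def)
    ultimately show ?thesis by blast
  qed
  have fR: "?f \<in> Rdeg m d"
    using b_facts dm by (intro pvs.subspace_add[OF subspace_Rdeg] pvs.subspace_sum[OF subspace_Rdeg] hpoly_in_Rdeg) auto
  have tf: "type_sums d ?f = a"
  proof -
    have "type_sums d (\<Sum>p\<in>Par d - {t}. \<Sum>v\<in>set_mset p. b p v) = 0"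
      unfolding t.sum using b_facts by (intro sum.neutral ballI) auto
    then show ?thesis by (simp add: t.add type_sums_hpoly[OF a(1)])
  qed
  define gens where "gens = insert ?f (hpoly d ` (B - {a}))"
  define V where "V = pvs.span gens"
  have "gens \<subseteq> Rdeg m d" unfolding gens_def using fR hpoly_in_Rdeg[OF dm] by blast
  then have VR: "V \<subseteq> Rdeg m d" unfolding V_def by (rule pvs.span_minimal) (rule subspace_Rdeg)
  have "type_sums d ` hpoly d ` (B - {a}) = B - {a}"
    using B(1) Us(2) by (force simp: image_image type_sums_hpoly)
  then have "type_sums d ` gens = B" unfolding gens_def using tf aB by auto
  then have TV: "type_sums d ` V = U"
    unfolding V_def t.span_image[symmetric] using pvs.span_subspace[OF B(1,3) Us(1)] by simp
  have "card gens \<le> Suc (card (hpoly d ` (B - {a}) :: 'k mpol set))"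
    unfolding gens_def using B(4) by (simp add: card_insert_if)
  also have "\<dots> \<le> Suc (card (B - {a}))" using B(4) by (simp add: card_image_le)
  finally have "card gens \<le> Suc (card (B - {a}))" .
  then have "card gens \<le> r" using B(4,5) Us(3) assms(2) aB by (simp add: card_Diff_singleton)
  moreover have "pvs.dim V \<le> card gens"
    unfolding V_def by (rule pvs.dim_le_card) (use B(4) in \<open>auto simp: gens_def\<close>)
  moreover have "r \<le> pvs.dim V"
  proof -
    obtain R where "finite R" "(Rdeg m d :: 'k mpol set) \<subseteq> pvs.span R" by (rule Rdeg_finite_span)
    then have "pvs.dim V = pvs.dim {x \<in> V. type_sums d x = 0} + pvs.dim (type_sums d ` V)"
      using VR by (intro t.rank_nullity_on[of _ R]) (auto simp: V_def)
    then show ?thesis using TV Us(3) by simp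
  qed
  ultimately have "V \<in> Grass r (Rdeg m d)" using VR by (simp add: Grass_def V_def)
  moreover have "type_null m d \<subseteq> orbit_span m V"
  proof (rule binomial_type_null[OF subspace_orbit_span perm_act_orbit_span[OF VR] dm assms(1) a(1) t(1) adm])
    fix p v assume p: "p \<in> Par d - {t}" "v \<in># p"
    show "vars (b p v) \<inter> vars (hpoly d a) = {}" unfolding b_def using b1 p sub by blast
    fix p' v' assume p': "p' \<in> Par d - {t}" "v' \<in># p'" and ne: "(p, v) \<noteq> (p', v')"
    \<comment> \<open>The deleted part can be recovered from \<open>p\<close> and the remainder, so
      distinct pairs select distinct subpartitions and the disjointness clause applies.\<close>
    have "(p, p - {#v#}) \<noteq> (p', p' - {#v'#})"
    proof
      assume eq: "(p, p - {#v#}) = (p', p' - {#v'#})"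
      then have "add_mset v (p - {#v#}) = add_mset v' (p - {#v#})"
        using insert_DiffM[OF p(2)] insert_DiffM[OF p'(2)] by (metis prod.inject)
      then have "v = v'" by (metis add_mset_add_single add_left_cancel single_eq_single)
      then show False using ne eq by simp
    qed
    then show "vars (b p v) \<inter> vars (b p' v') = {}" unfolding b_def using b2 p p' sub by blast
  next
    have "?f \<in> V" unfolding V_def gens_def by (rule pvs.span_base) blast
    then show "?f \<in> orbit_span m V" using subset_orbit_span by blast
  qed
  ultimately show ?thesis using TV that by blast
qed

section \<open>Adding variables\<close>

lemma permutation_into:
  assumes "S \<subseteq> {1..n}" "card S \<le> m"
  obtains \<tau> where "\<tau> permutes {1..n :: nat}" "\<tau> ` S \<subseteq> {1..m}"
proof -
  have fS: "finite S" using assms(1) finite_subset by blast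
  \<comment> \<open>The squarefree monomial with support \<open>S\<close>: a permutation taking it
    to the standard monomial of its type takes \<open>S\<close> to an initial segment.\<close>
  define e :: mon where "e = (\<Sum>i\<in>S. Poly_Mapping.single i 1)"
  have le: "Poly_Mapping.lookup e i = (if i \<in> S then 1 else 0)" for i
    using fS by (simp add: e_def lookup_sum lookup_single when_def)
  then have k: "Poly_Mapping.keys e = S" by (auto simp: in_keys_iff split: if_splits)
  have "image_mset (Poly_Mapping.lookup e) (mset_set S) = image_mset (\<lambda>_. 1) (mset_set S)"
    using fS by (intro image_mset_cong) (simp add: le)
  then have t: "mon_type e = replicate_mset (card S) 1"
    by (simp add: mon_type_def k image_mset_const_eq)
  let ?e = "part_mon (replicate_mset (card S) 1)"
  have e': "mon_type ?e = replicate_mset (card S) 1" "Poly_Mapping.keys ?e = {1..card S}"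
    using part_mon_facts[of "replicate_mset (card S) 1"] by auto
  have cS: "card S \<le> n" using card_mono[OF _ assms(1)] by simp
  obtain \<tau> where \<tau>: "\<tau> permutes {1..n}" "perm_mon \<tau> e = ?e"
  proof (rule mon_type_eq_imp_perm)
    show "Poly_Mapping.keys e \<subseteq> {1..n}" using assms(1) by (simp only: k)
    show "Poly_Mapping.keys ?e \<subseteq> {1..n}" using cS by (simp only: e'(2) atLeastatMost_subset_iff) simp
    show "mon_type e = mon_type ?e" by (simp only: t e'(1))
  qed simp
  have "\<tau> ` S = {1..card S}" using keys_perm_mon[OF permutes_bij[OF \<tau>(1)], of e] unfolding \<tau>(2) k e'(2) ..
  then show ?thesis using that[OF \<tau>(1)] assms(2) by auto
qed

text \<open>A transposition difference in \<open>n\<close> variables is carried by a permutation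
  into the first \<open>m\<close> variables, where it lies in the kernel for \<open>m\<close>, and
  is then carried back. This takes room for \<open>d + 1\<close> variables; if \<open>m = d\<close>,
  the assumption on type sums puts every monomial of degree \<open>d\<close> into the orbit
  span.\<close>

lemma type_null_extend:
  fixes V :: "'k::field mpol set"
  assumes V: "pvs.subspace V" "V \<subseteq> Rdeg m d" and null: "type_null m d \<subseteq> orbit_span m V"
    and "d \<le> m" "m \<le> n" and m: "d < m \<or> type_sums d ` V = kvec d"
  shows "type_null n d \<subseteq> orbit_span n V"
proof (rule type_null_subsetI[OF subspace_orbit_span])
  show dn: "d \<le> n" using assms(4,5) by simp
  have Vn: "V \<subseteq> Rdeg n d" using V(2) Rdeg_mono[OF assms(5)] by blast
  note perm = perm_act_orbit_span[OF Vn]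
  fix M M' assume M: "M \<in> mons n d" "M' \<in> mons n d" "mon_type M = mon_type M'"
  show "xmon M - xmon M' \<in> orbit_span n V"
  proof (cases "d < m")
    case True
    show ?thesis
    proof (rule same_type_diff_mem[OF subspace_orbit_span _ M(1,2) M(3) refl])
      fix L a b assume L: "L \<in> mons n d" and ab: "a \<in> {1..n}" "b \<in> {1..n}"
      let ?L = "perm_mon (transpose a b) L"
      let ?S = "Poly_Mapping.keys L \<union> Poly_Mapping.keys ?L"
      have L': "?L \<in> mons n d" using L ab by (intro perm_mon_in_mons permutes_swap_id)
      have c: "card (Poly_Mapping.keys L) \<le> d" using L card_keys_le_mdeg[of L] by (simp add: mons_def)
      \<comment> \<open>A transposition brings at most one new variable into the support:
        \<open>b\<close> if \<open>a\<close> occurs in \<open>L\<close>, and otherwise at most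
        \<open>a\<close>.\<close>
      have "\<exists>x. ?S \<subseteq> insert x (Poly_Mapping.keys L)"
      proof (cases "a \<in> Poly_Mapping.keys L")
        case True
        then have "?S \<subseteq> insert b (Poly_Mapping.keys L)" by (auto simp: keys_perm_mon transpose_def)
        then show ?thesis ..
      next
        case False
        then have "?S \<subseteq> insert a (Poly_Mapping.keys L)" by (auto simp: keys_perm_mon transpose_def)
        then show ?thesis ..
      qed
      then obtain x where "?S \<subseteq> insert x (Poly_Mapping.keys L)" ..
      then have "card ?S \<le> card (insert x (Poly_Mapping.keys L))" by (intro card_mono) auto
      also have "\<dots> \<le> Suc (card (Poly_Mapping.keys L))" by (simp add: card_insert_if)
      also have "\<dots> \<le> m" using c True by simp
      finally have "card ?S \<le> m" .
      moreover have "?S \<subseteq> {1..n}" using L L' by (simp add: mons_def)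
      ultimately obtain \<tau> where \<tau>: "\<tau> permutes {1..n}" "\<tau> ` ?S \<subseteq> {1..m}" using permutation_into by metis
      have bt: "bij \<tau>" "bij (inv_into UNIV \<tau>)" using \<tau>(1) by (auto intro: permutes_bij bij_imp_bij_inv)
      have inv_tau: "perm_mon (inv_into UNIV \<tau>) (perm_mon \<tau> e) = e" for e
        using bt by (simp add: perm_mon_comp inj_iff[THEN iffD1] bij_is_inj)
      have "xmon (perm_mon \<tau> L) - xmon (perm_mon \<tau> ?L) \<in> (type_null m d :: 'k mpol set)"
      proof -
        have mm: "perm_mon \<tau> L \<in> mons m d" "perm_mon \<tau> ?L \<in> mons m d"
          using L L' \<tau>(2) bt(1) by (auto simp: mons_def keys_perm_mon[OF bt(1)] mdeg_perm_mon[OF bt(1)] image_Un simp del: One_nat_def)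
        interpret t: Vector_Spaces.linear pscale pscale "type_sums d :: 'k mpol \<Rightarrow> _" by (rule linear_type_sums)
        have "type_sums d (xmon (perm_mon \<tau> L) - xmon (perm_mon \<tau> ?L) :: 'k mpol) = 0"
          using mm bt(1) by (simp add: t.diff type_sums_xmon mons_def mon_type_perm_mon)
        moreover have "xmon (perm_mon \<tau> L) - xmon (perm_mon \<tau> ?L) \<in> (Rdeg m d :: 'k mpol set)"
          using mm by (intro pvs.subspace_diff[OF subspace_Rdeg]) (simp_all add: xmon_in_Rdeg)
        ultimately show ?thesis by (simp add: type_null_def)
      qed
      then have "xmon (perm_mon \<tau> L) - xmon (perm_mon \<tau> ?L) \<in> orbit_span n V"
        using null orbit_span_mono[OF assms(5)] by blast
      from perm[OF permutes_inv[OF \<tau>(1)] this] show "xmon L - xmon ?L \<in> orbit_span n V"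
        by (simp add: module_hom.diff[OF linear_perm_act[THEN Vector_Spaces.linear.axioms(3)]] inv_tau)
    qed
  next
    case False
    then have full: "type_sums d ` V = kvec d" using m by blast
    have "xmon L \<in> orbit_span n V" if L: "L \<in> mons n d" for L
    proof -
      let ?p = "mon_type L"
      have p: "?p \<in> Par d" using L by (simp add: mon_type_in_Par mons_def)
      have pm: "part_mon ?p \<in> mons m d" by (rule part_mon_in_mons[OF p assms(4)])
      have "xmon (part_mon ?p) \<in> orbit_span m V"
        unfolding orbit_span_eq[OF V null] full using pm by (simp add: xmon_in_Rdeg type_sums_in_kvec)
      then have *: "xmon (part_mon ?p) \<in> orbit_span n V" using orbit_span_mono[OF assms(5)] by blast
      obtain \<sigma> where s: "\<sigma> permutes {1..n}" "perm_mon \<sigma> (part_mon ?p) = L"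
        by (rule mon_type_eq_imp_perm[of "{1..n}" "part_mon ?p" L])
          (use L part_mon_in_mons[OF p dn] mon_type_part_mon[OF p] in \<open>auto simp: mons_def\<close>)
      show ?thesis using perm[OF s(1) *] unfolding perm_act_xmon s(2) .
    qed
    then show ?thesis using M by (intro pvs.subspace_diff[OF subspace_orbit_span]) auto
  qed
qed

text \<open>For \<open>d = 1\<close> this forces \<open>r = P(d)\<close>, the situation in which
  \<open>G\<close> consists of \<open>kvec d\<close> alone; here \<open>m\<close> may be as small as
  1.\<close>

lemma num_parts_1: "num_parts 1 = 1"
proof -
  have "Par 1 = {{#1#}}"
  proof
    show "Par 1 \<subseteq> {{#1#}}"
    proof
      fix p assume "p \<in> Par 1"
      then have p: "0 \<notin># p" "sum_mset p = 1" by (auto simp: Par_def)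
      have "p \<noteq> {#}" using p(2) by auto
      then obtain x q where q: "p = add_mset x q" by (rule multiset_nonemptyE) (metis insert_DiffM)
      have "x \<noteq> 0" "x + sum_mset q = 1" using p q by auto
      then have "x = 1" "sum_mset q = 0" by linarith+
      moreover have "q = {#}" using \<open>sum_mset q = 0\<close> p(1) q by (cases q) auto
      ultimately show "p \<in> {{#1#}}" using q by simp
    qed
  qed (simp add: Par_def)
  then show ?thesis by (simp add: num_parts_def)
qed

section \<open>Assembling the commutative diagram and the bijections\<close>

theorem theorem9p2:
  fixes G :: "(nat multiset \<Rightarrow>\<^sub>0 'k::field_char_0) set set"
    and d r m n :: nat
    and ord :: "nat multiset rel"
  assumes "d > 0" and "r > 0" and "r \<le> num_parts d"
    and "good_open r d G"
    and "linear_order_on (Par d) ord"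
    and "large_enough TYPE('k) ord d m"
    and "m \<le> n"
  shows "(bij_betw (eta m n) (SIg G r d m) (SIg G r d n))
    \<and> (pi_incl m n ` Oset G r d m \<subseteq> Oset G r d n)
    \<and> (Phi m ` Oset G r d m \<subseteq> SIg G r d m)
    \<and> (Phi n ` Oset G r d n \<subseteq> SIg G r d n)
    \<and> (alpha m d ` Oset G r d m \<subseteq> G)
    \<and> (alpha n d ` Oset G r d n \<subseteq> G)
    \<and> (\<forall>V\<in>Oset G r d m. Phi m V = Psi m d (alpha m d V))
    \<and> (\<forall>V\<in>Oset G r d n. Phi n V = Psi n d (alpha n d V))
    \<and> (\<forall>V\<in>Oset G r d m. alpha n d (pi_incl m n V) = alpha m d V)
    \<and> (\<forall>V\<in>Oset G r d m. eta m n (Phi m V) = Phi n (pi_incl m n V))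
    \<and> (\<forall>U\<in>G. eta m n (Psi m d U) = Psi n d U)
    \<and> (bij_betw (Psi m d) G (SIg G r d m))
    \<and> (bij_betw (Psi n d) G (SIg G r d n))
    \<and> (\<forall>I\<in>SIg G r d m. eta m n I \<in> SIg G r d n)"
proof -
  have dm: "d \<le> m" and dm2: "2 \<le> d \<Longrightarrow> d < m"
    by (rule large_enough_bounds[OF assms(5,6,1)])+
  have dn: "d \<le> n" using dm assms(7) by simp
  have G: "G \<noteq> {}" "G \<subseteq> Grass r (kvec d)"
    using assms(4) by (auto simp: good_open_def zariski_open_def)
  have P: "propP l Fs" if "d \<le> l" "U \<in> G" "is_basis Fs (perp l d (ident l d ` U))" for l U Fs
    using assms(4) that unfolding good_open_def Let_def by blast
  have full: "U = kvec d" if "\<not> 2 \<le> d" "U \<in> G" for U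
  proof -
    have "d = 1" using that(1) assms(1) by simp
    then have "r = num_parts d" using assms(2,3) num_parts_1 by simp
    then show ?thesis using that(2) G(2) by (intro Grass_kvec_full) auto
  qed
  have O: "V \<in> Oset G r d l \<longleftrightarrow>
      V \<in> Grass r (Rdeg l d) \<and> type_null l d \<subseteq> orbit_span l V \<and> type_sums d ` V \<in> G" if "d \<le> l" for V l
    by (rule Oset_iff[OF that assms(3) G])
  have al: "alpha l d V = type_sums d ` V" if "d \<le> l" "V \<in> Oset G r d l" for V l
    using that(2) by (intro alpha_eq that(1)) (auto simp: O[OF that(1)] Grass_def)
  have Phi: "Phi l V = Psi l d (type_sums d ` V)" if l: "d \<le> l" "m \<le> l" and V: "V \<in> Oset G r d l" for V l
  proof -
    have V': "pvs.subspace V" "V \<subseteq> Rdeg l d" "type_null l d \<subseteq> orbit_span l V" "type_sums d ` V \<in> G"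
      using V by (auto simp: O[OF l(1)] Grass_def)
    \<comment> \<open>For \<open>d \<ge> 2\<close> the bound \<open>d < m\<close> gives at least
      three variables; for \<open>d = 1\<close> the point of \<open>G\<close> is all of
      \<open>kvec d\<close>.\<close>
    have "3 \<le> l \<or> type_sums d ` V = kvec d"
      using full[OF _ V'(4)] dm2 l(2) by (cases "2 \<le> d") auto
    then show ?thesis
      unfolding Phi_def using P[OF l(1) V'(4)] by (intro sym_ideal_eq_Psi[OF V'(1-3) l(1)]) auto
  qed
  have incl: "V \<in> Oset G r d n" if V: "V \<in> Oset G r d m" for V
  proof -
    have V': "pvs.subspace V" "V \<subseteq> Rdeg m d" "type_null m d \<subseteq> orbit_span m V" "type_sums d ` V \<in> G" "pvs.dim V = r"
      using V by (auto simp: O[OF dm] Grass_def)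
    have "d < m \<or> type_sums d ` V = kvec d" using full[OF _ V'(4)] dm2 by blast
    then have "type_null n d \<subseteq> orbit_span n V" by (rule type_null_extend[OF V'(1-3) dm assms(7)])
    then show ?thesis using V' Rdeg_mono[OF assms(7), of d] by (auto simp: O[OF dn] Grass_def)
  qed
  have lift: "\<exists>V\<in>Oset G r d m. type_sums d ` V = U" if U: "U \<in> G" for U
  proof -
    obtain V where "V \<in> Grass r (Rdeg m d)" "type_null m d \<subseteq> orbit_span m V" "type_sums d ` V = U"
      by (rule Grass_lift[OF assms(1,2,5,6)]) (use U G(2) in auto)
    then show ?thesis using U O[OF dm] by blast
  qed
  have eta: "eta m n (Phi m V) = Phi n V" if "V \<in> Oset G r d m" for V
  proof -
    have "V \<subseteq> Rpoly m" using that Rdeg_subset_Rpoly by (auto simp: O[OF dm] Grass_def)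
    then show ?thesis unfolding eta_def Phi_def by (rule sym_ideal_sym_ideal[OF _ assms(7)])
  qed
  \<comment> \<open>A lift \<open>V\<close> of \<open>U\<close> in \<open>O_m\<close> stays in
    \<open>O_n\<close>, so both sides are ideals generated by the same \<open>V\<close>.\<close>
  have etaPsi: "eta m n (Psi m d U) = Psi n d U" if U: "U \<in> G" for U
  proof -
    obtain V where V: "V \<in> Oset G r d m" "type_sums d ` V = U" using lift[OF U] by blast
    show ?thesis using eta[OF V(1)] Phi[OF dm order_refl V(1)] Phi[OF dn assms(7) incl[OF V(1)]] V(2) by simp
  qed
  have SIg: "SIg G r d l = Phi l ` Oset G r d l" for l
    by (auto simp: SIg_def Phi_def)
  have bij: "bij_betw (Psi l d) G (SIg G r d l)" if l: "d \<le> l" "m \<le> l"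
    and lift': "\<And>U. U \<in> G \<Longrightarrow> \<exists>V\<in>Oset G r d l. type_sums d ` V = U" for l
    unfolding bij_betw_def
  proof
    show "inj_on (Psi l d) G"
    proof (rule inj_onI)
      \<comment> \<open>\<open>U\<close> is recovered from its ideal: a vector \<open>a\<close> lies
        in \<open>U\<close> exactly when its lift \<open>hpoly d a\<close> lies in
        \<open>Psi l d U\<close>.\<close>
      have sub: "a \<in> U'" if UU: "U \<in> G" "U' \<in> G" "Psi l d U = Psi l d U'" and a: "a \<in> U" for U U' a
      proof -
        have U: "U \<subseteq> kvec d" "pvs.subspace U" "U' \<subseteq> kvec d" "pvs.subspace U'"
          using UU(1,2) G(2) by (auto simp: Grass_def)
        have T: "type_sums d (hpoly d a) = a" using a U(1) by (intro type_sums_hpoly) blast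
        have h: "hpoly d a \<in> Rdeg l d" by (rule hpoly_in_Rdeg[OF l(1)])
        then have "hpoly d a \<in> Psi l d U"
          using a T by (auto simp: Psi_iff[OF l(1) U(1,2)] Rdeg_def)
        then show ?thesis using T by (simp add: UU(3) Psi_iff[OF l(1) U(3,4)])
      qed
      fix U U' assume "U \<in> G" "U' \<in> G" "Psi l d U = Psi l d U'"
      then show "U = U'" using sub[of U U'] sub[of U' U] by auto
    qed
    show "Psi l d ` G = SIg G r d l"
    proof
      show "Psi l d ` G \<subseteq> SIg G r d l"
        using lift' Phi[OF l] unfolding SIg by (metis (no_types, lifting) image_eqI image_subsetI)
      show "SIg G r d l \<subseteq> Psi l d ` G"
        using Phi[OF l] O[OF l(1)] unfolding SIg by auto
    qed
  qed
  have bm: "bij_betw (Psi m d) G (SIg G r d m)" by (rule bij[OF dm order_refl lift])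
  have bn: "bij_betw (Psi n d) G (SIg G r d n)"
    by (rule bij[OF dn assms(7)]) (use lift incl in blast)
  have beta: "bij_betw (eta m n) (SIg G r d m) (SIg G r d n)"
  \<comment> \<open>On \<open>G\<close> the composite of \<open>eta m n\<close> with the bijection
    \<open>Psi m d\<close> is the bijection \<open>Psi n d\<close>, so \<open>eta m n\<close> is
    itself a bijection.\<close>
  proof (rule bij_betw_comp_iff[OF bm, THEN iffD2])
    show "bij_betw (eta m n \<circ> Psi m d) G (SIg G r d n)"
      using bn by (rule bij_betw_cong[THEN iffD1, rotated]) (simp add: etaPsi)
  qed
  show ?thesis
  proof (intro conjI ballI)
    show "eta m n I \<in> SIg G r d n" if "I \<in> SIg G r d m" for I
      using bij_betw_apply[OF beta that] .
  qed (use beta bm bn incl eta etaPsi al[OF dm] al[OF dn] Phi[OF dm order_refl] Phi[OF dn assms(7)] O[OF dm] O[OF dn]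
      in \<open>auto simp: pi_incl_def SIg\<close>)
qed

end
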